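(* Let $\mathcal{U}$ be the $\alpha$-hypercircle associated to the unit $u(t)=\frac{at+b}{t+d}\in\mathbb{K}(\alpha)(t)$ and let $r=[\mathbb{K}(-d):\mathbb{K}]$. Then: 1. $\mathcal{U}$ defines a curve of degree $r$. 2. $\mathcal{U}$ is contained in a linear variety of dimension $r$ and it is not contained in a linear variety of dimension $r-1$. 3. $\mathcal{U}$ (its projective closure) is a regular curve in $\mathbb{P}(\mathbb{F})^n$. 4. The Hilbert function of (the projective closure of) $\mathcal{U}$ is equal to its Hilbert polynomial, and $h_{\mathcal{U}}(m)=mr+1$.
   Context: $\mathbb{K}$ is a field of characteristic zero, $\mathbb{L}=\mathbb{K}(\alpha)$ is a finite algebraic extension of $\mathbb{K}$ of degree $n$ with primitive element $\alpha$, and $\mathbb{F}$ is the algebraic closure of $\mathbb{K}$. A unit of $\mathbb{L}(t)$ (under composition) is a rational function $u(t)=\frac{at+b}{ct+d}$ with $a,b,c,d\in\mathbb{L}$, $ad-bc\neq 0$. Every unit $u(t)\in\mathbb{L}(t)$ is written uniquely as $u(t)=\sum_{i=0}^{n-1}\phi_i(t)\alpha^i$ with $\phi_i(t)\in\mathbb{K}(t)$, and the $\alpha$-hypercircle generated by (or associated to) $u(t)$ is the rational curve $\mathcal{U}\subseteq\mathbb{F}^n$ parametrized by $(\phi_0(t),\ldots,\phi_{n-1}(t))$ (Zariski closure of the image). Linear varieties in $\mathbb{F}^n$ are affine-linear subspaces. The Hilbert function $h_{\mathcal{U}}(m)$ is the dimension over $\mathbb{F}$ of the degree $m$ part of the homogeneous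 coordinate ring of the projective closure of $\mathcal{U}$ in $\mathbb{P}(\mathbb{F})^n$. *)

theory Defs
  imports
    "HOL-Algebra.Generated_Fields"
    "HOL-Algebra.Algebraic_Closure_Type"
    "HOL-Library.Function_Algebras"
    "HOL-Library.Poly_Mapping"
begin

section \<open>Field extensions and rational functions\<close>

text \<open>
  The algebraically closed field \<open>F\<close> is the type \<open>'f\<close>; the fields \<open>K\<close> and \<open>L = K(\<alpha>)\<close> are
  subfields of it.
\<close>

abbreviation adjoin :: "'f::field set \<Rightarrow> 'f \<Rightarrow> 'f set" where
  "adjoin K x \<equiv> generate_field ring_of_type_algebra (insert x K)"

abbreviation ext_degree :: "'f::field set \<Rightarrow> 'f set \<Rightarrow> nat" where
  "ext_degree K E \<equiv> ring.dim ring_of_type_algebra K E"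

definition ratfuns_over :: "'f::field set \<Rightarrow> 'f poly fract set" where
  "ratfuns_over K =
     {Fract p q | p q. range (coeff p) \<subseteq> K \<and> range (coeff q) \<subseteq> K \<and> q \<noteq> 0}"

text \<open>
  Every representation of \<open>\<phi>\<close> as a quotient is admitted, so \<open>\<phi>\<close> has a value at \<open>t\<close> iff the
  denominator in lowest terms does not vanish at \<open>t\<close>.
\<close>

definition ratfun_val :: "'f::field poly fract \<Rightarrow> 'f \<Rightarrow> 'f \<Rightarrow> bool" where
  "ratfun_val \<phi> t y \<longleftrightarrow> (\<exists>p q. poly q t \<noteq> 0 \<and> \<phi> = Fract p q \<and> y = poly p t / poly q t)"

section \<open>Affine space and multivariate polynomials\<close>

text \<open>\<open>F\<^sup>n\<close> consists of the sequences that vanish from index \<open>n\<close> on.\<close>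

definition affine_space :: "nat \<Rightarrow> (nat \<Rightarrow> 'f::field) set" where
  "affine_space n = {x. \<forall>i\<ge>n. x i = 0}"

definition vscale :: "'f::field \<Rightarrow> (nat \<Rightarrow> 'f) \<Rightarrow> nat \<Rightarrow> 'f" where
  "vscale c v = (\<lambda>i. c * v i)"

interpretation vec: vector_space vscale
  by unfold_locales (simp_all add: vscale_def fun_eq_iff algebra_simps)

definition linear_variety :: "nat \<Rightarrow> nat \<Rightarrow> (nat \<Rightarrow> 'f::field) set \<Rightarrow> bool" where
  "linear_variety n k V \<longleftrightarrow>
     (\<exists>p \<in> affine_space n. \<exists>W. W \<subseteq> affine_space n \<and> vec.subspace W \<and> vec.dim W = k \<and>
        V = (\<lambda>w. p + w) ` W)"

type_synonym 'f mpol = "(nat \<Rightarrow>\<^sub>0 nat) \<Rightarrow>\<^sub>0 'f"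

definition mpols :: "nat \<Rightarrow> 'f::field mpol set" where
  "mpols N = {p. \<forall>m \<in> Poly_Mapping.keys p. Poly_Mapping.keys m \<subseteq> {..<N}}"

definition mpol_ring :: "nat \<Rightarrow> 'f::field mpol ring" where
  "mpol_ring N = ring_of_type_algebra\<lparr>carrier := mpols N\<rparr>"

definition mpol_eval :: "'f::field mpol \<Rightarrow> (nat \<Rightarrow> 'f) \<Rightarrow> 'f" where
  "mpol_eval p x =
     (\<Sum>m \<in> Poly_Mapping.keys p. Poly_Mapping.lookup p m *
        (\<Prod>i \<in> Poly_Mapping.keys m. x i ^ Poly_Mapping.lookup m i))"

definition mpol_deriv :: "nat \<Rightarrow> 'f::field mpol \<Rightarrow> 'f mpol" where
  "mpol_deriv i p =
     (\<Sum>m \<in> Poly_Mapping.keys p. Poly_Mapping.single (m - Poly_Mapping.single i 1)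
        (of_nat (Poly_Mapping.lookup m i) * Poly_Mapping.lookup p m))"

definition homogeneous :: "nat \<Rightarrow> 'f::field mpol \<Rightarrow> bool" where
  "homogeneous k p \<longleftrightarrow>
     (\<forall>m \<in> Poly_Mapping.keys p. (\<Sum>i \<in> Poly_Mapping.keys m. Poly_Mapping.lookup m i) = k)"

definition affine_alg_set :: "nat \<Rightarrow> (nat \<Rightarrow> 'f::field) set \<Rightarrow> bool" where
  "affine_alg_set n Y \<longleftrightarrow>
     (\<exists>P \<subseteq> mpols n. Y = {x \<in> affine_space n. \<forall>p \<in> P. mpol_eval p x = 0})"

section \<open>Projective space\<close>

text \<open>
  The points of \<open>P(F)\<^sup>n\<close> are the lines through the origin of \<open>F\<^bsup>n+1\<^esup>\<close>; the homogeneous coordinates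
  have the indices \<open>0, \<dots>, n\<close>, and \<open>F\<^sup>n\<close> is embedded as the chart where coordinate 0 is nonzero.
\<close>

definition proj_space :: "nat \<Rightarrow> (nat \<Rightarrow> 'f::field) set set" where
  "proj_space n = {vec.span {v} | v. v \<in> affine_space (Suc n) \<and> v \<noteq> 0}"

definition proj_embed :: "(nat \<Rightarrow> 'f::field) \<Rightarrow> (nat \<Rightarrow> 'f) set" where
  "proj_embed x = vec.span {case_nat 1 x}"

definition vanishing_forms :: "nat \<Rightarrow> (nat \<Rightarrow> 'f::field) set set \<Rightarrow> 'f mpol set" where
  "vanishing_forms n Y =
     {f \<in> mpols (Suc n). (\<exists>k. homogeneous k f) \<and> (\<forall>l \<in> Y. \<forall>v \<in> l. mpol_eval f v = 0)}"

definition proj_alg_set :: "nat \<Rightarrow> (nat \<Rightarrow> 'f::field) set set \<Rightarrow> bool" where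
  "proj_alg_set n Y \<longleftrightarrow>
     (\<exists>P \<subseteq> mpols (Suc n). (\<forall>f \<in> P. \<exists>k. homogeneous k f) \<and>
        Y = {l \<in> proj_space n. \<forall>f \<in> P. \<forall>v \<in> l. mpol_eval f v = 0})"

definition proj_closure :: "nat \<Rightarrow> (nat \<Rightarrow> 'f::field) set \<Rightarrow> (nat \<Rightarrow> 'f) set set" where
  "proj_closure n S = proj_alg_set n hull (proj_embed ` S)"

section \<open>Curves\<close>

text \<open>
  In the following three definitions, \<open>C\<close> is the predicate of being a closed set, so that they
  apply to both affine and projective algebraic sets.
\<close>

definition irreducible_closed :: "('p set \<Rightarrow> bool) \<Rightarrow> 'p set \<Rightarrow> bool" where
  "irreducible_closed C Y \<longleftrightarrow>
     C Y \<and> Y \<noteq> {} \<and> (\<forall>A B. C A \<longrightarrow> C B \<longrightarrow> Y = A \<union> B \<longrightarrow> Y = A \<or> Y = B)"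

definition irreducible_chain ::
    "('p set \<Rightarrow> bool) \<Rightarrow> 'p set \<Rightarrow> nat \<Rightarrow> (nat \<Rightarrow> 'p set) \<Rightarrow> bool" where
  "irreducible_chain C Y k Z \<longleftrightarrow>
     (\<forall>i\<le>k. irreducible_closed C (Z i) \<and> Z i \<subseteq> Y) \<and> (\<forall>i<k. Z i \<subset> Z (Suc i))"

definition irreducible_curve :: "('p set \<Rightarrow> bool) \<Rightarrow> 'p set \<Rightarrow> bool" where
  "irreducible_curve C Y \<longleftrightarrow> irreducible_closed C Y \<and>
     (\<exists>Z. irreducible_chain C Y 1 Z) \<and> (\<nexists>Z. irreducible_chain C Y 2 Z)"

text \<open>
  The degree of a projective curve is the number of points in which a general hyperplane
  \<open>c\<^sub>0 x\<^sub>0 + \<dots> + c\<^sub>n x\<^sub>n = 0\<close> meets it; general means that \<open>c\<close> lies in some nonempty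
  principal open set \<open>G \<noteq> 0\<close> of coefficient vectors.
\<close>

definition has_degree :: "nat \<Rightarrow> (nat \<Rightarrow> 'f::field) set set \<Rightarrow> nat \<Rightarrow> bool" where
  "has_degree n Y r \<longleftrightarrow>
     (\<exists>G \<in> mpols (Suc n). G \<noteq> 0 \<and>
        (\<forall>c \<in> affine_space (Suc n). mpol_eval G c \<noteq> 0 \<longrightarrow>
           (let H = {l \<in> Y. \<forall>v \<in> l. (\<Sum>i\<le>n. c i * v i) = 0} in finite H \<and> card H = r)))"

section \<open>Homogeneous coordinate ring and Hilbert function\<close>

definition homogeneous_ideal :: "nat \<Rightarrow> (nat \<Rightarrow> 'f::field) set set \<Rightarrow> 'f mpol set" where
  "homogeneous_ideal n Y = genideal (mpol_ring (Suc n)) (vanishing_forms n Y)"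

definition coord_ring :: "nat \<Rightarrow> (nat \<Rightarrow> 'f::field) set set \<Rightarrow> 'f mpol set ring" where
  "coord_ring n Y = mpol_ring (Suc n) Quot homogeneous_ideal n Y"

definition coord_class :: "nat \<Rightarrow> (nat \<Rightarrow> 'f::field) set set \<Rightarrow> 'f mpol \<Rightarrow> 'f mpol set" where
  "coord_class n Y f = a_r_coset (mpol_ring (Suc n)) (homogeneous_ideal n Y) f"

text \<open>
  The dimension is taken over the copy of \<open>F\<close> inside the coordinate ring that is formed by the
  residue classes of the constant polynomials.
\<close>

definition hilbert_function :: "nat \<Rightarrow> (nat \<Rightarrow> 'f::field) set set \<Rightarrow> nat \<Rightarrow> nat" where
  "hilbert_function n Y m =
     ring.dim (coord_ring n Y)
       (coord_class n Y ` range (Poly_Mapping.single 0))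
       (coord_class n Y ` {f \<in> mpols (Suc n). homogeneous m f})"

definition hilbert_polynomial :: "nat \<Rightarrow> (nat \<Rightarrow> 'f::field) set set \<Rightarrow> rat poly" where
  "hilbert_polynomial n Y =
     (THE P. \<exists>m0. \<forall>m\<ge>m0. of_nat (hilbert_function n Y m) = poly P (of_nat m))"

text \<open>
  Jacobian criterion: at every point, the Jacobian matrix of the elements of the homogeneous ideal
  has rank \<open>n - 1\<close>, the codimension of a curve.
\<close>

definition gradient :: "nat \<Rightarrow> 'f::field mpol \<Rightarrow> (nat \<Rightarrow> 'f) \<Rightarrow> nat \<Rightarrow> 'f" where
  "gradient n f v = (\<lambda>i. if i \<le> n then mpol_eval (mpol_deriv i f) v else 0)"

definition regular_curve :: "nat \<Rightarrow> (nat \<Rightarrow> 'f::field) set set \<Rightarrow> bool" where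
  "regular_curve n Y \<longleftrightarrow> irreducible_curve (proj_alg_set n) Y \<and>
     (\<forall>l \<in> Y. \<forall>v \<in> l. v \<noteq> 0 \<longrightarrow>
        vec.dim ((\<lambda>f. gradient n f v) ` homogeneous_ideal n Y) = n - 1)"

section \<open>Hypercircles\<close>

text \<open>
  The coordinates of \<open>u\<close> over \<open>K(t)\<close> with respect to the basis \<open>1, \<alpha>, \<dots>, \<alpha>\<^bsup>n-1\<^esup>\<close> of \<open>L(t)\<close>;
  padding with 0 from index \<open>n\<close> on makes the function \<open>\<phi>\<close> unique.
\<close>

definition hyper_coords :: "'f::field set \<Rightarrow> 'f \<Rightarrow> 'f poly fract \<Rightarrow> nat \<Rightarrow> 'f poly fract" where
  "hyper_coords K \<alpha> u = (let n = ext_degree K (adjoin K \<alpha>) in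
     (THE \<phi>. (\<forall>i<n. \<phi> i \<in> ratfuns_over K) \<and> (\<forall>i\<ge>n. \<phi> i = 0) \<and>
        u = (\<Sum>i<n. \<phi> i * Fract [:\<alpha> ^ i:] 1)))"

definition hypercircle :: "'f::field set \<Rightarrow> 'f \<Rightarrow> 'f poly fract \<Rightarrow> (nat \<Rightarrow> 'f) set" where
  "hypercircle K \<alpha> u = (let n = ext_degree K (adjoin K \<alpha>) in
     affine_alg_set n hull
       {x \<in> affine_space n. \<exists>t. \<forall>i<n. ratfun_val (hyper_coords K \<alpha> u i) t (x i)})"

end

theory Submission
  imports Defs
begin

text \<open>
  Let \<open>M\<close> be the minimal polynomial of \<open>- d\<close> over \<open>K\<close> and write \<open>u = a + e / (t + d)\<close> with
  \<open>e = b - a d \<noteq> 0\<close>. The coordinates of \<open>u\<close> have the common denominator \<open>M\<close>, and their numerators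
  together with \<open>M\<close> span the polynomials of degree at most \<open>r\<close>, because the coefficients of
  \<open>e M / (t + d)\<close> are linearly independent over \<open>K\<close>. Hence the projective closure of the hypercircle
  is the image of the rational normal curve of degree \<open>r\<close> under an injective linear map, given by a
  matrix \<open>B\<close> with left inverse \<open>A\<close>. Hyperplanes pull back to the binary forms of degree \<open>r\<close>, and forms
  of degree \<open>m\<close> pull back onto the binary forms of degree \<open>m r\<close>; this gives the degree, the linear
  hull and the Hilbert function. At each point the equations of the curve generate all linear forms
  that vanish on the tangent plane of the cone, which is the Jacobian criterion.
\<close>

section \<open>Evaluation, differentiation and homogeneity of polynomials\<close>

text \<open>The arithmetic provides independence over \<open>K\<close>: up to order, the
  coefficients of M / (t + d) arise from 1, - d, ..., (- d)^(r-1) by a unitriangular matrix over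
  \<open>K\<close>. The geometry needs independence over the large field, and of vectors rather than
  numbers. Expanding each coefficient in powers of \<alpha> turns it into a column over
  \<open>K\<close>, and a left inverse over \<open>K\<close> keeps these columns independent over
  every extension. The same left inverse yields linear forms that restrict to the monomials s^(r-j)
  t^j on the cone, so the later claims can be checked with explicit forms. Three obstacles shape the
  rest. A general hyperplane has to be witnessed by one nonzero polynomial; it is extracted by
  elimination from the single hyperplane that cuts out t^r - s^r. The affine curve is defined as a
  closure; it is never computed, only bracketed between the parametrized points and the zeros of
  explicit equations. Finally, a single coordinate may be defined at a root of M after cancellation,
  so the domain of the parametrization needs an argument.\<close>

definition lin_ext :: "((nat \<Rightarrow>\<^sub>0 nat) \<Rightarrow> 'f::field) \<Rightarrow> 'f mpol \<Rightarrow> 'f" where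
  "lin_ext \<phi> p = (\<Sum>m\<in>Poly_Mapping.keys p. Poly_Mapping.lookup p m * \<phi> m)"

definition mon_eval :: "(nat \<Rightarrow>\<^sub>0 nat) \<Rightarrow> (nat \<Rightarrow> 'f::field) \<Rightarrow> 'f" where
  "mon_eval m x = (\<Prod>i\<in>Poly_Mapping.keys m. x i ^ Poly_Mapping.lookup m i)"

text \<open>If variable \<open>i\<close> does not occur in \<open>m\<close>, the truncated
  subtraction leaves \<open>m\<close> unchanged, but the factor \<open>of_nat 0\<close> removes the
  term.\<close>

definition mon_deriv :: "nat \<Rightarrow> (nat \<Rightarrow>\<^sub>0 nat) \<Rightarrow> (nat \<Rightarrow> 'f::field) \<Rightarrow> 'f" where
  "mon_deriv i m x =
     of_nat (Poly_Mapping.lookup m i) * mon_eval (m - Poly_Mapping.single i 1) x"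

definition mon_degree :: "(nat \<Rightarrow>\<^sub>0 nat) \<Rightarrow> nat" where
  "mon_degree m = (\<Sum>i\<in>Poly_Mapping.keys m. Poly_Mapping.lookup m i)"

abbreviation mconst :: "'f::field \<Rightarrow> 'f mpol" where
  "mconst c \<equiv> Poly_Mapping.single 0 c"

abbreviation mvar :: "nat \<Rightarrow> 'f::field mpol" where
  "mvar i \<equiv> Poly_Mapping.single (Poly_Mapping.single i 1) 1"

lemma lin_ext_superset:
  assumes "finite S" "Poly_Mapping.keys p \<subseteq> S"
  shows "lin_ext \<phi> p = (\<Sum>m\<in>S. Poly_Mapping.lookup p m * \<phi> m)"
  unfolding lin_ext_def using assms
  by (intro sum.mono_neutral_left) (auto simp: in_keys_iff)

lemma lin_ext_zero [simp]: "lin_ext \<phi> 0 = 0"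
  by (simp add: lin_ext_def)

lemma lin_ext_add: "lin_ext \<phi> (p + q) = lin_ext \<phi> p + lin_ext \<phi> q"
proof -
  let ?S = "Poly_Mapping.keys p \<union> Poly_Mapping.keys q"
  have "Poly_Mapping.keys (p + q) \<subseteq> ?S" by (rule keys_add)
  then show ?thesis
    by (simp add: lin_ext_superset[of ?S] lookup_add distrib_right sum.distrib)
qed

lemma lin_ext_single [simp]: "lin_ext \<phi> (Poly_Mapping.single m c) = c * \<phi> m"
  by (simp add: lin_ext_superset[of "{m}"] lookup_single)

text \<open>Evaluation and evaluated derivative are both linear extensions from monomials, so the
  additivity of \<open>lin_ext\<close> serves both.\<close>

lemma mpol_eval_lin_ext: "mpol_eval p x = lin_ext (\<lambda>m. mon_eval m x) p"
  by (simp add: mpol_eval_def lin_ext_def mon_eval_def)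

lemma mpol_eval_zero [simp]: "mpol_eval 0 x = 0"
  and mpol_eval_add [simp]: "mpol_eval (p + q) x = mpol_eval p x + mpol_eval q x"
  and mpol_eval_single: "mpol_eval (Poly_Mapping.single m c) x = c * mon_eval m x"
  by (simp_all add: mpol_eval_lin_ext lin_ext_add)

lemma mpol_eval_sum [simp]: "mpol_eval (sum f S) x = (\<Sum>i\<in>S. mpol_eval (f i) x)"
  by (induction S rule: infinite_finite_induct) auto

lemma mpol_eval_deriv_lin_ext: "mpol_eval (mpol_deriv i p) x = lin_ext (\<lambda>m. mon_deriv i m x) p"
  by (simp add: mpol_deriv_def mpol_eval_single lin_ext_def mon_deriv_def mult_ac)

lemma mpol_eq_sum_single:
  "p = (\<Sum>m\<in>Poly_Mapping.keys p. Poly_Mapping.single m (Poly_Mapping.lookup p m))"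
proof (rule poly_mapping_eqI)
  fix k
  show "Poly_Mapping.lookup p k = Poly_Mapping.lookup
    (\<Sum>m\<in>Poly_Mapping.keys p. Poly_Mapping.single m (Poly_Mapping.lookup p m)) k"
    by (auto simp: lookup_sum lookup_single when_def in_keys_iff)
qed

section \<open>Polynomials in N variables: closure properties and induction\<close>

lemma zero_in_mpols [simp]: "0 \<in> mpols N"
  by (simp add: mpols_def)

lemma single_in_mpols: "Poly_Mapping.keys m \<subseteq> {..<N} \<Longrightarrow> Poly_Mapping.single m c \<in> mpols N"
  by (simp add: mpols_def)

lemma mconst_in_mpols [simp]: "mconst c \<in> mpols N"
  by (simp add: single_in_mpols)

lemma one_in_mpols [simp]: "1 \<in> mpols N"
  by (metis mconst_in_mpols single_one)

lemma mvar_in_mpols: "i < N \<Longrightarrow> mvar i \<in> mpols N"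
  by (simp add: single_in_mpols)

lemma add_in_mpols: "p \<in> mpols N \<Longrightarrow> q \<in> mpols N \<Longrightarrow> p + q \<in> mpols N"
  unfolding mpols_def using keys_add[of p q] by blast

lemma uminus_in_mpols: "p \<in> mpols N \<Longrightarrow> - p \<in> mpols N"
  by (simp add: mpols_def in_keys_iff)

lemma diff_in_mpols: "p \<in> mpols N \<Longrightarrow> q \<in> mpols N \<Longrightarrow> p - q \<in> mpols N"
  using add_in_mpols[of p N "-q"] uminus_in_mpols[of q N] by simp

lemma mult_in_mpols:
  assumes "p \<in> mpols N" "q \<in> mpols N"
  shows "p * q \<in> mpols N"
  unfolding mpols_def
proof (intro CollectI ballI)
  fix m assume "m \<in> Poly_Mapping.keys (p * q)"
  then obtain a b where "m = a + b" "a \<in> Poly_Mapping.keys p" "b \<in> Poly_Mapping.keys q"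
    using keys_mult[of p q] by blast
  then show "Poly_Mapping.keys m \<subseteq> {..<N}"
    using assms keys_add[of a b] unfolding mpols_def by blast
qed

lemma sum_in_mpols: "(\<And>i. i \<in> S \<Longrightarrow> f i \<in> mpols N) \<Longrightarrow> sum f S \<in> mpols N"
  by (induction S rule: infinite_finite_induct) (auto intro: add_in_mpols)

lemma power_in_mpols: "p \<in> mpols N \<Longrightarrow> p ^ k \<in> mpols N"
  by (induction k) (auto intro: mult_in_mpols)

lemma mpols_induct_single [consumes 1, case_names zero single add]:
  assumes p: "p \<in> mpols N" and zero: "P 0"
    and single: "\<And>m c. Poly_Mapping.keys m \<subseteq> {..<N} \<Longrightarrow> P (Poly_Mapping.single m c)"
    and add: "\<And>p q. p \<in> mpols N \<Longrightarrow> q \<in> mpols N \<Longrightarrow> P p \<Longrightarrow> P q \<Longrightarrow> P (p + q)"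
  shows "P p"
proof -
  let ?s = "\<lambda>S. \<Sum>m\<in>S. Poly_Mapping.single m (Poly_Mapping.lookup p m)"
  \<comment> \<open>Membership of the partial sums is carried along because the case
    \<open>add\<close> may assume it.\<close>
  have "P (?s S) \<and> ?s S \<in> mpols N" if "finite S" "S \<subseteq> Poly_Mapping.keys p" for S
    using that
  proof (induction S rule: finite_induct)
    case (insert m S)
    then have m: "Poly_Mapping.keys m \<subseteq> {..<N}" using p by (auto simp: mpols_def)
    have IH: "P (?s S)" "?s S \<in> mpols N" using insert by auto
    have "P (Poly_Mapping.single m (Poly_Mapping.lookup p m) + ?s S)"
      by (rule add[OF single_in_mpols[OF m] IH(2) single[OF m] IH(1)])
    then show ?case
      using insert.hyps IH by (auto intro: add_in_mpols single_in_mpols[OF m])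
  qed (auto simp: zero)
  then have "P (?s (Poly_Mapping.keys p))" by simp
  then show ?thesis using mpol_eq_sum_single[of p] by simp
qed

lemma mpol_induct_single [case_names zero single add]:
  assumes "P 0" "\<And>m c. P (Poly_Mapping.single m c)" "\<And>p q. P p \<Longrightarrow> P q \<Longrightarrow> P (p + q)"
  shows "P (p :: 'f::field mpol)"
proof -
  let ?s = "\<lambda>S. \<Sum>m\<in>S. Poly_Mapping.single m (Poly_Mapping.lookup p m)"
  have "P (?s S)" if "finite S" for S
    using that by (induction S rule: finite_induct) (auto intro: assms)
  then show ?thesis using mpol_eq_sum_single[of p] by (metis finite_keys)
qed

lemma mon_eval_superset:
  assumes "finite S" "Poly_Mapping.keys m \<subseteq> S"
  shows "mon_eval m x = (\<Prod>i\<in>S. x i ^ Poly_Mapping.lookup m i)"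
  unfolding mon_eval_def using assms
  by (intro prod.mono_neutral_left) (auto simp: in_keys_iff)

lemma mon_eval_zero [simp]: "mon_eval 0 x = 1"
  by (simp add: mon_eval_def)

lemma mon_eval_single [simp]: "mon_eval (Poly_Mapping.single i k) x = x i ^ k"
  by (simp add: mon_eval_superset[of "{i}"])

lemma mon_eval_add: "mon_eval (m + m') x = mon_eval m x * mon_eval m' x"
proof -
  let ?S = "Poly_Mapping.keys m \<union> Poly_Mapping.keys m'"
  have "Poly_Mapping.keys (m + m') \<subseteq> ?S" by (rule keys_add)
  then show ?thesis
    by (simp add: mon_eval_superset[of ?S] lookup_add power_add prod.distrib)
qed

lemma mon_degree_superset:
  assumes "finite S" "Poly_Mapping.keys m \<subseteq> S"
  shows "mon_degree m = (\<Sum>i\<in>S. Poly_Mapping.lookup m i)"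
  unfolding mon_degree_def using assms
  by (intro sum.mono_neutral_left) (auto simp: in_keys_iff)

lemma mon_degree_zero [simp]: "mon_degree 0 = 0"
  by (simp add: mon_degree_def)

lemma mon_degree_single [simp]: "mon_degree (Poly_Mapping.single i k) = k"
  by (simp add: mon_degree_superset[of "{i}"])

lemma mon_degree_add: "mon_degree (m + m') = mon_degree m + mon_degree m'"
proof -
  let ?S = "Poly_Mapping.keys m \<union> Poly_Mapping.keys m'"
  have "Poly_Mapping.keys (m + m') \<subseteq> ?S" by (rule keys_add)
  then show ?thesis
    by (simp add: mon_degree_superset[of ?S] lookup_add sum.distrib)
qed

lemma mon_minus_single:
  assumes "Poly_Mapping.lookup m i > 0"
  shows "m = (m - Poly_Mapping.single i 1) + Poly_Mapping.single i (1::nat)"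
  using assms by (intro poly_mapping_eqI) (auto simp: lookup_add lookup_minus lookup_single when_def)

text \<open>The product rule on monomials. Truncated subtraction of exponents forces the distinction
  of which factors contain variable \<open>i\<close>.\<close>

lemma mon_deriv_add:
  "mon_deriv i (m + m') x = mon_deriv i m x * mon_eval m' x + mon_eval m x * mon_deriv i m' x"
proof -
  have *: "mon_deriv i (a + b) x =
      of_nat (Poly_Mapping.lookup a i + Poly_Mapping.lookup b i) *
      mon_eval (a - Poly_Mapping.single i 1) x * mon_eval b x"
    if "Poly_Mapping.lookup a i > 0" for a b :: "nat \<Rightarrow>\<^sub>0 nat"
  proof -
    have "a + b - Poly_Mapping.single i 1 = (a - Poly_Mapping.single i 1) + b"
      using that by (intro poly_mapping_eqI) (auto simp: lookup_add lookup_minus lookup_single when_def)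
    then show ?thesis
      by (simp add: mon_deriv_def lookup_add mon_eval_add algebra_simps)
  qed
  have ex: "mon_eval a x = mon_eval (a - Poly_Mapping.single i 1) x * x i"
    if "Poly_Mapping.lookup a i > 0" for a :: "nat \<Rightarrow>\<^sub>0 nat"
    using mon_minus_single[OF that] mon_eval_add[of "a - Poly_Mapping.single i 1" "Poly_Mapping.single i 1" x]
    by simp
  consider "Poly_Mapping.lookup m i > 0" "Poly_Mapping.lookup m' i > 0"
    | "Poly_Mapping.lookup m i > 0" "Poly_Mapping.lookup m' i = 0"
    | "Poly_Mapping.lookup m i = 0" "Poly_Mapping.lookup m' i > 0"
    | "Poly_Mapping.lookup m i = 0" "Poly_Mapping.lookup m' i = 0" by blast
  then show ?thesis
  proof cases
    case 1
    then show ?thesis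
      using *[of m m'] by (simp add: mon_deriv_def ex algebra_simps)
  next
    case 2
    then show ?thesis
      using *[of m m'] by (simp add: mon_deriv_def algebra_simps)
  next
    case 3
    then show ?thesis
      using *[of m' m] by (simp add: mon_deriv_def add.commute[of m' m] mult_ac)
  next
    case 4
    then show ?thesis by (simp add: mon_deriv_def lookup_add)
  qed
qed

section \<open>Evaluation as a ring homomorphism, partial derivatives as derivations\<close>

lemma mpol_eval_mult [simp]: "mpol_eval (p * q) x = mpol_eval p x * mpol_eval q x"
proof (induction p rule: mpol_induct_single)
  case (single m c)
  show ?case
  proof (induction q rule: mpol_induct_single)
    case (single m' c')
    show ?case by (simp add: mult_single mpol_eval_single mon_eval_add)
  qed (simp_all add: distrib_left)
qed (simp_all add: distrib_right)

lemma mpol_eval_mconst [simp]: "mpol_eval (mconst c) x = c"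
  and mpol_eval_mvar [simp]: "mpol_eval (mvar i) x = x i"
  by (simp_all add: mpol_eval_single)

lemma mpol_eval_mvar_Suc [simp]:
  "mpol_eval (Poly_Mapping.single (Poly_Mapping.single i (Suc 0)) 1) x = x i"
  by (simp add: mpol_eval_single)

lemma mpol_eval_one [simp]: "mpol_eval 1 x = 1"
  by (metis mpol_eval_mconst single_one)

lemma mpol_eval_uminus [simp]: "mpol_eval (- p) x = - mpol_eval p x"
  using mpol_eval_add[of p "-p" x] by (simp add: eq_neg_iff_add_eq_0 add.commute)

lemma mpol_eval_diff [simp]: "mpol_eval (p - q) x = mpol_eval p x - mpol_eval q x"
  using mpol_eval_add[of p "-q" x] by simp

lemma mpol_eval_power [simp]: "mpol_eval (p ^ k) x = mpol_eval p x ^ k"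
  by (induction k) auto

lemma mpol_eval_deriv_add [simp]:
  "mpol_eval (mpol_deriv i (p + q)) x = mpol_eval (mpol_deriv i p) x + mpol_eval (mpol_deriv i q) x"
  by (simp add: mpol_eval_deriv_lin_ext lin_ext_add)

lemma mpol_eval_deriv_single:
  "mpol_eval (mpol_deriv i (Poly_Mapping.single m c)) x = c * mon_deriv i m x"
  by (simp add: mpol_eval_deriv_lin_ext)

lemma mpol_eval_deriv_zero [simp]: "mpol_eval (mpol_deriv i 0) x = 0"
  by (simp add: mpol_eval_deriv_lin_ext)

lemma mpol_eval_deriv_mult [simp]:
  "mpol_eval (mpol_deriv i (p * q)) x =
     mpol_eval (mpol_deriv i p) x * mpol_eval q x + mpol_eval p x * mpol_eval (mpol_deriv i q) x"
proof (induction p rule: mpol_induct_single)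
  case (single m c)
  show ?case
  proof (induction q rule: mpol_induct_single)
    case (single m' c')
    show ?case
      by (simp add: mult_single mpol_eval_single mpol_eval_deriv_single mon_deriv_add distrib_left)
  next
    case (add p q)
    then show ?case by (simp add: distrib_left)
  qed simp
next
  case (add p q)
  then show ?case by (simp add: distrib_right)
qed simp

lemma mpol_eval_deriv_mconst [simp]: "mpol_eval (mpol_deriv i (mconst c)) x = 0"
  by (simp add: mpol_eval_deriv_single mon_deriv_def)

lemma mpol_eval_deriv_one [simp]: "mpol_eval (mpol_deriv i 1) x = 0"
  by (metis mpol_eval_deriv_mconst single_one)

lemma mpol_eval_deriv_mvar [simp]:
  "mpol_eval (mpol_deriv i (mvar j)) x = (if i = j then 1 else 0)"
  by (auto simp: mpol_eval_deriv_single mon_deriv_def lookup_single when_def)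

lemma mpol_eval_deriv_mvar_Suc [simp]:
  "mpol_eval (mpol_deriv i (Poly_Mapping.single (Poly_Mapping.single j (Suc 0)) 1)) x =
     (if i = j then 1 else 0)"
  using mpol_eval_deriv_mvar[of i j x] by simp

lemma mpol_eval_deriv_uminus [simp]:
  "mpol_eval (mpol_deriv i (- p)) x = - mpol_eval (mpol_deriv i p) x"
  using mpol_eval_deriv_add[of i p "-p" x] by (simp add: eq_neg_iff_add_eq_0 add.commute)

lemma mpol_eval_deriv_diff [simp]:
  "mpol_eval (mpol_deriv i (p - q)) x = mpol_eval (mpol_deriv i p) x - mpol_eval (mpol_deriv i q) x"
  using mpol_eval_deriv_add[of i p "-q" x] by simp

lemma mpol_eval_deriv_sum [simp]:
  "mpol_eval (mpol_deriv i (sum f S)) x = (\<Sum>j\<in>S. mpol_eval (mpol_deriv i (f j)) x)"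
  by (induction S rule: infinite_finite_induct) auto

lemma mpol_eval_deriv_power:
  "mpol_eval (mpol_deriv i (p ^ k)) x =
     of_nat k * mpol_eval p x ^ (k - 1) * mpol_eval (mpol_deriv i p) x"
proof (induction k)
  case (Suc k)
  then show ?case by (cases k) (auto simp: algebra_simps)
qed auto

text \<open>Constants and variables generate the polynomial ring, as one sees by splitting one
  variable at a time off a monomial. This form of induction suits statements about substitution,
  such as the chain rule, dehomogenization and clearing of denominators.\<close>

lemma mpols_induct [consumes 1, case_names const var add mult]:
  assumes "p \<in> mpols N" and const: "\<And>c. P (mconst c)" and var: "\<And>i. i < N \<Longrightarrow> P (mvar i)"
    and add: "\<And>p q. p \<in> mpols N \<Longrightarrow> q \<in> mpols N \<Longrightarrow> P p \<Longrightarrow> P q \<Longrightarrow> P (p + q)"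
    and mult: "\<And>p q. p \<in> mpols N \<Longrightarrow> q \<in> mpols N \<Longrightarrow> P p \<Longrightarrow> P q \<Longrightarrow> P (p * q)"
  shows "P p"
  using assms(1)
proof (induction p rule: mpols_induct_single)
  case zero
  show ?case using const[of 0] by simp
next
  case (single m c)
  then show ?case
  proof (induction "mon_degree m" arbitrary: m)
    case 0
    then have "m = 0"
      by (intro poly_mapping_eqI) (auto simp: mon_degree_def in_keys_iff)
    then show ?case using const[of c] by simp
  next
    case (Suc k)
    then obtain i where i: "i \<in> Poly_Mapping.keys m"
      by (metis mon_degree_def sum.empty ex_in_conv nat.distinct(1))
    let ?m = "m - Poly_Mapping.single i 1"
    have pos: "Poly_Mapping.lookup m i > 0" using i by (simp add: in_keys_iff)
    have m: "m = ?m + Poly_Mapping.single i 1" by (rule mon_minus_single[OF pos])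
    have "mon_degree m = mon_degree ?m + 1"
      using mon_degree_add[of ?m "Poly_Mapping.single i 1"] m by simp
    moreover have k: "Poly_Mapping.keys ?m \<subseteq> {..<N}"
    proof
      fix j assume "j \<in> Poly_Mapping.keys ?m"
      then have "j \<in> Poly_Mapping.keys m" by (auto simp: in_keys_iff lookup_minus)
      then show "j \<in> {..<N}" using Suc.prems by blast
    qed
    ultimately have "P (Poly_Mapping.single ?m c)" using Suc by simp
    moreover have iN: "i < N" using i Suc.prems by auto
    ultimately have "P (Poly_Mapping.single ?m c * mvar i)"
      by (intro mult single_in_mpols[OF k] mvar_in_mpols var)
    also have "Poly_Mapping.single ?m c * mvar i = Poly_Mapping.single m c"
      using m by (simp add: mult_single)
    finally show ?case .
  qed
qed (rule add)

section \<open>Homogeneity\<close>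

lemma homogeneous_iff: "homogeneous k p \<longleftrightarrow> (\<forall>m\<in>Poly_Mapping.keys p. mon_degree m = k)"
  by (simp add: homogeneous_def mon_degree_def)

lemma homogeneous_zero [simp]: "homogeneous k 0"
  by (simp add: homogeneous_iff)

lemma homogeneous_mconst [simp]: "homogeneous 0 (mconst c)"
  by (simp add: homogeneous_iff)

lemma homogeneous_one [simp]: "homogeneous 0 1"
  by (simp add: homogeneous_iff)

lemma homogeneous_mvar [simp]: "homogeneous 1 (mvar i)"
  by (simp add: homogeneous_iff)

lemma homogeneous_add: "homogeneous k p \<Longrightarrow> homogeneous k q \<Longrightarrow> homogeneous k (p + q)"
  using keys_add[of p q] by (auto simp: homogeneous_iff)

lemma homogeneous_uminus: "homogeneous k p \<Longrightarrow> homogeneous k (- p)"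
  by (simp add: homogeneous_iff in_keys_iff)

lemma homogeneous_diff: "homogeneous k p \<Longrightarrow> homogeneous k q \<Longrightarrow> homogeneous k (p - q)"
  using homogeneous_add[of k p "-q"] homogeneous_uminus[of k q] by simp

lemma homogeneous_mult:
  assumes "homogeneous k p" "homogeneous l q"
  shows "homogeneous (k + l) (p * q)"
  unfolding homogeneous_iff
proof
  fix m assume "m \<in> Poly_Mapping.keys (p * q)"
  then obtain a b where "m = a + b" "a \<in> Poly_Mapping.keys p" "b \<in> Poly_Mapping.keys q"
    using keys_mult[of p q] by blast
  then show "mon_degree m = k + l"
    using assms by (simp add: homogeneous_iff mon_degree_add)
qed

lemma homogeneous_scale: "homogeneous k p \<Longrightarrow> homogeneous k (mconst c * p)"
  using homogeneous_mult[of 0 "mconst c" k p] by simp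

lemma homogeneous_power: "homogeneous k p \<Longrightarrow> homogeneous (j * k) (p ^ j)"
  by (induction j) (auto intro: homogeneous_mult)

lemma homogeneous_sum: "(\<And>i. i \<in> S \<Longrightarrow> homogeneous k (f i)) \<Longrightarrow> homogeneous k (sum f S)"
  by (induction S rule: infinite_finite_induct) (auto intro: homogeneous_add)

section \<open>Binary forms\<close>

text \<open>A form is kept as a function because only its values on the cone matter; over an
  infinite field the values determine the coefficients.\<close>

definition binary_form :: "nat \<Rightarrow> ('f::field \<Rightarrow> 'f \<Rightarrow> 'f) \<Rightarrow> bool" where
  "binary_form k h \<longleftrightarrow> (\<exists>c. \<forall>s t. h s t = (\<Sum>j\<le>k. c j * (s ^ (k - j) * t ^ j)))"

lemma binary_form_zero: "binary_form k (\<lambda>s t. 0)"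
  unfolding binary_form_def by (intro exI[of _ "\<lambda>_. 0"]) simp

lemma binary_form_monomial:
  assumes "j \<le> k"
  shows "binary_form k (\<lambda>s t. c * (s ^ (k - j) * t ^ j))"
  unfolding binary_form_def
proof (intro exI[of _ "\<lambda>i. if i = j then c else 0"] allI)
  fix s t :: 'a
  have "(\<Sum>i\<le>k. (if i = j then c else 0) * (s ^ (k - i) * t ^ i)) =
        (\<Sum>i\<le>k. if i = j then c * (s ^ (k - j) * t ^ j) else 0)"
    by (rule sum.cong) auto
  then show "c * (s ^ (k - j) * t ^ j) = (\<Sum>i\<le>k. (if i = j then c else 0) * (s ^ (k - i) * t ^ i))"
    using assms by simp
qed

lemma binary_form_add:
  assumes "binary_form k g" "binary_form k h"
  shows "binary_form k (\<lambda>s t. g s t + h s t)"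
proof -
  obtain c d where "\<And>s t. g s t = (\<Sum>j\<le>k. c j * (s ^ (k - j) * t ^ j))"
    "\<And>s t. h s t = (\<Sum>j\<le>k. d j * (s ^ (k - j) * t ^ j))"
    using assms unfolding binary_form_def by metis
  then show ?thesis
    unfolding binary_form_def
    by (intro exI[of _ "\<lambda>j. c j + d j"]) (simp add: sum.distrib algebra_simps)
qed

lemma binary_form_sum:
  "(\<And>i. i \<in> S \<Longrightarrow> binary_form k (f i)) \<Longrightarrow> binary_form k (\<lambda>s t. \<Sum>i\<in>S. f i s t)"
  by (induction S rule: infinite_finite_induct) (auto intro: binary_form_add binary_form_zero)

lemma binary_form_mult:
  assumes "binary_form k g" "binary_form l h"
  shows "binary_form (k + l) (\<lambda>s t. g s t * h s t)"
proof -
  obtain c d where c: "\<And>s t. g s t = (\<Sum>j\<le>k. c j * (s ^ (k - j) * t ^ j))"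
    and d: "\<And>s t. h s t = (\<Sum>j\<le>l. d j * (s ^ (l - j) * t ^ j))"
    using assms unfolding binary_form_def by metis
  have "g s t * h s t =
      (\<Sum>i\<le>k. \<Sum>j\<le>l. (c i * d j) * (s ^ (k + l - (i + j)) * t ^ (i + j)))" for s t
    unfolding c d sum_product
  proof (intro sum.cong refl)
    fix i j assume "i \<in> {..k}" "j \<in> {..l}"
    then have "k + l - (i + j) = (k - i) + (l - j)" by auto
    then show "c i * (s ^ (k - i) * t ^ i) * (d j * (s ^ (l - j) * t ^ j)) =
        (c i * d j) * (s ^ (k + l - (i + j)) * t ^ (i + j))"
      by (simp add: power_add algebra_simps)
  qed
  then show ?thesis
    by (auto intro!: binary_form_sum binary_form_monomial)
qed

lemma binary_form_scale: "binary_form k h \<Longrightarrow> binary_form k (\<lambda>s t. c * h s t)"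
  using binary_form_mult[of 0 "\<lambda>s t. c" k h] binary_form_monomial[of 0 0 c] by simp

lemma binary_form_one: "binary_form 0 (\<lambda>s t. 1)"
  using binary_form_monomial[of 0 0 1] by simp

lemma binary_form_power: "binary_form k h \<Longrightarrow> binary_form (k * j) (\<lambda>s t. h s t ^ j)"
  by (induction j) (auto intro: binary_form_mult binary_form_one)

lemma binary_form_prod:
  assumes "finite S" "\<And>i. i \<in> S \<Longrightarrow> binary_form (k i) (f i)"
  shows "binary_form (\<Sum>i\<in>S. k i) (\<lambda>s t. \<Prod>i\<in>S. f i s t)"
  using assms by (induction S rule: finite_induct) (auto intro: binary_form_mult binary_form_one)

text \<open>Substituting binary forms of degree \<open>r\<close> turns every monomial of degree
  \<open>k\<close> into a binary form of degree \<open>k * r\<close>.\<close>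

lemma binary_form_mpol_eval:
  assumes "\<And>i. i < N \<Longrightarrow> binary_form r (\<lambda>s t. x s t i)"
    and "f \<in> mpols N" "homogeneous k f"
  shows "binary_form (k * r) (\<lambda>s t. mpol_eval f (x s t))"
  unfolding mpol_eval_def
proof (intro binary_form_sum binary_form_scale)
  fix m assume m: "m \<in> Poly_Mapping.keys f"
  have "binary_form (\<Sum>i\<in>Poly_Mapping.keys m. r * Poly_Mapping.lookup m i)
      (\<lambda>s t. \<Prod>i\<in>Poly_Mapping.keys m. x s t i ^ Poly_Mapping.lookup m i)"
    using m assms(2) by (intro binary_form_prod binary_form_power assms(1)) (auto simp: mpols_def)
  moreover have "(\<Sum>i\<in>Poly_Mapping.keys m. r * Poly_Mapping.lookup m i) = k * r"
    using assms(3) m by (simp add: homogeneous_def sum_distrib_left[symmetric])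
  ultimately show "binary_form (k * r)
      (\<lambda>s t. \<Prod>i\<in>Poly_Mapping.keys m. x s t i ^ Poly_Mapping.lookup m i)" by simp
qed

lemma poly_coeff_sum:
  fixes c :: "nat \<Rightarrow> 'f::field"
  shows "poly (\<Sum>j\<le>k. monom (c j) j) t = (\<Sum>j\<le>k. c j * t ^ j)"
    and "j \<le> k \<Longrightarrow> coeff (\<Sum>j\<le>k. monom (c j) j) j = c j"
  by (simp_all add: poly_sum poly_monom coeff_sum)

lemma smult_monom_mult: "smult c (monom 1 j * p) = monom c j * (p :: 'f::field poly)"
  by (simp add: smult_monom flip: mult_smult_left)

lemma coeff_sum_monom: "coeff (\<Sum>j<N. monom (y j :: 'f::field) j) k = (if k < N then y k else 0)"
  by (simp add: coeff_sum)

lemma power_sum_zero_imp_coeffs_zero: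
  fixes c :: "nat \<Rightarrow> 'f::field"
  assumes "infinite T" "\<And>t. t \<in> T \<Longrightarrow> (\<Sum>j\<le>k. c j * t ^ j) = 0" "j \<le> k"
  shows "c j = 0"
proof -
  let ?p = "\<Sum>j\<le>k. monom (c j) j"
  have "?p = 0"
  proof (rule ccontr)
    assume "?p \<noteq> 0"
    then have "finite {t. poly ?p t = 0}" by (rule poly_roots_finite)
    moreover have "T \<subseteq> {t. poly ?p t = 0}" using assms(2) by (auto simp: poly_coeff_sum(1))
    ultimately show False using assms(1) finite_subset by blast
  qed
  then show ?thesis using poly_coeff_sum(2)[OF assms(3), of c] by simp
qed

text \<open>The polynomial \<open>h 1 t\<close> has the same coefficients as \<open>h\<close>.
  Infinitely many zeros annihilate all of them, which also settles the values at
  \<open>s = 0\<close>.\<close>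

lemma binary_form_eq_zero:
  fixes h :: "'f::field \<Rightarrow> 'f \<Rightarrow> 'f"
  assumes "binary_form k h" "infinite T" "\<And>t. t \<in> T \<Longrightarrow> h 1 t = 0"
  shows "h s t = 0"
proof -
  obtain c where c: "\<And>s t. h s t = (\<Sum>j\<le>k. c j * (s ^ (k - j) * t ^ j))"
    using assms(1) unfolding binary_form_def by metis
  have "(\<Sum>j\<le>k. c j * t ^ j) = 0" if "t \<in> T" for t
    using assms(3)[OF that] c[of 1 t] by simp
  then have "\<And>j. j \<le> k \<Longrightarrow> c j = 0"
    using power_sum_zero_imp_coeffs_zero[OF assms(2)] by blast
  then show ?thesis by (simp add: c)
qed

section \<open>Linear algebra\<close>

locale sub_field =
  fixes K :: "'f::field set"
  assumes zero_mem: "0 \<in> K" and one_mem: "1 \<in> K"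
    and add_mem: "x \<in> K \<Longrightarrow> y \<in> K \<Longrightarrow> x + y \<in> K"
    and mult_mem: "x \<in> K \<Longrightarrow> y \<in> K \<Longrightarrow> x * y \<in> K"
    and uminus_mem: "x \<in> K \<Longrightarrow> - x \<in> K"
    and inverse_mem: "x \<in> K \<Longrightarrow> inverse x \<in> K"
begin

lemma diff_mem: "x \<in> K \<Longrightarrow> y \<in> K \<Longrightarrow> x - y \<in> K"
  using add_mem[of x "-y"] uminus_mem[of y] by simp

lemma divide_mem: "x \<in> K \<Longrightarrow> y \<in> K \<Longrightarrow> x / y \<in> K"
  by (simp add: divide_inverse mult_mem inverse_mem)

lemma sum_mem: "(\<And>i. i \<in> S \<Longrightarrow> g i \<in> K) \<Longrightarrow> sum g S \<in> K"
  by (induction S rule: infinite_finite_induct) (auto intro: zero_mem add_mem)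

text \<open>
  The left inverse again has entries in \<open>K\<close>; over a larger field it therefore witnesses that the
  columns stay independent there.
\<close>

lemma left_inverse_exists:
  fixes n r :: nat
  assumes "\<And>i j. i < n \<Longrightarrow> j < r \<Longrightarrow> B i j \<in> K"
    and "\<And>c. (\<And>j. j < r \<Longrightarrow> c j \<in> K) \<Longrightarrow> (\<And>i. i < n \<Longrightarrow> (\<Sum>j<r. B i j * c j) = 0) \<Longrightarrow>
           \<forall>j<r. c j = 0"
  shows "\<exists>A. (\<forall>j<r. \<forall>i<n. A j i \<in> K) \<and>
    (\<forall>j<r. \<forall>k<r. (\<Sum>i<n. A j i * B i k) = (if j = k then 1 else 0))"
  using assms
proof (induction r)
  case (Suc r)
  have "\<forall>j<r. c j = 0" if "\<And>j. j < r \<Longrightarrow> c j \<in> K" "\<And>i. i < n \<Longrightarrow> (\<Sum>j<r. B i j * c j) = 0" for c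
  proof -
    have "\<forall>j<Suc r. (c(r := 0)) j = 0"
      using that by (intro Suc.prems(2)) (auto simp: less_Suc_eq zero_mem)
    then show ?thesis by (auto simp: less_Suc_eq)
  qed
  then have "\<exists>A. (\<forall>j<r. \<forall>i<n. A j i \<in> K) \<and>
    (\<forall>j<r. \<forall>k<r. (\<Sum>i<n. A j i * B i k) = (if j = k then 1 else 0))"
    by (intro Suc.IH) (auto intro: Suc.prems(1))
  then obtain A where A: "\<And>j i. j < r \<Longrightarrow> i < n \<Longrightarrow> A j i \<in> K"
    and AB: "\<And>j k. j < r \<Longrightarrow> k < r \<Longrightarrow> (\<Sum>i<n. A j i * B i k) = (if j = k then 1 else 0)"
    by blast
  define e where "e j = (\<Sum>i<n. A j i * B i r)" for j
  have e: "e j \<in> K" if "j < r" for j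
    unfolding e_def using that by (auto intro!: sum_mem mult_mem A Suc.prems(1))
  \<comment> \<open>The part of the new column that is annihilated by \<open>A\<close>; were it
    zero, the new column would depend on the earlier ones.\<close>
  define b where "b i = B i r - (\<Sum>j<r. B i j * e j)" for i
  have b: "b i \<in> K" if "i < n" for i
    unfolding b_def using that by (auto intro!: sum_mem mult_mem diff_mem e Suc.prems(1))
  have "\<exists>i<n. b i \<noteq> 0"
  proof (rule ccontr)
    assume "\<not> (\<exists>i<n. b i \<noteq> 0)"
    then have "(\<Sum>j<Suc r. B i j * (if j < r then - e j else 1)) = 0" if "i < n" for i
      using that by (simp add: b_def sum_negf)
    then have "\<forall>j<Suc r. (if j < r then - e j else 1) = 0"
      using e by (intro Suc.prems(2)) (auto intro: uminus_mem one_mem)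
    then show False by (auto dest: spec[of _ r])
  qed
  then obtain i0 where i0: "i0 < n" "b i0 \<noteq> 0" by blast
  \<comment> \<open>Up to the factor \<open>1 / b i0\<close>, this row sends x to coordinate
    \<open>i0\<close> of x - B (A x). It kills the earlier columns and takes the value 1 on the new
    one.\<close>
  define a where "a i = ((if i = i0 then 1 else 0) - (\<Sum>j<r. B i0 j * A j i)) / b i0" for i
  have a: "a i \<in> K" if "i < n" for i
    unfolding a_def using that i0
    by (intro divide_mem diff_mem sum_mem mult_mem b) (auto intro!: A Suc.prems(1) zero_mem one_mem)
  have aB: "(\<Sum>i<n. a i * B i k) = (B i0 k - (\<Sum>j<r. B i0 j * (\<Sum>i<n. A j i * B i k))) / b i0" for k
  proof -
    have "(\<Sum>i<n. a i * B i k) =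
      (\<Sum>i<n. (if i = i0 then B i k else 0) - (\<Sum>j<r. B i0 j * (A j i * B i k))) / b i0"
      by (auto simp: a_def sum_divide_distrib algebra_simps sum_distrib_left intro!: sum.cong)
    also have "(\<Sum>i<n. (if i = i0 then B i k else 0) - (\<Sum>j<r. B i0 j * (A j i * B i k))) =
      B i0 k - (\<Sum>i<n. \<Sum>j<r. B i0 j * (A j i * B i k))"
      using i0 by (simp add: sum_subtractf)
    also have "(\<Sum>i<n. \<Sum>j<r. B i0 j * (A j i * B i k)) = (\<Sum>j<r. B i0 j * (\<Sum>i<n. A j i * B i k))"
      by (subst sum.swap) (simp add: sum_distrib_left)
    finally show ?thesis .
  qed
  have aB_less: "(\<Sum>i<n. a i * B i k) = 0" if "k < r" for k
  proof -
    have "(\<Sum>j<r. B i0 j * (\<Sum>i<n. A j i * B i k)) = (\<Sum>j<r. if j = k then B i0 j else 0)"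
      using that by (intro sum.cong) (auto simp: AB)
    then show ?thesis using that by (simp add: aB)
  qed
  have aB_r: "(\<Sum>i<n. a i * B i r) = 1"
    using i0 by (simp add: aB b_def e_def)
  \<comment> \<open>The old rows have the value \<open>e j\<close> on the new column; subtracting
    \<open>e j\<close> times the new row corrects this and leaves the other columns alone.\<close>
  define A' where "A' j i = (if j = r then a i else A j i - e j * a i)" for j i
  have "(\<Sum>i<n. A' j i * B i k) = (if j = k then 1 else 0)" if "j < Suc r" "k < Suc r" for j k
  proof (cases "j = r")
    case True
    then show ?thesis using that aB_less aB_r by (auto simp: A'_def less_Suc_eq)
  next
    case False
    then have "(\<Sum>i<n. A' j i * B i k) = (\<Sum>i<n. A j i * B i k) - e j * (\<Sum>i<n. a i * B i k)"
      by (simp add: A'_def sum_subtractf sum_distrib_left algebra_simps)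
    then show ?thesis
      using False that by (cases "k = r") (auto simp: AB aB_less aB_r e_def less_Suc_eq)
  qed
  moreover have "A' j i \<in> K" if "j < Suc r" "i < n" for j i
    using that by (auto simp: A'_def less_Suc_eq intro!: diff_mem mult_mem A a e)
  ultimately show ?case by blast
qed auto

end

lemma sub_field_UNIV: "sub_field UNIV"
  by unfold_locales auto

text \<open>
  Fraction-free elimination: a column is cleared with the help of an entry that does not vanish at
  \<open>c0\<close>, and \<open>G\<close> collects the pivots.
\<close>

lemma generic_trivial_kernel:
  fixes m N :: nat and M :: "nat \<Rightarrow> nat \<Rightarrow> 'f::field mpol"
  assumes "\<And>k j. k < m \<Longrightarrow> j < N \<Longrightarrow> M k j \<in> mpols S"
    and "\<And>x. (\<And>k. k < m \<Longrightarrow> (\<Sum>j<N. mpol_eval (M k j) c0 * x j) = 0) \<Longrightarrow> \<forall>j<N. x j = 0"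
  shows "\<exists>G\<in>mpols S. mpol_eval G c0 \<noteq> 0 \<and>
    (\<forall>c x. mpol_eval G c \<noteq> 0 \<longrightarrow> (\<forall>k<m. (\<Sum>j<N. mpol_eval (M k j) c * x j) = 0) \<longrightarrow> (\<forall>j<N. x j = 0))"
  using assms
proof (induction N arbitrary: M)
  case 0
  show ?case by (intro bexI[of _ 1]) auto
next
  case (Suc N)
  have "\<exists>k<m. mpol_eval (M k N) c0 \<noteq> 0"
  proof (rule ccontr)
    assume *: "\<not> (\<exists>k<m. mpol_eval (M k N) c0 \<noteq> 0)"
    \<comment> \<open>If column \<open>N\<close> vanished at \<open>c0\<close>, the unit vector with
      index \<open>N\<close> would lie in the kernel.\<close>
    have "\<forall>j<Suc N. (if j = N then 1 else 0 :: 'f) = 0"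
      using * by (intro Suc.prems(2)) simp
    then show False by (auto dest: spec[of _ N])
  qed
  then obtain p where p: "p < m" "mpol_eval (M p N) c0 \<noteq> 0" by blast
  \<comment> \<open>Cross-multiplied row operation with pivot row \<open>p\<close>: it clears column
    \<open>N\<close> without a division, so the entries stay polynomials.\<close>
  define M' where "M' k j = M k j * M p N - M k N * M p j" for k j
  have step: "(\<Sum>j<N. mpol_eval (M' k j) c * x j) =
      mpol_eval (M p N) c * (\<Sum>j<N. mpol_eval (M k j) c * x j)
      - mpol_eval (M k N) c * (\<Sum>j<N. mpol_eval (M p j) c * x j)" for k c x
    by (simp add: M'_def sum_subtractf sum_distrib_left algebra_simps)
  have "\<exists>G\<in>mpols S. mpol_eval G c0 \<noteq> 0 \<and>
    (\<forall>c x. mpol_eval G c \<noteq> 0 \<longrightarrow> (\<forall>k<m. (\<Sum>j<N. mpol_eval (M' k j) c * x j) = 0) \<longrightarrow> (\<forall>j<N. x j = 0))"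
  proof (rule Suc.IH)
    show "M' k j \<in> mpols S" if "k < m" "j < N" for k j
      unfolding M'_def using that p Suc.prems(1) by (intro diff_in_mpols mult_in_mpols) auto
    fix x assume x: "\<And>k. k < m \<Longrightarrow> (\<Sum>j<N. mpol_eval (M' k j) c0 * x j) = 0"
    \<comment> \<open>The pivot row at \<open>c0\<close>, solved for the last unknown, extends a
      kernel vector of the reduced matrix to one of the full matrix.\<close>
    define y where "y = x(N := - (\<Sum>j<N. mpol_eval (M p j) c0 * x j) / mpol_eval (M p N) c0)"
    have "(\<Sum>j<Suc N. mpol_eval (M k j) c0 * y j) = 0" if "k < m" for k
    proof -
      have "(\<Sum>j<Suc N. mpol_eval (M k j) c0 * y j) =
        (\<Sum>j<N. mpol_eval (M k j) c0 * x j)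
        - mpol_eval (M k N) c0 * (\<Sum>j<N. mpol_eval (M p j) c0 * x j) / mpol_eval (M p N) c0"
        by (simp add: y_def)
      also have "\<dots> = (\<Sum>j<N. mpol_eval (M' k j) c0 * x j) / mpol_eval (M p N) c0"
        unfolding step using p by (simp add: field_simps)
      finally show ?thesis using x[OF that] by simp
    qed
    then have "\<forall>j<Suc N. y j = 0" by (rule Suc.prems(2))
    then show "\<forall>j<N. x j = 0" by (auto simp: y_def less_Suc_eq split: if_splits)
  qed
  then obtain G where G: "G \<in> mpols S" "mpol_eval G c0 \<noteq> 0"
    and ker: "\<And>c x. mpol_eval G c \<noteq> 0 \<Longrightarrow> (\<And>k. k < m \<Longrightarrow> (\<Sum>j<N. mpol_eval (M' k j) c * x j) = 0) \<Longrightarrow>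
       \<forall>j<N. x j = 0" by blast
  show ?case
  proof (intro bexI[of _ "M p N * G"] conjI allI impI)
    show "M p N * G \<in> mpols S" using G p Suc.prems(1) by (intro mult_in_mpols) auto
    show "mpol_eval (M p N * G) c0 \<noteq> 0" using G p by simp
    fix c x j
    assume nz: "mpol_eval (M p N * G) c \<noteq> 0"
      and x: "\<forall>k<m. (\<Sum>j<Suc N. mpol_eval (M k j) c * x j) = 0" and "j < Suc N"
    have eq: "(\<Sum>j<N. mpol_eval (M k j) c * x j) = - mpol_eval (M k N) c * x N" if "k < m" for k
      using x that by (simp add: eq_neg_iff_add_eq_0)
    have "(\<Sum>j<N. mpol_eval (M' k j) c * x j) = 0" if "k < m" for k
      unfolding step eq[OF that] eq[OF p(1)] by simp
    then have xN: "\<forall>j<N. x j = 0" using nz by (intro ker) auto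
    then have "mpol_eval (M p N) c * x N = 0" using eq[OF p(1)] by simp
    then have "x N = 0" using nz by simp
    then show "x j = 0" using xN \<open>j < Suc N\<close> by (auto simp: less_Suc_eq)
  qed
qed

text \<open>Splitting off the linear factor of a root \<open>a\<close> removes exactly one root,
  since by the product rule a simple root is not a root of the cofactor; the cofactor inherits
  simplicity of its roots.\<close>

lemma card_simple_roots:
  fixes p :: "'f::field poly"
  assumes "p \<noteq> 0" "\<And>x. poly p x = 0 \<Longrightarrow> poly (pderiv p) x \<noteq> 0"
    and "\<And>q :: 'f poly. degree q > 0 \<Longrightarrow> \<exists>x. poly q x = 0"
  shows "card {x. poly p x = 0} = degree p"
  using assms(1,2)
proof (induction "degree p" arbitrary: p)
  case 0
  then obtain c where "p = [:c:]" using degree_eq_zeroE by metis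
  then show ?case using 0 by auto
next
  case (Suc k)
  then obtain a where a: "poly p a = 0" using assms(3)[of p] by auto
  then obtain q where q: "p = [:-a, 1:] * q" by (metis dvd_def poly_eq_0_iff_dvd)
  have q0: "q \<noteq> 0" using q Suc.prems by auto
  then have deg: "degree p = Suc (degree q)" unfolding q by (subst degree_mult_eq) auto
  have der: "poly (pderiv p) x = poly q x + (x - a) * poly (pderiv q) x" for x
    unfolding q pderiv_mult by (simp add: pderiv_pCons algebra_simps del: mult_pCons_left)
  have qa: "poly q a \<noteq> 0" using Suc.prems(2)[OF a] der[of a] by auto
  have "card {x. poly q x = 0} = degree q"
  proof (rule Suc.hyps(1))
    show "k = degree q" using deg Suc.hyps(2) by simp
    fix x assume x: "poly q x = 0"
    then show "poly (pderiv q) x \<noteq> 0" using Suc.prems(2)[of x] der[of x] q by auto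
  qed (rule q0)
  moreover have "{x. poly p x = 0} = insert a {x. poly q x = 0}" unfolding q by auto
  ultimately show ?case
    using qa deg poly_roots_finite[OF q0] by simp
qed

subsection \<open>Subspaces of affine space\<close>

lemma subspace_affine_space: "vec.subspace (affine_space N)"
  by (auto simp: vec.subspace_def affine_space_def vscale_def)

definition unit_vec :: "nat \<Rightarrow> nat \<Rightarrow> 'f::field" where
  "unit_vec i = (\<lambda>j. if j = i then 1 else 0)"

lemma sum_fun_apply: "sum f S x = (\<Sum>i\<in>S. f i x)"
  by (induction S rule: infinite_finite_induct) auto

text \<open>Injectivity is part of the conclusion because two equal members would satisfy the
  relation with coefficients 1 and -1. It makes the cardinality of the image equal to
  \<open>r\<close>.\<close>

lemma independent_family:
  fixes w :: "nat \<Rightarrow> nat \<Rightarrow> 'f::field"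
  assumes "\<And>c. (\<And>i. (\<Sum>j<r. c j * w j i) = 0) \<Longrightarrow> \<forall>j<r. c j = 0"
  shows "inj_on w {..<r}" "vec.independent (w ` {..<r})"
proof -
  show inj: "inj_on w {..<r}"
  proof (rule inj_onI, rule ccontr)
    fix j k assume jk: "j \<in> {..<r}" "k \<in> {..<r}" "w j = w k" "j \<noteq> k"
    let ?c = "\<lambda>i. if i = j then 1 else if i = k then -1 else 0 :: 'f"
    have "(\<Sum>l<r. ?c l * w l i) = 0" for i
    proof -
      have "(\<Sum>l<r. ?c l * w l i) =
          (\<Sum>l<r. (if l = j then w l i else 0) + (if l = k then - w l i else 0))"
        using jk by (intro sum.cong) auto
      also have "\<dots> = w j i - w k i"
        using jk by (simp add: sum.distrib)
      finally show ?thesis using jk by simp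
    qed
    from assms[of ?c, OF this] have "?c j = 0" using jk by blast
    then show False by simp
  qed
  show "vec.independent (w ` {..<r})"
  proof (rule vec.independent_if_scalars_zero)
    fix f x assume s: "(\<Sum>v\<in>w ` {..<r}. vscale (f v) v) = 0" and x: "x \<in> w ` {..<r}"
    have "(\<Sum>j<r. f (w j) * w j i) = 0" for i
    proof -
      have "(\<Sum>j<r. f (w j) * w j i) = (\<Sum>v\<in>w ` {..<r}. vscale (f v) v) i"
        using inj by (simp add: sum.reindex sum_fun_apply vscale_def)
      then show ?thesis by (simp add: s)
    qed
    from assms[of "\<lambda>j. f (w j)", OF this] show "f x = 0" using x by blast
  qed simp
qed

lemma affine_space_subset_span: "affine_space N \<subseteq> vec.span (unit_vec ` {..<N})"
proof
  fix x :: "nat \<Rightarrow> 'a" assume x: "x \<in> affine_space N"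
  have "x = (\<Sum>i<N. vscale (x i) (unit_vec i))"
  proof
    fix k
    have "(\<Sum>i<N. vscale (x i) (unit_vec i)) k = (\<Sum>i<N. if k = i then x i else 0)"
      unfolding sum_fun_apply by (intro sum.cong) (auto simp: vscale_def unit_vec_def)
    also have "\<dots> = x k" using x by (simp add: affine_space_def)
    finally show "x k = (\<Sum>i<N. vscale (x i) (unit_vec i)) k" by simp
  qed
  also have "\<dots> \<in> vec.span (unit_vec ` {..<N})"
    by (intro vec.span_sum vec.span_scale vec.span_base) auto
  finally show "x \<in> vec.span (unit_vec ` {..<N})" .
qed

lemma independent_in_affine_space:
  assumes "vec.independent S" "S \<subseteq> affine_space N"
  shows "finite S" "card S \<le> N"
proof -
  have "finite S \<and> card S \<le> card ((unit_vec :: nat \<Rightarrow> nat \<Rightarrow> 'a) ` {..<N})"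
    using affine_space_subset_span assms by (intro vec.independent_span_bound) auto
  then show "finite S" "card S \<le> N"
    using card_image_le[of "{..<N}" "unit_vec :: nat \<Rightarrow> nat \<Rightarrow> 'a"] by auto
qed

lemma dim_affine_space: "vec.dim (affine_space N :: (nat \<Rightarrow> 'f::field) set) = N"
proof -
  have *: "inj_on (unit_vec :: nat \<Rightarrow> nat \<Rightarrow> 'f) {..<N}"
    "vec.independent ((unit_vec :: nat \<Rightarrow> nat \<Rightarrow> 'f) ` {..<N})"
  proof -
    have "\<forall>j<N. c j = 0" if "\<And>i. (\<Sum>j<N. c j * unit_vec j i) = 0" for c :: "nat \<Rightarrow> 'f"
    proof (intro allI impI)
      fix k assume "k < N"
      have "(\<Sum>j<N. c j * unit_vec j k) = (\<Sum>j<N. if k = j then c j else 0)"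
        by (intro sum.cong) (auto simp: unit_vec_def)
      also have "\<dots> = c k" using \<open>k < N\<close> by simp
      finally show "c k = 0" using that[of k] by simp
    qed
    from independent_family[where w = unit_vec, OF this]
    show "inj_on (unit_vec :: nat \<Rightarrow> nat \<Rightarrow> 'f) {..<N}"
      "vec.independent ((unit_vec :: nat \<Rightarrow> nat \<Rightarrow> 'f) ` {..<N})" by auto
  qed
  show ?thesis
  proof (rule vec.dim_unique[OF _ affine_space_subset_span *(2)])
    show "unit_vec ` {..<N} \<subseteq> affine_space N" by (auto simp: affine_space_def unit_vec_def)
  qed (simp add: card_image[OF *(1)])
qed

text \<open>Rank-nullity for a single functional: a basis of the kernel, extended by one vector on
  which the functional does not vanish, is a basis.\<close>

lemma dim_hyperplane:
  fixes p a :: "nat \<Rightarrow> 'f::field"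
  assumes W: "vec.subspace W" "W \<subseteq> affine_space N" and a: "a \<in> W" "(\<Sum>i<N. p i * a i) \<noteq> 0"
  defines "W0 \<equiv> {w \<in> W. (\<Sum>i<N. p i * w i) = 0}"
  shows "vec.subspace W0" "vec.dim W = Suc (vec.dim W0)"
proof -
  show sub: "vec.subspace W0"
  proof (rule vec.subspaceI)
    show "0 \<in> W0" using W by (auto simp: W0_def vec.subspace_0)
    show "x + y \<in> W0" if "x \<in> W0" "y \<in> W0" for x y
      using that W by (auto simp: W0_def vec.subspace_add distrib_left sum.distrib)
    show "vscale c x \<in> W0" if "x \<in> W0" for c x
    proof -
      have "(\<Sum>i<N. p i * vscale c x i) = c * (\<Sum>i<N. p i * x i)"
        by (simp add: vscale_def sum_distrib_left mult_ac)
      then show ?thesis using that W by (auto simp: W0_def vec.subspace_scale)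
    qed
  qed
  obtain B where B: "B \<subseteq> W0" "vec.independent B" "W0 \<subseteq> vec.span B" "card B = vec.dim W0"
    using vec.basis_exists[of W0] by blast
  have "finite B"
    using B W by (intro independent_in_affine_space[of B N]) (auto simp: W0_def)
  have spB: "vec.span B \<subseteq> W0" using B sub by (intro vec.span_minimal)
  then have aB: "a \<notin> vec.span B" using a by (auto simp: W0_def)
  then have aB': "a \<notin> B" by (meson vec.span_base)
  have "vec.dim W = card (insert a B)"
  proof (rule vec.dim_unique)
    show "insert a B \<subseteq> W" using a B by (auto simp: W0_def)
    show "vec.independent (insert a B)" using aB B by (intro vec.independent_insertI)
    show "W \<subseteq> vec.span (insert a B)"
    proof
      fix w assume w: "w \<in> W"
      define k where "k = (\<Sum>i<N. p i * w i) / (\<Sum>i<N. p i * a i)"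
      have "(\<Sum>i<N. p i * (w - vscale k a) i) = (\<Sum>i<N. p i * w i) - k * (\<Sum>i<N. p i * a i)"
        by (simp add: vscale_def sum_distrib_left algebra_simps sum_subtractf)
      also have "\<dots> = 0" using a by (simp add: k_def)
      finally have "w - vscale k a \<in> W0"
        using w a W by (auto simp: W0_def intro!: vec.subspace_diff vec.subspace_scale)
      then show "w \<in> vec.span (insert a B)"
        using B(3) by (auto simp: vec.span_breakdown_eq)
    qed
  qed simp
  then show "vec.dim W = Suc (vec.dim W0)" using \<open>finite B\<close> aB' B by simp
qed

section \<open>Algebraic sets\<close>

lemma mpol_eval_scale:
  assumes "homogeneous k f"
  shows "mpol_eval f (vscale c v) = c ^ k * mpol_eval f v"
proof -
  have "mon_eval m (vscale c v) = c ^ k * mon_eval m v" if "m \<in> Poly_Mapping.keys f" for m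
  proof -
    have "mon_eval m (vscale c v) = c ^ mon_degree m * mon_eval m v"
      by (simp add: mon_eval_def vscale_def power_mult_distrib prod.distrib power_sum mon_degree_def)
    then show ?thesis using that assms by (simp add: homogeneous_iff)
  qed
  then show ?thesis
    by (simp add: mpol_eval_lin_ext lin_ext_def sum_distrib_left mult_ac)
qed

lemma form_vanishes_on_line:
  assumes "homogeneous k f"
  shows "(\<forall>v\<in>vec.span {u}. mpol_eval f v = 0) \<longleftrightarrow> mpol_eval f u = 0"
  using mpol_eval_scale[OF assms] vec.span_base[of u "{u}"]
  by (auto simp: vec.span_singleton)

lemma span_singleton_mem_eq:
  assumes "x \<in> vec.span {u}" "x \<noteq> 0"
  shows "vec.span {x} = vec.span {u}"
proof -
  obtain c where c: "x = vscale c u" using assms(1) by (auto simp: vec.span_singleton)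
  then have "c \<noteq> 0" using assms(2) by (auto simp: vscale_def)
  then have "u = vscale (inverse c) x" by (auto simp: c vscale_def)
  then have "u \<in> vec.span {x}" by (metis vec.span_base vec.span_scale singletonI)
  then show ?thesis using assms(1) by (simp add: vec.span_eq)
qed

lemma proj_alg_set_Int_forms:
  assumes "\<forall>f\<in>P. \<exists>k. homogeneous k f"
  shows "{l \<in> proj_space n. \<forall>f\<in>P. \<forall>v\<in>l. mpol_eval f v = 0} =
    {vec.span {u} | u. u \<in> affine_space (Suc n) \<and> u \<noteq> 0 \<and> (\<forall>f\<in>P. mpol_eval f u = 0)}"
  unfolding proj_space_def using assms form_vanishes_on_line by blast

lemma proj_alg_set_Un:
  assumes "proj_alg_set n S" "proj_alg_set n T"
  shows "proj_alg_set n (S \<union> T)"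
proof -
  obtain P where P: "P \<subseteq> mpols (Suc n)" "\<forall>f\<in>P. \<exists>k. homogeneous k f"
    "S = {l \<in> proj_space n. \<forall>f\<in>P. \<forall>v\<in>l. mpol_eval f v = 0}"
    using assms(1) unfolding proj_alg_set_def by auto
  obtain Q where Q: "Q \<subseteq> mpols (Suc n)" "\<forall>f\<in>Q. \<exists>k. homogeneous k f"
    "T = {l \<in> proj_space n. \<forall>f\<in>Q. \<forall>v\<in>l. mpol_eval f v = 0}"
    using assms(2) unfolding proj_alg_set_def by auto
  define PQ where "PQ = {f * g | f g. f \<in> P \<and> g \<in> Q}"
  have PQ: "PQ \<subseteq> mpols (Suc n)"
    using P(1) Q(1) unfolding PQ_def by (auto intro!: mult_in_mpols)
  have hom: "\<forall>f\<in>PQ. \<exists>k. homogeneous k f"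
    using P(2) Q(2) unfolding PQ_def by (blast intro: homogeneous_mult)
  have PQ0: "(\<forall>f\<in>PQ. mpol_eval f u = 0) \<longleftrightarrow> (\<forall>f\<in>P. mpol_eval f u = 0) \<or> (\<forall>f\<in>Q. mpol_eval f u = 0)" for u
    unfolding PQ_def by fastforce
  have "S \<union> T = {l \<in> proj_space n. \<forall>f\<in>PQ. \<forall>v\<in>l. mpol_eval f v = 0}"
    unfolding P(3) Q(3) proj_alg_set_Int_forms[OF P(2)] proj_alg_set_Int_forms[OF Q(2)]
      proj_alg_set_Int_forms[OF hom] PQ0 by blast
  then show ?thesis
    unfolding proj_alg_set_def using PQ hom by blast
qed

lemma proj_alg_set_point:
  assumes u: "u \<in> affine_space (Suc n)" "u \<noteq> 0"
  shows "proj_alg_set n {vec.span {u}}"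
proof -
  \<comment> \<open>The 2 by 2 minors of the matrix with rows \<open>u\<close> and x; they all
    vanish exactly if x is proportional to \<open>u\<close>.\<close>
  define f where "f i j = mconst (u i) * mvar j - mconst (u j) * mvar i" for i j
  define P where "P = {f i j | i j. i < Suc n \<and> j < Suc n}"
  have P: "P \<subseteq> mpols (Suc n)"
    unfolding P_def f_def by (blast intro: diff_in_mpols mult_in_mpols mconst_in_mpols mvar_in_mpols)
  have "homogeneous 1 (f i j)" for i j
    unfolding f_def by (intro homogeneous_diff homogeneous_scale homogeneous_mvar)
  then have hom: "\<forall>g\<in>P. \<exists>k. homogeneous k g"
    unfolding P_def by blast
  have ev: "mpol_eval (f i j) x = u i * x j - u j * x i" for i j x
    by (simp add: f_def)
  have "vec.span {x} = vec.span {u}"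
    if x: "x \<in> affine_space (Suc n)" "x \<noteq> 0" "\<forall>g\<in>P. mpol_eval g x = 0" for x
  proof -
    obtain i where i: "u i \<noteq> 0" using u(2) by (auto simp: fun_eq_iff)
    then have iN: "i < Suc n" using u(1) by (auto simp: affine_space_def not_less[symmetric])
    have "x j = x i / u i * u j" for j
    proof (cases "j < Suc n")
      case True
      then have "mpol_eval (f i j) x = 0" using x(3) iN unfolding P_def by blast
      then show ?thesis using i by (simp add: ev field_simps)
    next
      case False
      then show ?thesis using u(1) x(1) by (auto simp: affine_space_def)
    qed
    then have "x = vscale (x i / u i) u" unfolding vscale_def by (rule ext)
    then have "x \<in> vec.span {u}" by (metis vec.span_base vec.span_scale singletonI)
    then show ?thesis using x(2) by (rule span_singleton_mem_eq)
  qed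
  moreover have "\<forall>g\<in>P. mpol_eval g u = 0" unfolding P_def using ev by auto
  ultimately have "{vec.span {u}} = {l \<in> proj_space n. \<forall>f\<in>P. \<forall>v\<in>l. mpol_eval f v = 0}"
    unfolding proj_alg_set_Int_forms[OF hom] using u by blast
  then show ?thesis unfolding proj_alg_set_def using P hom by blast
qed

section \<open>Affine algebraic sets\<close>

lemma affine_alg_set_Inter:
  assumes "\<And>T. T \<in> \<T> \<Longrightarrow> affine_alg_set n T" "\<T> \<noteq> {}"
  shows "affine_alg_set n (\<Inter>\<T>)"
proof -
  \<comment> \<open>Taking all polynomials that vanish on the intersection avoids choosing equations
    for each member.\<close>
  define P where "P = {f \<in> mpols n. \<forall>x\<in>\<Inter>\<T>. mpol_eval f x = 0}"
  have "x \<in> \<Inter>\<T>" if x: "x \<in> affine_space n" "\<forall>f\<in>P. mpol_eval f x = 0" for x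
  proof
    fix T assume T: "T \<in> \<T>"
    obtain Q where Q: "Q \<subseteq> mpols n" "T = {x \<in> affine_space n. \<forall>f\<in>Q. mpol_eval f x = 0}"
      using assms(1)[OF T] unfolding affine_alg_set_def by auto
    have "f \<in> P" if "f \<in> Q" for f
    proof -
      have "mpol_eval f x = 0" if "x \<in> \<Inter>\<T>" for x
      proof -
        have "x \<in> T" using that T by blast
        then show ?thesis using \<open>f \<in> Q\<close> by (simp add: Q(2))
      qed
      then show ?thesis using that Q(1) unfolding P_def by blast
    qed
    then show "x \<in> T" using x by (simp add: Q(2))
  qed
  moreover have "\<Inter>\<T> \<subseteq> affine_space n"
    using assms unfolding affine_alg_set_def by fast
  ultimately have "\<Inter>\<T> = {x \<in> affine_space n. \<forall>f\<in>P. mpol_eval f x = 0}"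
    by (auto simp: P_def)
  then show ?thesis
    unfolding affine_alg_set_def by (intro exI[of _ P]) (auto simp: P_def)
qed

lemma affine_alg_set_affine_space: "affine_alg_set n (affine_space n)"
  unfolding affine_alg_set_def by (intro exI[of _ "{}"]) auto

lemma affine_alg_set_Un:
  assumes "affine_alg_set n S" "affine_alg_set n T"
  shows "affine_alg_set n (S \<union> T)"
proof -
  obtain P where P: "P \<subseteq> mpols n" "S = {x \<in> affine_space n. \<forall>f\<in>P. mpol_eval f x = 0}"
    using assms(1) unfolding affine_alg_set_def by auto
  obtain Q where Q: "Q \<subseteq> mpols n" "T = {x \<in> affine_space n. \<forall>f\<in>Q. mpol_eval f x = 0}"
    using assms(2) unfolding affine_alg_set_def by auto
  define PQ where "PQ = {f * g | f g. f \<in> P \<and> g \<in> Q}"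
  have PQ: "PQ \<subseteq> mpols n"
    using P(1) Q(1) unfolding PQ_def by (auto intro!: mult_in_mpols)
  have PQ0: "(\<forall>f\<in>PQ. mpol_eval f u = 0) \<longleftrightarrow> (\<forall>f\<in>P. mpol_eval f u = 0) \<or> (\<forall>f\<in>Q. mpol_eval f u = 0)" for u
    unfolding PQ_def by fastforce
  have "S \<union> T = {x \<in> affine_space n. \<forall>f\<in>PQ. mpol_eval f x = 0}"
    unfolding P(2) Q(2) PQ0 by blast
  then show ?thesis
    unfolding affine_alg_set_def using PQ by blast
qed

lemma affine_alg_set_point:
  assumes u: "u \<in> affine_space n"
  shows "affine_alg_set n {u}"
proof -
  define P where "P = (\<lambda>i. mvar i - mconst (u i)) ` {..<n}"
  have "P \<subseteq> mpols n"
    unfolding P_def by (auto intro!: diff_in_mpols mvar_in_mpols simp del: One_nat_def)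
  moreover have "{u} = {x \<in> affine_space n. \<forall>f\<in>P. mpol_eval f x = 0}"
  proof (rule antisym; rule subsetI)
    fix x assume x: "x \<in> {x \<in> affine_space n. \<forall>f\<in>P. mpol_eval f x = 0}"
    have "x i = u i" for i
    proof (cases "i < n")
      case True
      then have "mpol_eval (mvar i - mconst (u i)) x = 0" using x unfolding P_def by blast
      then show ?thesis by simp
    next
      case False
      then show ?thesis using x u by (auto simp: affine_space_def)
    qed
    then show "x \<in> {u}" by auto
  qed (use u in \<open>auto simp: P_def\<close>)
  ultimately show ?thesis unfolding affine_alg_set_def by blast
qed

text \<open>If proper closed subsets are finite, an irreducible one is a single point, because a
  finite set splits into closed points. Hence a chain from a point to \<open>Y\<close> cannot be
  refined. The lemma serves the affine and the projective curve alike.\<close>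

lemma irreducible_curveI:
  assumes C: "C Y" and inf: "infinite Y"
    and union: "\<And>A B. C A \<Longrightarrow> C B \<Longrightarrow> C (A \<union> B)"
    and point: "\<And>y. y \<in> Y \<Longrightarrow> C {y}"
    and proper: "\<And>T. C T \<Longrightarrow> T \<subset> Y \<Longrightarrow> finite T"
  shows "irreducible_curve C Y"
proof -
  have fin_closed: "C A" if "finite A" "A \<noteq> {}" "A \<subseteq> Y" for A
    using that
  proof (induction rule: finite_ne_induct)
    case (insert x A)
    then have "C ({x} \<union> A)" by (intro union point) auto
    then show ?case by simp
  qed (auto intro: point)
  have irr: "irreducible_closed C Y"
    unfolding irreducible_closed_def
  proof (intro conjI allI impI)
    show "C Y" by (rule C)
    show "Y \<noteq> {}" using inf by auto
    fix A B assume AB: "C A" "C B" "Y = A \<union> B"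
    show "Y = A \<or> Y = B"
    proof (rule ccontr)
      assume "\<not> (Y = A \<or> Y = B)"
      then have "finite A" "finite B" using AB by (auto intro!: proper)
      then show False using inf AB by auto
    qed
  qed
  have singleton: "irreducible_closed C {y}" if "y \<in> Y" for y
    unfolding irreducible_closed_def using point[OF that] by blast
  have proper_irr: "\<exists>y. A = {y}" if A: "irreducible_closed C A" "A \<subset> Y" for A
  proof -
    have fin: "finite A" using A by (intro proper) (auto simp: irreducible_closed_def)
    obtain y where y: "y \<in> A" using A by (auto simp: irreducible_closed_def)
    show ?thesis
    proof (cases "A - {y} = {}")
      case True
      then show ?thesis using y by auto
    next
      case False
      then have "C {y}" "C (A - {y})" "A = {y} \<union> (A - {y})"
        using y A fin by (auto intro!: point fin_closed)
      then have "A = {y} \<or> A = A - {y}" using A(1) unfolding irreducible_closed_def by blast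
      then show ?thesis using y by auto
    qed
  qed
  obtain y where y: "y \<in> Y" using inf by fastforce
  have "irreducible_chain C Y 1 (\<lambda>i. if i = 0 then {y} else Y)"
    unfolding irreducible_chain_def using y irr singleton[OF y] inf
    by (auto simp: psubset_eq)
  moreover have "\<not> irreducible_chain C Y 2 Z" for Z
  proof
    assume Z: "irreducible_chain C Y 2 Z"
    then have ic: "irreducible_closed C (Z 0)" "irreducible_closed C (Z 1)" "Z 2 \<subseteq> Y"
      unfolding irreducible_chain_def by auto
    have "\<forall>i<2. Z i \<subset> Z (Suc i)" using Z unfolding irreducible_chain_def by blast
    then have st: "Z 0 \<subset> Z 1" "Z 1 \<subset> Z 2" by (auto simp: numeral_2_eq_2)
    then obtain z where "Z 1 = {z}" using proper_irr[OF ic(2)] ic(3) by blast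
    then have "Z 0 = {}" using st by auto
    then show False using ic(1) by (auto simp: irreducible_closed_def)
  qed
  ultimately show ?thesis unfolding irreducible_curve_def using irr by blast
qed

section \<open>The cone over a rational normal curve\<close>

text \<open>The left inverse \<open>A\<close> is a parameter rather than an existence statement
  because its rows serve as coordinate functions on the cone.\<close>

locale rational_normal_cone =
  fixes n r :: nat and A B :: "nat \<Rightarrow> nat \<Rightarrow> 'f::field_char_0"
  assumes r_pos: "0 < r"
    and left_inverse: "j \<le> r \<Longrightarrow> k \<le> r \<Longrightarrow> (\<Sum>i\<le>n. A j i * B i k) = (if j = k then 1 else 0)"
    and alg_closed: "0 < degree (p :: 'f poly) \<Longrightarrow> \<exists>x. poly p x = 0"
begin

text \<open>The homogeneous parameter (s, t) includes (0, 1), the value infinity of the affine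
  parameter t / s.\<close>

definition cone_point :: "'f \<Rightarrow> 'f \<Rightarrow> nat \<Rightarrow> 'f" where
  "cone_point s t i = (if i \<le> n then \<Sum>j\<le>r. B i j * (s ^ (r - j) * t ^ j) else 0)"

definition coord :: "nat \<Rightarrow> (nat \<Rightarrow> 'f) \<Rightarrow> 'f" where
  "coord j x = (\<Sum>i\<le>n. A j i * x i)"

definition curve :: "(nat \<Rightarrow> 'f) set set" where
  "curve = {vec.span {cone_point s t} | s t. s \<noteq> 0 \<or> t \<noteq> 0}"

lemma cone_point_in_affine_space [simp]: "cone_point s t \<in> affine_space (Suc n)"
  by (simp add: affine_space_def cone_point_def)

lemma coord_lincomb:
  assumes "j \<le> r"
  shows "(\<Sum>i\<le>n. A j i * (\<Sum>k\<le>r. B i k * y k)) = y j"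
proof -
  have "(\<Sum>i\<le>n. A j i * (\<Sum>k\<le>r. B i k * y k)) = (\<Sum>k\<le>r. (\<Sum>i\<le>n. A j i * B i k) * y k)"
    unfolding sum_distrib_left sum_distrib_right by (subst sum.swap) (simp add: mult_ac)
  also have "\<dots> = (\<Sum>k\<le>r. if k = j then y k else 0)"
    using assms by (intro sum.cong) (auto simp: left_inverse)
  finally show ?thesis using assms by simp
qed

lemma coord_cone_point: "j \<le> r \<Longrightarrow> coord j (cone_point s t) = s ^ (r - j) * t ^ j"
  unfolding coord_def using coord_lincomb[of j "\<lambda>j. s ^ (r - j) * t ^ j"]
  by (simp add: cone_point_def)

lemma coord_vscale: "coord j (vscale c x) = c * coord j x"
  by (simp add: coord_def vscale_def sum_distrib_left mult_ac)

lemma binary_form_cone_point: "binary_form r (\<lambda>s t. cone_point s t i)"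
proof (cases "i \<le> n")
  case True
  then show ?thesis
    unfolding cone_point_def by (auto intro!: binary_form_sum binary_form_monomial)
next
  case False
  then show ?thesis by (simp add: cone_point_def binary_form_zero)
qed

lemma cone_point_eq_0_iff: "cone_point s t = 0 \<longleftrightarrow> s = 0 \<and> t = 0"
proof
  assume "cone_point s t = 0"
  then have "s ^ r = 0" "t ^ r = 0"
    using coord_cone_point[of 0 s t] coord_cone_point[of r s t] by (auto simp: coord_def)
  then show "s = 0 \<and> t = 0" by simp
next
  assume "s = 0 \<and> t = 0"
  then show "cone_point s t = 0"
    using r_pos by (auto simp: cone_point_def fun_eq_iff power_0_left intro!: sum.neutral)
qed

lemma cone_point_scale: "cone_point (c * s) (c * t) = vscale (c ^ r) (cone_point s t)"
proof
  fix i
  have "(c * s) ^ (r - j) * (c * t) ^ j = c ^ r * (s ^ (r - j) * t ^ j)" if "j \<le> r" for j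
    using that by (simp add: power_mult_distrib power_add[symmetric])
  then show "cone_point (c * s) (c * t) i = vscale (c ^ r) (cone_point s t) i"
    by (auto simp: cone_point_def vscale_def sum_distrib_left mult_ac intro!: sum.cong)
qed

lemma root_exists: "\<exists>b. b ^ r = (c::'f)"
proof -
  have "degree (monom 1 r - [:c:]) = r"
    using r_pos by (subst diff_conv_add_uminus, subst degree_add_eq_left) (auto simp: degree_monom_eq)
  then obtain b where "poly (monom 1 r - [:c:]) b = 0" using alg_closed r_pos by metis
  then show ?thesis by (auto simp: poly_monom)
qed

text \<open>Scalars have \<open>r\<close>-th roots, so they can be absorbed into the parameters:
  every multiple of a point of the image is again in the image.\<close>

lemma vscale_cone_point: "\<exists>s' t'. vscale c (cone_point s t) = cone_point s' t'"
  by (metis root_exists cone_point_scale)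

lemma mem_curveE:
  assumes "l \<in> curve" "v \<in> l"
  obtains s t where "v = cone_point s t"
proof -
  obtain s t where "l = vec.span {cone_point s t}" using assms by (auto simp: curve_def)
  then obtain c where "v = vscale c (cone_point s t)" using assms(2) by (auto simp: vec.span_singleton)
  then show thesis using that vscale_cone_point by metis
qed

lemma span_cone_point_in_curve: "s \<noteq> 0 \<or> t \<noteq> 0 \<Longrightarrow> vec.span {cone_point s t} \<in> curve"
  by (auto simp: curve_def)

lemma span_vscale: "c \<noteq> 0 \<Longrightarrow> vec.span {vscale c x} = vec.span {x :: nat \<Rightarrow> 'f}"
proof (cases "x = 0")
  case False
  assume "c \<noteq> 0"
  then have "vscale c x \<noteq> 0" using False by (auto simp: vscale_def fun_eq_iff)
  then show ?thesis
    by (intro span_singleton_mem_eq) (auto intro: vec.span_scale vec.span_base)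
qed simp

lemma curve_eq: "curve = insert (vec.span {cone_point 0 1}) (range (\<lambda>t. vec.span {cone_point 1 t}))"
proof (rule antisym; rule subsetI)
  fix l assume "l \<in> curve"
  then obtain s t where l: "l = vec.span {cone_point s t}" "s \<noteq> 0 \<or> t \<noteq> 0"
    by (auto simp: curve_def)
  show "l \<in> insert (vec.span {cone_point 0 1}) (range (\<lambda>t. vec.span {cone_point 1 t}))"
  proof (cases "s = 0")
    case True
    then show ?thesis using l cone_point_scale[of t 0 1] by (simp add: span_vscale)
  next
    case False
    then have "cone_point s t = vscale (s ^ r) (cone_point 1 (t / s))"
      using cone_point_scale[of s 1 "t / s"] by simp
    then show ?thesis using False l by (simp add: span_vscale)
  qed
qed (auto intro: span_cone_point_in_curve)

lemma inj_curve_param: "inj (\<lambda>t. vec.span {cone_point 1 t})"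
proof (rule injI)
  fix t t' assume "vec.span {cone_point 1 t} = vec.span {cone_point 1 t'}"
  then have "cone_point 1 t \<in> vec.span {cone_point 1 t'}" using vec.span_base[of _ "{cone_point 1 t}"] by blast
  then obtain c where c: "cone_point 1 t = vscale c (cone_point 1 t')"
    by (auto simp: vec.span_singleton)
  have eq: "1 ^ (r - j) * t ^ j = c * (1 ^ (r - j) * t' ^ j)" if "j \<le> r" for j
    using arg_cong[OF c, of "coord j"] that by (simp only: coord_vscale coord_cone_point)
  show "t = t'" using eq[of 0] eq[of 1] r_pos by simp
qed

lemma vanishes_on_curve_iff:
  assumes "homogeneous k f"
  shows "(\<forall>l\<in>curve. \<forall>v\<in>l. mpol_eval f v = 0) \<longleftrightarrow> (\<forall>s t. mpol_eval f (cone_point s t) = 0)"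
proof
  assume *: "\<forall>l\<in>curve. \<forall>v\<in>l. mpol_eval f v = 0"
  show "\<forall>s t. mpol_eval f (cone_point s t) = 0"
  proof (intro allI)
    fix s t
    have "cone_point s t \<in> vec.span {cone_point s t}" by (simp add: vec.span_base)
    \<comment> \<open>The parameter (0, 0) gives no point of the curve, but the zero vector lies on
      every line, in particular on that of (1, 0).\<close>
    moreover have "cone_point 0 0 \<in> vec.span {cone_point 1 0}"
      using cone_point_eq_0_iff[of 0 0] by (simp add: vec.span_zero)
    ultimately show "mpol_eval f (cone_point s t) = 0"
      using * span_cone_point_in_curve[of s t] span_cone_point_in_curve[of 1 0] by fastforce
  qed
qed (metis mem_curveE)

text \<open>The form pulls back to a binary form, so infinitely many parameters with s = 1 determine
  it everywhere, including at s = 0.\<close>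

lemma form_vanishes_on_cone:
  assumes "f \<in> mpols (Suc n)" "homogeneous k f" "infinite T"
    "\<And>t. t \<in> T \<Longrightarrow> mpol_eval f (cone_point 1 t) = 0"
  shows "mpol_eval f (cone_point s t) = 0"
proof -
  have "binary_form (k * r) (\<lambda>s t. mpol_eval f (cone_point s t))"
    by (rule binary_form_mpol_eval[OF binary_form_cone_point assms(1,2)])
  from binary_form_eq_zero[OF this assms(3,4)] show ?thesis .
qed

subsection \<open>Equations of the curve\<close>

definition coord_form :: "nat \<Rightarrow> 'f mpol" where
  "coord_form j = (\<Sum>i\<le>n. mconst (A j i) * mvar i)"

text \<open>Row \<open>i\<close> of the identity minus B A; together these equations say x = B A x,
  that is, x lies in the column space of \<open>B\<close>.\<close>

definition linear_eq :: "nat \<Rightarrow> 'f mpol" where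
  "linear_eq i = mvar i - (\<Sum>j\<le>r. mconst (B i j) * coord_form j)"

lemma coord_form_in_mpols: "coord_form j \<in> mpols (Suc n)"
  unfolding coord_form_def by (intro sum_in_mpols mult_in_mpols mvar_in_mpols) auto

lemma homogeneous_coord_form: "homogeneous 1 (coord_form j)"
  unfolding coord_form_def by (intro homogeneous_sum homogeneous_scale homogeneous_mvar)

lemma mpol_eval_coord_form [simp]: "mpol_eval (coord_form j) x = coord j x"
  by (simp add: coord_form_def coord_def)

lemma linear_eq_in_mpols: "i \<le> n \<Longrightarrow> linear_eq i \<in> mpols (Suc n)"
  unfolding linear_eq_def
  by (intro diff_in_mpols sum_in_mpols mult_in_mpols mvar_in_mpols coord_form_in_mpols) auto

lemma homogeneous_linear_eq: "homogeneous 1 (linear_eq i)"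
  unfolding linear_eq_def
  by (intro homogeneous_diff homogeneous_sum homogeneous_scale homogeneous_mvar homogeneous_coord_form)

lemma mpol_eval_linear_eq: "mpol_eval (linear_eq i) x = x i - (\<Sum>j\<le>r. B i j * coord j x)"
  by (simp add: linear_eq_def)

lemma linear_eq_cone_point: "i \<le> n \<Longrightarrow> mpol_eval (linear_eq i) (cone_point s t) = 0"
  unfolding mpol_eval_linear_eq
  by (subst cone_point_def) (auto simp: coord_cone_point intro!: sum.cong)

text \<open>For i + j = k + l these are the classical quadrics through the rational normal curve,
  written in the coordinates given by \<open>A\<close>.\<close>

definition minor :: "nat \<Rightarrow> nat \<Rightarrow> nat \<Rightarrow> nat \<Rightarrow> 'f mpol" where
  "minor i j k l = coord_form i * coord_form j - coord_form k * coord_form l"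

lemma minor_in_mpols: "minor i j k l \<in> mpols (Suc n)"
  unfolding minor_def by (intro diff_in_mpols mult_in_mpols coord_form_in_mpols)

lemma homogeneous_minor: "homogeneous (1 + 1) (minor i j k l)"
  unfolding minor_def by (intro homogeneous_diff homogeneous_mult homogeneous_coord_form)

lemma minor_cone_point:
  assumes "i + j = k + l" "i \<le> r" "j \<le> r" "k \<le> r" "l \<le> r"
  shows "mpol_eval (minor i j k l) (cone_point s t) = 0"
proof -
  have "(r - i) + (r - j) = (r - k) + (r - l)" using assms by simp
  then have "s ^ (r - i) * s ^ (r - j) = s ^ (r - k) * s ^ (r - l)"
    "t ^ i * t ^ j = t ^ k * t ^ l"
    using assms(1) by (metis power_add)+
  then have "(s ^ (r - i) * t ^ i) * (s ^ (r - j) * t ^ j) = (s ^ (r - k) * t ^ k) * (s ^ (r - l) * t ^ l)"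
    by (simp only: mult.assoc mult.left_commute[of "t ^ _"]) (simp only: mult.assoc[symmetric])
  then show ?thesis using assms by (simp add: minor_def coord_cone_point)
qed

text \<open>If \<open>y 0\<close> is nonzero, the quadrics make y a geometric progression, and an
  \<open>r\<close>-th root of \<open>y 0\<close> gives s. If \<open>y 0 = 0\<close>, the quadrics
  y_{j+1}^2 = y_j y_{j+2} annihilate everything before \<open>y r\<close>, which leaves the point s
  = 0.\<close>

lemma coords_of_minors:
  assumes "\<And>i j k l. i + j = k + l \<Longrightarrow> i \<le> r \<Longrightarrow> j \<le> r \<Longrightarrow> k \<le> r \<Longrightarrow> l \<le> r \<Longrightarrow> y i * y j = y k * (y l :: 'f)"
  shows "\<exists>s t. \<forall>j\<le>r. y j = s ^ (r - j) * t ^ j"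
proof (cases "y 0 = 0")
  case False
  obtain s where s: "s ^ r = y 0" using root_exists by blast
  define q where "q = y 1 / y 0"
  have yq: "y j = y 0 * q ^ j" if "j \<le> r" for j
    using that
  proof (induction j)
    case (Suc j)
    then have "y 0 * y (Suc j) = y 1 * y j" using r_pos by (intro assms) auto
    also have "y j = y 0 * q ^ j" using Suc by simp
    finally show ?case using False by (simp add: q_def field_simps)
  qed simp
  have sq: "s ^ (r - j) * (s * q) ^ j = y 0 * q ^ j" if "j \<le> r" for j
  proof -
    have "s ^ (r - j) * (s * q) ^ j = s ^ (r - j + j) * q ^ j"
      by (simp only: power_mult_distrib power_add mult.assoc)
    then show ?thesis using that s by simp
  qed
  have "\<forall>j\<le>r. y j = s ^ (r - j) * (s * q) ^ j"
  proof (intro allI impI)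
    fix j assume "j \<le> r"
    from yq[OF this] sq[OF this] show "y j = s ^ (r - j) * (s * q) ^ j" by (rule trans[OF _ sym])
  qed
  then show ?thesis by blast
next
  case True
  have z: "y j = 0" if "j < r" for j
    using that
  proof (induction j)
    case (Suc j)
    then have "y (Suc j) * y (Suc j) = y j * y (Suc (Suc j))" by (intro assms) auto
    then show ?case using Suc by simp
  qed (rule True)
  obtain t where t: "t ^ r = y r" using root_exists by blast
  \<comment> \<open>The convention \<open>0 ^ 0 = 1\<close> preserves exactly the term j =
    r.\<close>
  have "y j = 0 ^ (r - j) * t ^ j" if "j \<le> r" for j
    using that z t by (cases "j = r") auto
  then show ?thesis by blast
qed

definition curve_eqs :: "'f mpol set" where
  "curve_eqs = linear_eq ` {..n} \<union>
     {minor i j k l | i j k l. i + j = k + l \<and> i \<le> r \<and> j \<le> r \<and> k \<le> r \<and> l \<le> r}"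

lemma curve_eqs_props:
  "curve_eqs \<subseteq> mpols (Suc n)" "\<forall>f\<in>curve_eqs. \<exists>k. homogeneous k f"
  using linear_eq_in_mpols minor_in_mpols homogeneous_linear_eq homogeneous_minor
  unfolding curve_eqs_def by blast+

lemma zeros_curve_eqs:
  assumes "x \<in> affine_space (Suc n)"
  shows "(\<forall>f\<in>curve_eqs. mpol_eval f x = 0) \<longleftrightarrow> (\<exists>s t. x = cone_point s t)"
proof
  assume *: "\<forall>f\<in>curve_eqs. mpol_eval f x = 0"
  have "coord i x * coord j x = coord k x * coord l x"
    if "i + j = k + l" "i \<le> r" "j \<le> r" "k \<le> r" "l \<le> r" for i j k l
  proof -
    have "minor i j k l \<in> curve_eqs" using that unfolding curve_eqs_def by blast
    then have "mpol_eval (minor i j k l) x = 0" using * by blast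
    then show ?thesis by (simp add: minor_def)
  qed
  then obtain s t where st: "\<And>j. j \<le> r \<Longrightarrow> coord j x = s ^ (r - j) * t ^ j"
    using coords_of_minors[of "\<lambda>j. coord j x"] by blast
  have "x i = cone_point s t i" for i
  proof (cases "i \<le> n")
    case True
    then have "mpol_eval (linear_eq i) x = 0" using * unfolding curve_eqs_def by blast
    then show ?thesis using True st by (simp add: mpol_eval_linear_eq cone_point_def)
  next
    case False
    then show ?thesis using assms by (simp add: affine_space_def cone_point_def)
  qed
  then show "\<exists>s t. x = cone_point s t" by blast
next
  assume "\<exists>s t. x = cone_point s t"
  then show "\<forall>f\<in>curve_eqs. mpol_eval f x = 0"
    unfolding curve_eqs_def using linear_eq_cone_point minor_cone_point by auto
qed

lemma proj_alg_set_curve: "proj_alg_set n curve"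
proof -
  have "curve = {l \<in> proj_space n. \<forall>f\<in>curve_eqs. \<forall>v\<in>l. mpol_eval f v = 0}"
    unfolding proj_alg_set_Int_forms[OF curve_eqs_props(2)]
  proof (rule antisym; rule subsetI)
    fix l assume "l \<in> curve"
    then obtain s t where "l = vec.span {cone_point s t}" "s \<noteq> 0 \<or> t \<noteq> 0" by (auto simp: curve_def)
    then show "l \<in> {vec.span {u} | u. u \<in> affine_space (Suc n) \<and> u \<noteq> 0 \<and> (\<forall>f\<in>curve_eqs. mpol_eval f u = 0)}"
      using zeros_curve_eqs[OF cone_point_in_affine_space, of s t] cone_point_eq_0_iff[of s t]
        cone_point_in_affine_space[of s t] by blast
  next
    fix l assume "l \<in> {vec.span {u} | u. u \<in> affine_space (Suc n) \<and> u \<noteq> 0 \<and> (\<forall>f\<in>curve_eqs. mpol_eval f u = 0)}"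
    then obtain u where "l = vec.span {u}" "u \<in> affine_space (Suc n)" "u \<noteq> 0" "\<forall>f\<in>curve_eqs. mpol_eval f u = 0"
      by blast
    then show "l \<in> curve"
      using zeros_curve_eqs[of u] cone_point_eq_0_iff span_cone_point_in_curve by metis
  qed
  then show ?thesis unfolding proj_alg_set_def using curve_eqs_props by blast
qed

text \<open>A missing point yields an equation \<open>f\<close> of \<open>T\<close> that is not zero
  on the whole cone. Its pullback has finitely many zeros at s = 1, and s = 0 contributes at most
  one further point.\<close>

lemma finite_closed_subset_of_curve:
  assumes "proj_alg_set n T" "T \<subset> curve"
  shows "finite T"
proof -
  obtain P where P: "P \<subseteq> mpols (Suc n)" "\<forall>f\<in>P. \<exists>k. homogeneous k f"
    "T = {l \<in> proj_space n. \<forall>f\<in>P. \<forall>v\<in>l. mpol_eval f v = 0}"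
    using assms(1) unfolding proj_alg_set_def by auto
  obtain l where l: "l \<in> curve" "l \<notin> T" using assms(2) by blast
  have "curve \<subseteq> proj_space n" using proj_alg_set_curve unfolding proj_alg_set_def by blast
  then obtain f v where f: "f \<in> P" "v \<in> l" "mpol_eval f v \<noteq> 0" using l P(3) by blast
  obtain s t where "v = cone_point s t" using mem_curveE[OF l(1) f(2)] .
  then have "finite {t. mpol_eval f (cone_point 1 t) = 0}"
    using form_vanishes_on_cone[of f] f P(1,2) by blast
  moreover have "T \<subseteq> insert (vec.span {cone_point 0 1})
      ((\<lambda>t. vec.span {cone_point 1 t}) ` {t. mpol_eval f (cone_point 1 t) = 0})"
  proof
    fix l assume l: "l \<in> T"
    then have "l \<in> curve" using assms(2) by blast
    moreover have "mpol_eval f v = 0" if "v \<in> l" for v using l f P(3) that by blast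
    ultimately show "l \<in> insert (vec.span {cone_point 0 1})
      ((\<lambda>t. vec.span {cone_point 1 t}) ` {t. mpol_eval f (cone_point 1 t) = 0})"
      unfolding curve_eq using vec.span_base by blast
  qed
  ultimately show ?thesis using finite_subset by blast
qed

lemma irreducible_curve_curve: "irreducible_curve (proj_alg_set n) curve"
proof (rule irreducible_curveI)
  have "infinite (range (\<lambda>t. vec.span {cone_point 1 t}))"
    using finite_imageD[OF _ inj_curve_param] infinite_UNIV_char_0[where 'a = 'f] by auto
  then show "infinite curve" by (simp add: curve_eq)
  show "proj_alg_set n {l}" if "l \<in> curve" for l
    using that proj_alg_set_point[OF cone_point_in_affine_space] cone_point_eq_0_iff
    by (auto simp: curve_def)
qed (use proj_alg_set_curve proj_alg_set_Un finite_closed_subset_of_curve in auto)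

subsection \<open>Degree\<close>

text \<open>A linear form in the hyperplane coefficients. The value 0 beyond \<open>r\<close> makes
  it agree with the coefficient of \<open>hyp_poly\<close> at every index.\<close>

definition hyp_coeff :: "nat \<Rightarrow> 'f mpol" where
  "hyp_coeff j = (if j \<le> r then \<Sum>i\<le>n. mconst (B i j) * mvar i else 0)"

definition hyp_poly :: "(nat \<Rightarrow> 'f) \<Rightarrow> 'f poly" where
  "hyp_poly c = (\<Sum>j\<le>r. monom (mpol_eval (hyp_coeff j) c) j)"

lemma hyp_coeff_in_mpols: "hyp_coeff j \<in> mpols (Suc n)"
  unfolding hyp_coeff_def by (auto intro!: sum_in_mpols mult_in_mpols mvar_in_mpols simp del: One_nat_def)

lemma coeff_hyp_poly: "coeff (hyp_poly c) j = mpol_eval (hyp_coeff j) c"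
  by (simp add: hyp_poly_def coeff_sum hyp_coeff_def)

lemma hyperplane_cone_point:
  "(\<Sum>i\<le>n. c i * cone_point s t i) = (\<Sum>j\<le>r. mpol_eval (hyp_coeff j) c * (s ^ (r - j) * t ^ j))"
proof -
  have "(\<Sum>i\<le>n. c i * cone_point s t i) = (\<Sum>i\<le>n. \<Sum>j\<le>r. B i j * c i * (s ^ (r - j) * t ^ j))"
    by (auto simp: cone_point_def sum_distrib_left mult_ac intro!: sum.cong)
  also have "\<dots> = (\<Sum>j\<le>r. \<Sum>i\<le>n. B i j * c i * (s ^ (r - j) * t ^ j))" by (rule sum.swap)
  also have "\<dots> = (\<Sum>j\<le>r. mpol_eval (hyp_coeff j) c * (s ^ (r - j) * t ^ j))"
    by (simp add: hyp_coeff_def sum_distrib_right)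
  finally show ?thesis .
qed

text \<open>
  The columns of the Sylvester matrix of \<open>g\<close> and its derivative: a nontrivial relation
  \<open>u g + w g' = 0\<close> with \<open>deg u < r - 1\<close> and \<open>deg w < r\<close> exists iff \<open>g\<close> has a multiple root.
\<close>

definition sylv_col :: "'f poly \<Rightarrow> nat \<Rightarrow> 'f poly" where
  "sylv_col g j = (if j < r - 1 then monom 1 j * g else monom 1 (j - (r - 1)) * pderiv g)"

text \<open>The entries are polynomials in the hyperplane coefficients, so that elimination produces
  the open condition as a polynomial in them.\<close>

definition sylv_entry :: "nat \<Rightarrow> nat \<Rightarrow> 'f mpol" where
  "sylv_entry k j =
     (if j < r - 1 then if j \<le> k then hyp_coeff (k - j) else 0
      else let i = j - (r - 1) in
        if i \<le> k then mconst (of_nat (Suc (k - i))) * hyp_coeff (Suc (k - i)) else 0)"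

lemma sylv_entry_in_mpols: "sylv_entry k j \<in> mpols (Suc n)"
  by (auto simp: sylv_entry_def Let_def intro!: mult_in_mpols hyp_coeff_in_mpols)

lemma mpol_eval_sylv_entry: "mpol_eval (sylv_entry k j) c = coeff (sylv_col (hyp_poly c) j) k"
  by (auto simp: sylv_entry_def sylv_col_def Let_def coeff_monom_mult coeff_pderiv coeff_hyp_poly)

text \<open>The vector x lists the r - 1 coefficients of the multiplier of \<open>g\<close>, then
  the r coefficients of the multiplier of its derivative. All products have degree below 2 r, so the
  2 r rows record the whole polynomial.\<close>

lemma sylv_relation:
  assumes "degree g \<le> r"
  shows "(\<forall>k<2 * r. (\<Sum>j<2 * r - 1. coeff (sylv_col g j) k * x j) = 0) \<longleftrightarrow>
    (\<Sum>j<r - 1. monom (x j) j) * g + (\<Sum>j<r. monom (x (r - 1 + j)) j) * pderiv g = 0"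
    (is "?L \<longleftrightarrow> ?u * g + ?w * pderiv g = 0")
proof -
  have "?u * g + ?w * pderiv g = (\<Sum>j<2 * r - 1. smult (x j) (sylv_col g j))"
  proof -
    have "{..<2 * r - 1} = {..<r - 1} \<union> (\<lambda>j. r - 1 + j) ` {..<r}"
    proof -
      have "x \<in> (\<lambda>j. r - 1 + j) ` {..<r}" if "x < 2 * r - 1" "\<not> x < r - 1" for x
        using that by (intro image_eqI[of _ _ "x - (r - 1)"]) auto
      then show ?thesis using r_pos by auto
    qed
    then have "(\<Sum>j<2 * r - 1. smult (x j) (sylv_col g j)) =
      (\<Sum>j<r - 1. smult (x j) (sylv_col g j)) + (\<Sum>j\<in>(\<lambda>j. r - 1 + j) ` {..<r}. smult (x j) (sylv_col g j))"
      by (simp only:) (rule sum.union_disjoint, auto)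
    also have "(\<Sum>j\<in>(\<lambda>j. r - 1 + j) ` {..<r}. smult (x j) (sylv_col g j)) =
      (\<Sum>j<r. smult (x (r - 1 + j)) (sylv_col g (r - 1 + j)))"
      by (subst sum.reindex) auto
    also have "\<dots> = ?w * pderiv g"
    proof -
      have "sylv_col g (r - 1 + j) = monom 1 j * pderiv g" for j by (simp add: sylv_col_def)
      then show ?thesis by (simp only: smult_monom_mult sum_distrib_right)
    qed
    also have "(\<Sum>j<r - 1. smult (x j) (sylv_col g j)) = ?u * g"
      by (simp add: sylv_col_def sum_distrib_right smult_monom_mult)
    finally show ?thesis ..
  qed
  then have co: "coeff (?u * g + ?w * pderiv g) k = (\<Sum>j<2 * r - 1. coeff (sylv_col g j) k * x j)" for k
    by (simp add: coeff_sum mult.commute)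
  have "coeff (sylv_col g j) k = 0" if "k \<ge> 2 * r" "j < 2 * r - 1" for j k
    using that assms r_pos
    by (auto simp: sylv_col_def coeff_monom_mult coeff_pderiv intro!: coeff_eq_0)
  then have "?L \<longleftrightarrow> (\<forall>k. coeff (?u * g + ?w * pderiv g) k = 0)"
    unfolding co by (metis (no_types, lifting) lessThan_iff mult_zero_left not_less sum.neutral)
  also have "\<dots> \<longleftrightarrow> ?u * g + ?w * pderiv g = 0" by (auto simp: poly_eq_iff)
  finally show ?thesis .
qed

text \<open>Two conditions define a general hyperplane: a nonzero leading coefficient of
  \<open>hyp_poly\<close> keeps the intersection away from s = 0, and a trivial Sylvester kernel
  makes the r roots simple.\<close>

lemma has_degree_curve: "has_degree n curve r"
proof -
  \<comment> \<open>The hyperplane on which the two extreme coordinates agree. It cuts out t^r -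
    s^r, which has only simple roots in characteristic zero; it shows that the open condition is not
    void.\<close>
  define c0 where "c0 i = A r i - A 0 i" for i
  have g0: "hyp_poly c0 = monom 1 r - 1"
  proof (rule poly_eqI)
    fix j
    have "(\<Sum>i\<le>n. B i j * c0 i) = (\<Sum>i\<le>n. A r i * B i j) - (\<Sum>i\<le>n. A 0 i * B i j)"
      by (simp add: c0_def sum_subtractf algebra_simps)
    then show "coeff (hyp_poly c0) j = coeff (monom 1 r - 1) j"
      using r_pos by (auto simp: coeff_hyp_poly hyp_coeff_def left_inverse coeff_1)
  qed
  have deg: "degree (hyp_poly c) \<le> r" for c
    by (rule degree_le) (simp add: coeff_hyp_poly hyp_coeff_def)
  have "\<exists>G\<in>mpols (Suc n). mpol_eval G c0 \<noteq> 0 \<and>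
    (\<forall>c x. mpol_eval G c \<noteq> 0 \<longrightarrow> (\<forall>k<2 * r. (\<Sum>j<2 * r - 1. mpol_eval (sylv_entry k j) c * x j) = 0) \<longrightarrow>
      (\<forall>j<2 * r - 1. x j = 0))"
  proof (rule generic_trivial_kernel)
    fix x assume x: "\<And>k. k < 2 * r \<Longrightarrow> (\<Sum>j<2 * r - 1. mpol_eval (sylv_entry k j) c0 * x j) = 0"
    define u where "u = (\<Sum>j<r - 1. monom (x j) j)"
    define w where "w = (\<Sum>j<r. monom (x (r - 1 + j)) j)"
    have "u * hyp_poly c0 + w * pderiv (hyp_poly c0) = 0"
      unfolding u_def w_def using x sylv_relation[OF deg, of c0 x] by (simp add: mpol_eval_sylv_entry)
    then have "u * (monom 1 r - 1) + w * monom (of_nat r) (r - 1) = 0"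
      by (simp add: g0 pderiv_diff pderiv_monom)
    then have "u = u * monom 1 r + w * monom (of_nat r) (r - 1)"
      by (simp add: right_diff_distrib algebra_simps)
    moreover have "monom 1 r = monom 1 (r - 1) * [:0, 1 :: 'f:]"
      using r_pos by (cases r) (simp_all add: monom_Suc)
    moreover have "monom (of_nat r) (r - 1) = monom 1 (r - 1) * [:of_nat r :: 'f:]"
      by (simp add: smult_monom)
    ultimately have "u = u * (monom 1 (r - 1) * [:0, 1:]) + w * (monom 1 (r - 1) * [:of_nat r:])"
      by argo
    also have "\<dots> = monom 1 (r - 1) * ([:0, 1:] * u + [:of_nat r:] * w)"
      by (simp only: ring_distribs mult_ac)
    finally have u: "u = monom 1 (r - 1) * ([:0, 1:] * u + [:of_nat r:] * w)" .
    \<comment> \<open>By the last identity \<open>u\<close> is divisible by t^(r-1), while its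
      degree is below r - 1.\<close>
    have "u = 0"
    proof (rule poly_eqI)
      fix k
      have "coeff u k = (if k < r - 1 then x k else 0)" by (simp add: u_def coeff_sum_monom)
      moreover have "coeff u k = 0" if "k < r - 1"
        using that by (subst u) (simp add: coeff_monom_mult)
      ultimately show "coeff u k = coeff 0 k" by simp
    qed
    then have "monom 1 (r - 1) * ([:of_nat r:] * w) = 0" using u by simp
    \<comment> \<open>Characteristic zero enters: \<open>of_nat r\<close> is nonzero.\<close>
    then have "w = 0" using r_pos by simp
    show "\<forall>j<2 * r - 1. x j = 0"
    proof (intro allI impI)
      fix j assume j: "j < 2 * r - 1"
      show "x j = 0"
      proof (cases "j < r - 1")
        case True
        then show ?thesis using \<open>u = 0\<close> coeff_sum_monom[of x "r - 1" j] by (simp add: u_def)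
      next
        case False
        then have "j - (r - 1) < r" "r - 1 + (j - (r - 1)) = j" using j by auto
        then have "coeff w (j - (r - 1)) = x j" unfolding w_def coeff_sum_monom by simp
        then show ?thesis using \<open>w = 0\<close> by simp
      qed
    qed
  qed (rule sylv_entry_in_mpols)
  then obtain G where G: "G \<in> mpols (Suc n)" "mpol_eval G c0 \<noteq> 0"
    and ker: "\<And>c x. mpol_eval G c \<noteq> 0 \<Longrightarrow>
      (\<forall>k<2 * r. (\<Sum>j<2 * r - 1. mpol_eval (sylv_entry k j) c * x j) = 0) \<Longrightarrow> \<forall>j<2 * r - 1. x j = 0"
    by blast
  have lead0: "mpol_eval (hyp_coeff r) c0 = 1"
    using r_pos by (simp flip: coeff_hyp_poly add: g0 coeff_1)
  define G' where "G' = hyp_coeff r * G"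
  have G': "G' \<in> mpols (Suc n)" unfolding G'_def by (intro mult_in_mpols G hyp_coeff_in_mpols)
  have G'0: "G' \<noteq> 0" using G(2) lead0 mpol_eval_zero[of c0] unfolding G'_def
    by (metis mpol_eval_mult mult_cancel_right1)
  have "finite H \<and> card H = r"
    if c: "mpol_eval G' c \<noteq> 0" and H: "H = {l \<in> curve. \<forall>v\<in>l. (\<Sum>i\<le>n. c i * v i) = 0}" for c H
  proof -
    define g where "g = hyp_poly c"
    have lead: "coeff g r \<noteq> 0" using c by (simp add: g_def G'_def coeff_hyp_poly)
    then have deg_g: "degree g = r" using deg[of c] le_degree[of g r] unfolding g_def by auto
    have "poly (pderiv g) \<tau> \<noteq> 0" if root: "poly g \<tau> = 0" for \<tau>
    proof
      assume "poly (pderiv g) \<tau> = 0"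
      then obtain p q where p: "g = [:-\<tau>, 1:] * p" and q: "pderiv g = [:-\<tau>, 1:] * q"
        using root by (metis dvd_def poly_eq_0_iff_dvd)
      have g0: "g \<noteq> 0" using lead by auto
      then have p0: "p \<noteq> 0" using p by auto
      then have deg_p: "degree g = Suc (degree p)" unfolding p by (subst degree_mult_eq) auto
      have coeff_q: "coeff q j = 0" if "j \<ge> r - 1" for j
      proof (cases "q = 0")
        case False
        then have "degree (pderiv g) = Suc (degree q)" unfolding q by (subst degree_mult_eq) auto
        moreover have "degree (pderiv g) = r - 1" using degree_pderiv[of g] deg_g by simp
        ultimately show ?thesis using that by (intro coeff_eq_0) auto
      qed simp
      \<comment> \<open>A common root gives g = (t - \<tau>) p and g' = (t - \<tau>) q, hence the
        relation q g - p g' = 0; x lists the coefficients of q and - p. It is nontrivial because the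
        leading coefficient of p, of degree r - 1, occurs in it.\<close>
      define x where "x j = (if j < r - 1 then coeff q j else - coeff p (j - (r - 1)))" for j
      have "(\<Sum>j<r - 1. monom (x j) j) = q"
        by (rule poly_eqI) (auto simp: coeff_sum_monom x_def coeff_q)
      moreover have "(\<Sum>j<r. monom (x (r - 1 + j)) j) = - p"
        using deg_p deg_g by (intro poly_eqI) (auto simp: coeff_sum_monom x_def intro!: coeff_eq_0)
      moreover have "q * g + - p * pderiv g = 0"
      proof -
        have "q * (l * p) + - p * (l * q) = 0" for l :: "'f poly" by (simp add: mult_ac)
        from this[of "[:-\<tau>, 1:]"] show ?thesis by (simp only: p[symmetric] q[symmetric])
      qed
      ultimately have "\<forall>k<2 * r. (\<Sum>j<2 * r - 1. mpol_eval (sylv_entry k j) c * x j) = 0"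
        using sylv_relation[OF deg, of c x] by (simp add: mpol_eval_sylv_entry g_def)
      then have "\<forall>j<2 * r - 1. x j = 0" using c by (intro ker) (auto simp: G'_def)
      then have "x (r - 1 + degree p) = 0" using deg_p deg_g by auto
      then show False using p0 by (simp add: x_def)
    qed
    then have card: "card {t. poly g t = 0} = r"
      using card_simple_roots[of g] alg_closed lead deg_g by fastforce
    have g_poly: "poly g t = (\<Sum>i\<le>n. c i * cone_point 1 t i)" for t
      by (simp add: hyperplane_cone_point g_def hyp_poly_def poly_sum poly_monom)
    have hyp: "(\<forall>v\<in>vec.span {u}. (\<Sum>i\<le>n. c i * v i) = 0) \<longleftrightarrow> (\<Sum>i\<le>n. c i * u i) = 0" for u
    proof -
      have "(\<Sum>i\<le>n. c i * vscale a u i) = a * (\<Sum>i\<le>n. c i * u i)" for a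
        by (simp add: vscale_def sum_distrib_left mult_ac)
      then show ?thesis using vec.span_base[of u "{u}"] by (auto simp: vec.span_singleton)
    qed
    \<comment> \<open>At the point with s = 0 the linear form takes the leading coefficient as its
      value, so this point is not on the hyperplane.\<close>
    have "(\<Sum>i\<le>n. c i * cone_point 0 1 i) = coeff g r"
    proof -
      have "(\<Sum>i\<le>n. c i * cone_point 0 1 i) = (\<Sum>j\<le>r. if j = r then mpol_eval (hyp_coeff j) c else 0)"
        unfolding hyperplane_cone_point by (intro sum.cong) auto
      then show ?thesis by (simp add: g_def coeff_hyp_poly)
    qed
    then have "H = (\<lambda>t. vec.span {cone_point 1 t}) ` {t. poly g t = 0}"
      unfolding H curve_eq using lead hyp g_poly by auto
    moreover have "inj_on (\<lambda>t. vec.span {cone_point 1 t}) {t. poly g t = 0}"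
      using inj_curve_param by (rule inj_on_subset) simp
    moreover have "finite {t. poly g t = 0}" using lead by (intro poly_roots_finite) auto
    ultimately show ?thesis using card by (simp add: card_image)
  qed
  then show ?thesis unfolding has_degree_def Let_def using G' G'0 by blast
qed

end

section \<open>The homogeneous ideal\<close>

lemma ring_of_type_algebra_simps [simp]:
  "carrier ring_of_type_algebra = UNIV"
  "x \<otimes>\<^bsub>ring_of_type_algebra\<^esub> y = x * y" "x \<oplus>\<^bsub>ring_of_type_algebra\<^esub> y = x + y"
  "\<one>\<^bsub>ring_of_type_algebra\<^esub> = 1" "\<zero>\<^bsub>ring_of_type_algebra\<^esub> = 0"
  by (simp_all add: ring_of_type_algebra_def)

lemma a_inv_ring_of_type_algebra [simp]:
  "\<ominus>\<^bsub>ring_of_type_algebra\<^esub> (x :: 'a::comm_ring_1) = - x"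
proof -
  interpret cring "ring_of_type_algebra :: 'a ring" by (rule cring_from_type_algebra)
  show ?thesis using minus_equality[of "- x" x] by simp
qed

lemma mpol_ring_simps [simp]:
  "carrier (mpol_ring N) = mpols N"
  "x \<otimes>\<^bsub>mpol_ring N\<^esub> y = x * y" "x \<oplus>\<^bsub>mpol_ring N\<^esub> y = x + y"
  "\<one>\<^bsub>mpol_ring N\<^esub> = 1" "\<zero>\<^bsub>mpol_ring N\<^esub> = 0"
  by (simp_all add: mpol_ring_def ring_of_type_algebra_def)

lemma cring_mpol_ring: "cring (mpol_ring N :: 'f::field mpol ring)"
proof -
  interpret T: cring "ring_of_type_algebra :: 'f mpol ring" by (rule cring_from_type_algebra)
  have "subring (mpols N) (ring_of_type_algebra :: 'f mpol ring)"
    by (rule T.subringI) (auto intro: uminus_in_mpols add_in_mpols mult_in_mpols)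
  then have "subcring (mpols N) (ring_of_type_algebra :: 'f mpol ring)" by (rule T.subcringI')
  then show ?thesis unfolding mpol_ring_def by (subst (asm) T.subcring_iff) auto
qed

lemma a_inv_mpol_ring [simp]: "p \<in> mpols N \<Longrightarrow> \<ominus>\<^bsub>mpol_ring N\<^esub> p = - (p :: 'f::field mpol)"
proof -
  assume p: "p \<in> mpols N"
  interpret cring "mpol_ring N :: 'f mpol ring" by (rule cring_mpol_ring)
  show ?thesis using minus_equality[of "- p" p] p by (simp add: uminus_in_mpols)
qed

lemma ideal_homogeneous_ideal: "ideal (homogeneous_ideal n Y) (mpol_ring (Suc n))"
proof -
  interpret cring "mpol_ring (Suc n) :: 'a mpol ring" by (rule cring_mpol_ring)
  show ?thesis
    unfolding homogeneous_ideal_def by (rule genideal_ideal) (auto simp: vanishing_forms_def)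
qed

lemma vanishing_form_in_ideal: "f \<in> vanishing_forms n Y \<Longrightarrow> f \<in> homogeneous_ideal n Y"
proof -
  interpret cring "mpol_ring (Suc n) :: 'a mpol ring" by (rule cring_mpol_ring)
  have "vanishing_forms n Y \<subseteq> homogeneous_ideal n Y"
    unfolding homogeneous_ideal_def by (rule genideal_self) (auto simp: vanishing_forms_def)
  then show "f \<in> vanishing_forms n Y \<Longrightarrow> f \<in> homogeneous_ideal n Y" by blast
qed

lemma homogeneous_ideal_in_mpols: "f \<in> homogeneous_ideal n Y \<Longrightarrow> f \<in> mpols (Suc n)"
  using additive_subgroup.a_subset[OF ideal.axioms(1)[OF ideal_homogeneous_ideal[of n Y]]] by auto

lemma homogeneous_ideal_closed:
  "0 \<in> homogeneous_ideal n Y"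
  "f \<in> homogeneous_ideal n Y \<Longrightarrow> g \<in> homogeneous_ideal n Y \<Longrightarrow> f + g \<in> homogeneous_ideal n Y"
  "f \<in> homogeneous_ideal n Y \<Longrightarrow> mconst c * f \<in> homogeneous_ideal n Y"
  using additive_subgroup.zero_closed[OF ideal.axioms(1)[OF ideal_homogeneous_ideal[of n Y]]]
    additive_subgroup.a_closed[OF ideal.axioms(1)[OF ideal_homogeneous_ideal[of n Y]], of f g]
    ideal.I_l_closed[OF ideal_homogeneous_ideal[of n Y], of f "mconst c"]
  by auto

lemma homogeneous_ideal_sum:
  "(\<And>i. i \<in> S \<Longrightarrow> f i \<in> homogeneous_ideal n Y) \<Longrightarrow> sum f S \<in> homogeneous_ideal n Y"
  by (induction S rule: infinite_finite_induct) (auto intro: homogeneous_ideal_closed)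

text \<open>Elements of the generated ideal need not be homogeneous; vanishing passes to them
  because the polynomials that vanish at \<open>v\<close> form an ideal.\<close>

lemma homogeneous_ideal_vanishes:
  assumes "f \<in> homogeneous_ideal n Y" "l \<in> Y" "v \<in> l"
  shows "mpol_eval f v = 0"
proof -
  interpret cring "mpol_ring (Suc n) :: 'a mpol ring" by (rule cring_mpol_ring)
  let ?J = "{f \<in> mpols (Suc n). mpol_eval f v = 0}"
  have "subgroup ?J (add_monoid (mpol_ring (Suc n)))"
    by (rule add.subgroupI)
       (auto intro: uminus_in_mpols add_in_mpols exI[of _ 0])
  then have "ideal ?J (mpol_ring (Suc n))"
    by (intro idealI ring_axioms) (auto intro: mult_in_mpols)
  moreover have "vanishing_forms n Y \<subseteq> ?J" using assms(2,3) by (auto simp: vanishing_forms_def)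
  ultimately have "homogeneous_ideal n Y \<subseteq> ?J"
    unfolding homogeneous_ideal_def by (rule genideal_minimal)
  then show ?thesis using assms(1) by blast
qed

text \<open>Value and derivative are stated for one and the same univariate polynomial, so that its
  vanishing as a function also gives a relation between the partial derivatives.\<close>

lemma chain_rule:
  fixes P :: "nat \<Rightarrow> 'f::field poly"
  assumes "f \<in> mpols N"
  shows "\<exists>g. \<forall>x. poly g x = mpol_eval f (\<lambda>i. poly (P i) x) \<and>
    poly (pderiv g) x = (\<Sum>i<N. mpol_eval (mpol_deriv i f) (\<lambda>i. poly (P i) x) * poly (pderiv (P i)) x)"
  using assms
proof (induction f rule: mpols_induct)
  case (const c)
  show ?case by (intro exI[of _ "[:c:]"]) (simp add: pderiv_pCons)
next
  case (var j)
  have "(\<Sum>i<N. (if i = j then 1 else 0) * poly (pderiv (P i)) x) = poly (pderiv (P j)) x" for x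
  proof -
    have "(\<Sum>i<N. (if i = j then 1 else 0) * poly (pderiv (P i)) x) =
      (\<Sum>i<N. if i = j then poly (pderiv (P i)) x else 0)" by (intro sum.cong) auto
    then show ?thesis using var by simp
  qed
  then show ?case by (intro exI[of _ "P j"]) simp
next
  case (add p q)
  then obtain g h where
    "\<And>x. poly g x = mpol_eval p (\<lambda>i. poly (P i) x) \<and>
      poly (pderiv g) x = (\<Sum>i<N. mpol_eval (mpol_deriv i p) (\<lambda>i. poly (P i) x) * poly (pderiv (P i)) x)"
    "\<And>x. poly h x = mpol_eval q (\<lambda>i. poly (P i) x) \<and>
      poly (pderiv h) x = (\<Sum>i<N. mpol_eval (mpol_deriv i q) (\<lambda>i. poly (P i) x) * poly (pderiv (P i)) x)"
    by blast
  then show ?case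
    by (intro exI[of _ "g + h"]) (simp add: pderiv_add distrib_right sum.distrib)
next
  case (mult p q)
  then obtain g h where
    "\<And>x. poly g x = mpol_eval p (\<lambda>i. poly (P i) x) \<and>
      poly (pderiv g) x = (\<Sum>i<N. mpol_eval (mpol_deriv i p) (\<lambda>i. poly (P i) x) * poly (pderiv (P i)) x)"
    "\<And>x. poly h x = mpol_eval q (\<lambda>i. poly (P i) x) \<and>
      poly (pderiv h) x = (\<Sum>i<N. mpol_eval (mpol_deriv i q) (\<lambda>i. poly (P i) x) * poly (pderiv (P i)) x)"
    by blast
  then show ?case
    by (intro exI[of _ "g * h"])
       (simp add: pderiv_mult algebra_simps sum.distrib sum_distrib_left)
qed

lemma pderiv_sum: "pderiv (sum f S) = (\<Sum>i\<in>S. pderiv (f i :: 'f::field poly))"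
  by (induction S rule: infinite_finite_induct) (auto simp: pderiv_add)

section \<open>Regularity\<close>

context rational_normal_cone
begin

lemma form_in_homogeneous_ideal:
  assumes "f \<in> mpols (Suc n)" "homogeneous k f" "\<And>s t. mpol_eval f (cone_point s t) = 0"
  shows "f \<in> homogeneous_ideal n curve"
  using assms vanishes_on_curve_iff[OF assms(2)]
  by (intro vanishing_form_in_ideal) (auto simp: vanishing_forms_def)

lemma homogeneous_ideal_cone_point:
  assumes "f \<in> homogeneous_ideal n curve"
  shows "mpol_eval f (cone_point s t) = 0"
proof (cases "s = 0 \<and> t = 0")
  case True
  then have "cone_point s t = 0" by (simp add: cone_point_eq_0_iff)
  then have "cone_point s t \<in> vec.span {cone_point 1 0}" by (simp add: vec.span_zero)
  then show ?thesis
    using homogeneous_ideal_vanishes[OF assms span_cone_point_in_curve[of 1 0]] by simp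
next
  case False
  then show ?thesis
    using homogeneous_ideal_vanishes[OF assms span_cone_point_in_curve[of s t]]
    by (simp add: vec.span_base)
qed

text \<open>Along a polynomial path inside the cone an element of the ideal becomes the zero
  polynomial, hence its derivative vanishes: the gradient is orthogonal to the velocity of the
  path.\<close>

lemma gradient_annihilates:
  assumes f: "f \<in> homogeneous_ideal n curve"
    and P: "\<And>x. \<exists>s t. (\<lambda>i. poly (P i) x) = cone_point s t"
  shows "(\<Sum>i<Suc n. gradient n f (\<lambda>i. poly (P i) x) i * poly (pderiv (P i)) x) = 0"
proof -
  obtain g where g: "\<And>x. poly g x = mpol_eval f (\<lambda>i. poly (P i) x)"
    "\<And>x. poly (pderiv g) x =
      (\<Sum>i<Suc n. mpol_eval (mpol_deriv i f) (\<lambda>i. poly (P i) x) * poly (pderiv (P i)) x)"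
    using chain_rule[OF homogeneous_ideal_in_mpols[OF f], of P] by blast
  have "poly g x = 0" for x
    unfolding g using P[of x] homogeneous_ideal_cone_point[OF f] by metis
  then have "g = 0" using poly_all_0_iff_0 by blast
  then show ?thesis using g(2)[of x] by (simp add: gradient_def)
qed

text \<open>The derivative of \<open>cone_point s t\<close> with respect to t. The factor
  \<open>of_nat j\<close> removes the term j = 0, where j - 1 is truncated.\<close>

definition tangent :: "'f \<Rightarrow> 'f \<Rightarrow> nat \<Rightarrow> 'f" where
  "tangent s t i = (if i \<le> n then \<Sum>j\<le>r. B i j * (s ^ (r - j) * (of_nat j * t ^ (j - 1))) else 0)"

lemma coord_tangent: "j \<le> r \<Longrightarrow> coord j (tangent s t) = s ^ (r - j) * (of_nat j * t ^ (j - 1))"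
  unfolding coord_def using coord_lincomb[of j "\<lambda>j. s ^ (r - j) * (of_nat j * t ^ (j - 1))"]
  by (simp add: tangent_def)

text \<open>Two paths through the point are used: the line through the origin, taken at parameter 1,
  and the curve with s fixed and t moving.\<close>

lemma gradient_orthogonal:
  assumes f: "f \<in> homogeneous_ideal n curve"
  shows "(\<Sum>i<Suc n. cone_point s t i * gradient n f (cone_point s t) i) = 0"
    "(\<Sum>i<Suc n. tangent s t i * gradient n f (cone_point s t) i) = 0"
proof -
  let ?P = "\<lambda>i. [:0, cone_point s t i:]"
  have "(\<lambda>i. poly (?P i) x) = vscale x (cone_point s t)" for x by (simp add: vscale_def)
  then have "\<exists>s' t'. (\<lambda>i. poly (?P i) x) = cone_point s' t'" for x
    by (metis vscale_cone_point)
  from gradient_annihilates[OF f this, of 1]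
  show "(\<Sum>i<Suc n. cone_point s t i * gradient n f (cone_point s t) i) = 0"
    by (simp add: pderiv_pCons mult.commute)
next
  let ?P = "\<lambda>i. if i \<le> n then \<Sum>j\<le>r. monom (B i j * s ^ (r - j)) j else 0"
  have eq: "(\<lambda>i. poly (?P i) x) = cone_point s x" for x
    by (auto simp: cone_point_def fun_eq_iff poly_sum poly_monom mult_ac)
  have der: "poly (pderiv (?P i)) x = tangent s x i" for i x
    by (auto simp: tangent_def poly_sum poly_monom pderiv_sum pderiv_monom mult_ac intro!: sum.cong)
  have "\<exists>s' t'. (\<lambda>i. poly (?P i) x) = cone_point s' t'" for x unfolding eq by blast
  from gradient_annihilates[OF f this, of t]
  show "(\<Sum>i<Suc n. tangent s t i * gradient n f (cone_point s t) i) = 0"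
    unfolding eq der by (simp add: mult.commute)
qed

text \<open>For nonzero s this is the annihilator of the tangent plane of the cone, which is spanned
  by the point itself and the derivative in t.\<close>

definition normal_space :: "'f \<Rightarrow> 'f \<Rightarrow> (nat \<Rightarrow> 'f) set" where
  "normal_space s t = {w \<in> affine_space (Suc n).
     (\<Sum>i<Suc n. tangent s t i * w i) = 0 \<and> (\<Sum>i<Suc n. cone_point s t i * w i) = 0}"

definition coord_row :: "nat \<Rightarrow> nat \<Rightarrow> 'f" where
  "coord_row j i = (if i \<le> n then A j i else 0)"

lemma coord_row_mult: "(\<Sum>i<Suc n. x i * coord_row j i) = coord j x"
  by (simp add: coord_def coord_row_def lessThan_Suc_atMost mult.commute)

text \<open>The two conditions are independent: row 1 of \<open>A\<close> pairs with the tangent to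
  s^(r-1), while row 0 pairs to 0 with the tangent and to s^r with the point. Each condition lowers
  the dimension n + 1 by one.\<close>

lemma dim_normal_space:
  assumes "s \<noteq> 0"
  shows "vec.dim (normal_space s t) = n - 1"
proof -
  have row: "coord_row j \<in> affine_space (Suc n)" for j
    by (simp add: affine_space_def coord_row_def)
  define W where "W = {w \<in> affine_space (Suc n). (\<Sum>i<Suc n. tangent s t i * w i) = 0}"
  have "vec.subspace W" and 1: "vec.dim (affine_space (Suc n) :: (nat \<Rightarrow> 'f) set) = Suc (vec.dim W)"
    unfolding W_def using assms r_pos
    by (intro dim_hyperplane[OF subspace_affine_space order_refl row[of 1]];
        simp only: coord_row_mult coord_tangent; simp)+
  moreover have "coord_row 0 \<in> W"
    unfolding W_def using row[of 0] by (simp only: mem_Collect_eq coord_row_mult coord_tangent) simp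
  moreover have "(\<Sum>i<Suc n. cone_point s t i * coord_row 0 i) \<noteq> 0"
    using assms by (simp only: coord_row_mult coord_cone_point) simp
  ultimately have "vec.dim W = Suc (vec.dim {w \<in> W. (\<Sum>i<Suc n. cone_point s t i * w i) = 0})"
    by (intro dim_hyperplane(2)[where N = "Suc n"]) (auto simp: W_def)
  moreover have "{w \<in> W. (\<Sum>i<Suc n. cone_point s t i * w i) = 0} = normal_space s t"
    by (auto simp: W_def normal_space_def)
  ultimately show ?thesis using 1 by (simp add: dim_affine_space)
qed

lemma gradient_in_normal_space:
  assumes "f \<in> homogeneous_ideal n curve"
  shows "gradient n f (cone_point s t) \<in> normal_space s t"
  using gradient_orthogonal[OF assms]
  by (simp add: normal_space_def affine_space_def gradient_def)

lemma sum_split_two: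
  fixes f :: "nat \<Rightarrow> 'f"
  shows "(\<Sum>j\<le>r. f j) = f 0 + f 1 + (\<Sum>j=2..r. f j)"
proof -
  have "{..r} = insert 0 (insert 1 {2..r})" using r_pos by auto
  then show ?thesis by (simp add: add.assoc)
qed

text \<open>
  In the affine chart where coordinate 0 is 1, the equations \<open>power_eq j\<close> express coordinate
  \<open>j\<close> as the \<open>j\<close>-th power of coordinate 1, so that the curve is a graph there.
\<close>

definition power_eq :: "nat \<Rightarrow> 'f mpol" where
  "power_eq j = coord_form 0 ^ (j - 1) * coord_form j - coord_form 1 ^ j"

lemma power_eq_in_ideal:
  assumes "1 \<le> j" "j \<le> r"
  shows "power_eq j \<in> homogeneous_ideal n curve"
proof (rule form_in_homogeneous_ideal)
  show "power_eq j \<in> mpols (Suc n)"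
    unfolding power_eq_def by (intro diff_in_mpols mult_in_mpols power_in_mpols coord_form_in_mpols)
  have "homogeneous ((j - 1) * 1 + 1) (power_eq j)"
    unfolding power_eq_def
  proof (rule homogeneous_diff)
    show "homogeneous ((j - 1) * 1 + 1) (coord_form 0 ^ (j - 1) * coord_form j)"
      by (intro homogeneous_mult homogeneous_power homogeneous_coord_form)
    show "homogeneous ((j - 1) * 1 + 1) (coord_form 1 ^ j)"
      using homogeneous_power[OF homogeneous_coord_form, of j 1] assms by simp
  qed
  then show "homogeneous j (power_eq j)" using assms by simp
  fix s t :: 'f
  have e: "r * (j - 1) + (r - j) = (r - 1) * j"
  proof -
    obtain i k where "j = Suc i" "r = Suc i + k"
      using assms by (metis One_nat_def Suc_pred' less_eq_Suc_le le_iff_add)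
    then show ?thesis by (simp add: algebra_simps)
  qed
  have "(s ^ r) ^ (j - 1) * (s ^ (r - j) * t ^ j) = s ^ (r * (j - 1) + (r - j)) * t ^ j"
    by (simp only: power_add power_mult mult.assoc)
  also have "\<dots> = (s ^ (r - 1) * t) ^ j"
    by (simp only: e power_mult power_mult_distrib)
  finally show "mpol_eval (power_eq j) (cone_point s t) = 0"
    using assms by (simp add: power_eq_def coord_cone_point)
qed

lemma mpol_eval_deriv_coord_form:
  "k \<le> n \<Longrightarrow> mpol_eval (mpol_deriv k (coord_form j)) x = A j k"
proof -
  assume "k \<le> n"
  have "mpol_eval (mpol_deriv k (coord_form j)) x = (\<Sum>i\<le>n. A j i * (if k = i then 1 else 0))"
    by (simp add: coord_form_def)
  also have "\<dots> = (\<Sum>i\<le>n. if k = i then A j i else 0)" by (intro sum.cong) auto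
  finally show ?thesis using \<open>k \<le> n\<close> by simp
qed

text \<open>An element of the ideal is built whose gradient is \<open>w\<close> up to a combination
  of rows 0 and 1 of \<open>A\<close>. Since \<open>w\<close> and all gradients annihilate the
  tangent plane, this combination does too, and pairing it with tangent and point shows that it is
  zero.\<close>

lemma normal_space_subset:
  assumes "s \<noteq> 0"
  shows "normal_space s t \<subseteq> (\<lambda>f. gradient n f (cone_point s t)) ` homogeneous_ideal n curve"
proof
  fix w assume w: "w \<in> normal_space s t"
  let ?v = "cone_point s t"
  define z where "z j = (\<Sum>i\<le>n. w i * B i j)" for j
  define y where "y = s ^ r"
  have y: "y \<noteq> 0" using assms by (simp add: y_def)
  \<comment> \<open>The linear equations contribute w - z A to the gradient. The equation
    \<open>power_eq j\<close> contributes y^(j-1) times row j of \<open>A\<close>, up to rows 0 and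
    1; dividing by this power restores the rows j with 2 \<le> j.\<close>
  define F where "F = (\<Sum>i\<le>n. mconst (w i) * linear_eq i) +
    (\<Sum>j=2..r. mconst (z j / y ^ (j - 1)) * power_eq j)"
  have F: "F \<in> homogeneous_ideal n curve"
    unfolding F_def
    by (intro homogeneous_ideal_closed homogeneous_ideal_sum power_eq_in_ideal
        form_in_homogeneous_ideal[OF linear_eq_in_mpols homogeneous_linear_eq linear_eq_cone_point]) auto
  \<comment> \<open>\<open>c0\<close> and \<open>c1\<close> collect the multiples of rows 0 and 1:
    those produced by the power equations, and the unrestored - \<open>z 0\<close> and -
    \<open>z 1\<close>.\<close>
  define c0 where "c0 = (\<Sum>j=2..r. z j / y ^ (j - 1) * (of_nat (j - 1) * y ^ (j - 1 - 1) * coord j ?v)) - z 0"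
  define c1 where "c1 = - (\<Sum>j=2..r. z j / y ^ (j - 1) * (of_nat j * coord 1 ?v ^ (j - 1))) - z 1"
  have grad: "gradient n F ?v = w + vscale c0 (coord_row 0) + vscale c1 (coord_row 1)"
  proof
    fix k
    show "gradient n F ?v k = (w + vscale c0 (coord_row 0) + vscale c1 (coord_row 1)) k"
    proof (cases "k \<le> n")
      case True
      have lin: "(\<Sum>i\<le>n. w i * mpol_eval (mpol_deriv k (linear_eq i)) ?v) = w k - (\<Sum>j\<le>r. z j * A j k)"
      proof -
        have "(\<Sum>i\<le>n. w i * mpol_eval (mpol_deriv k (linear_eq i)) ?v) =
            (\<Sum>i\<le>n. w i * ((if k = i then 1 else 0) - (\<Sum>j\<le>r. B i j * A j k)))"
          using True by (simp add: linear_eq_def mpol_eval_deriv_coord_form)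
        also have "\<dots> = (\<Sum>i\<le>n. if k = i then w i else 0) - (\<Sum>i\<le>n. \<Sum>j\<le>r. w i * B i j * A j k)"
          unfolding sum_subtractf[symmetric]
          by (intro sum.cong) (auto simp: right_diff_distrib sum_distrib_left mult_ac)
        also have "(\<Sum>i\<le>n. \<Sum>j\<le>r. w i * B i j * A j k) = (\<Sum>j\<le>r. z j * A j k)"
          by (subst sum.swap) (simp add: z_def sum_distrib_right)
        finally show ?thesis using True by simp
      qed
      have y_coord: "coord 0 ?v = y" by (simp add: coord_cone_point y_def)
      have pow: "z j / y ^ (j - 1) * mpol_eval (mpol_deriv k (power_eq j)) ?v =
          z j * A j k + z j / y ^ (j - 1) * (of_nat (j - 1) * y ^ (j - 1 - 1) * coord j ?v) * A 0 k
          - z j / y ^ (j - 1) * (of_nat j * coord 1 ?v ^ (j - 1)) * A 1 k" if "j \<in> {2..r}" for j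
        using True y
        by (simp add: power_eq_def mpol_eval_deriv_power mpol_eval_deriv_coord_form y_coord field_simps)
      have "gradient n F ?v k = (\<Sum>i\<le>n. w i * mpol_eval (mpol_deriv k (linear_eq i)) ?v) +
          (\<Sum>j=2..r. z j / y ^ (j - 1) * mpol_eval (mpol_deriv k (power_eq j)) ?v)"
        using True by (simp add: gradient_def F_def)
      also have "(\<Sum>j=2..r. z j / y ^ (j - 1) * mpol_eval (mpol_deriv k (power_eq j)) ?v) =
        (\<Sum>j=2..r. z j * A j k
          + z j / y ^ (j - 1) * (of_nat (j - 1) * y ^ (j - 1 - 1) * coord j ?v) * A 0 k
          - z j / y ^ (j - 1) * (of_nat j * coord 1 ?v ^ (j - 1)) * A 1 k)"
        by (rule sum.cong[OF refl]) (rule pow)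
      also have "\<dots> = (\<Sum>j=2..r. z j * A j k) + (c0 + z 0) * A 0 k + (c1 + z 1) * A 1 k"
        unfolding sum.distrib sum_subtractf by (simp add: c0_def c1_def sum_distrib_right)
      also have "(\<Sum>i\<le>n. w i * mpol_eval (mpol_deriv k (linear_eq i)) ?v) =
        w k - (z 0 * A 0 k + z 1 * A 1 k + (\<Sum>j=2..r. z j * A j k))"
        unfolding lin sum_split_two ..
      finally show ?thesis using True by (simp add: vscale_def coord_row_def algebra_simps)
    next
      case False
      then show ?thesis
        using w by (simp add: gradient_def normal_space_def affine_space_def vscale_def coord_row_def)
    qed
  qed
  have expand: "(\<Sum>i<Suc n. x i * gradient n F ?v i) =
      (\<Sum>i<Suc n. x i * w i) + c0 * coord 0 x + c1 * coord 1 x" for x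
  proof -
    have "(\<Sum>i<Suc n. x i * gradient n F ?v i) = (\<Sum>i<Suc n. x i * w i) +
      c0 * (\<Sum>i<Suc n. x i * coord_row 0 i) + c1 * (\<Sum>i<Suc n. x i * coord_row 1 i)"
      unfolding grad
      by (simp only: plus_fun_apply vscale_def sum_distrib_left distrib_left sum.distrib mult_ac)
    then show ?thesis by (simp only: coord_row_mult)
  qed
  \<comment> \<open>The tangent pairs to zero with row 0, so it isolates \<open>c1\<close>; the
    point itself then isolates \<open>c0\<close>.\<close>
  have "c1 = 0"
  proof -
    have "c0 * coord 0 (tangent s t) + c1 * coord 1 (tangent s t) = 0"
      using gradient_orthogonal(2)[OF F, of s t] expand[of "tangent s t"] w
      by (simp add: normal_space_def)
    then show ?thesis using assms r_pos by (simp add: coord_tangent)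
  qed
  moreover have "c0 = 0"
  proof -
    have "c0 * coord 0 ?v + c1 * coord 1 ?v = 0"
      using gradient_orthogonal(1)[OF F, of s t] expand[of ?v] w by (simp add: normal_space_def)
    then show ?thesis using assms r_pos \<open>c1 = 0\<close> by (simp add: coord_cone_point)
  qed
  ultimately have "gradient n F ?v = w" using grad by (simp add: vscale_def fun_eq_iff)
  then show "w \<in> (\<lambda>f. gradient n f ?v) ` homogeneous_ideal n curve" using F by blast
qed

lemma dim_gradients:
  assumes "s \<noteq> 0"
  shows "vec.dim ((\<lambda>f. gradient n f (cone_point s t)) ` homogeneous_ideal n curve) = n - 1"
proof -
  have "(\<lambda>f. gradient n f (cone_point s t)) ` homogeneous_ideal n curve = normal_space s t"
    using normal_space_subset[OF assms] gradient_in_normal_space by blast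
  then show ?thesis using dim_normal_space[OF assms] by simp
qed

text \<open>Exchanging s and t carries the rank computation, valid for nonzero s, to the remaining
  point s = 0.\<close>

lemma reversed: "rational_normal_cone n r (\<lambda>j. A (r - j)) (\<lambda>i j. B i (r - j))"
proof
  show "(\<Sum>i\<le>n. A (r - j) i * B i (r - k)) = (if j = k then 1 else 0)" if "j \<le> r" "k \<le> r" for j k
    using that by (auto simp: left_inverse)
qed (use r_pos alg_closed in auto)

end

context rational_normal_cone
begin

interpretation rev: rational_normal_cone n r "\<lambda>j. A (r - j)" "\<lambda>i j. B i (r - j)"
  by (rule reversed)

lemma rev_cone_point: "rev.cone_point s t = cone_point t s"
proof
  fix i
  have "(\<Sum>j\<le>r. B i (r - j) * (s ^ (r - j) * t ^ j)) = (\<Sum>j\<le>r. B i j * (t ^ (r - j) * s ^ j))"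
    by (rule sum.reindex_bij_witness[of _ "\<lambda>j. r - j" "\<lambda>j. r - j"]) (auto simp: mult.commute)
  then show "rev.cone_point s t i = cone_point t s i"
    by (simp add: cone_point_def rev.cone_point_def)
qed

lemma rev_curve: "rev.curve = curve"
  unfolding rev.curve_def curve_def rev_cone_point by blast

lemma regular_curve_curve: "regular_curve n curve"
  unfolding regular_curve_def
proof (intro conjI ballI impI irreducible_curve_curve)
  fix l v assume l: "l \<in> curve" "v \<in> l" "v \<noteq> 0"
  obtain s t where v: "v = cone_point s t" using mem_curveE[OF l(1,2)] .
  show "vec.dim ((\<lambda>f. gradient n f v) ` homogeneous_ideal n curve) = n - 1"
  proof (cases "s = 0")
    case True
    then have "t \<noteq> 0" using l(3) v cone_point_eq_0_iff by auto
    then show ?thesis using rev.dim_gradients[of t s] unfolding rev_curve rev_cone_point v by simp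
  next
    case False
    then show ?thesis unfolding v by (rule dim_gradients)
  qed
qed


section \<open>The Hilbert function\<close>

text \<open>Surjectivity of the pullback on monomials: k is split greedily into m indices of size at
  most r, and the form is the product of the corresponding \<open>coord_form\<close>s.\<close>

lemma monomial_form_exists:
  "k \<le> m * r \<Longrightarrow> \<exists>e\<in>mpols (Suc n). homogeneous m e \<and>
     (\<forall>s t. mpol_eval e (cone_point s t) = s ^ (m * r - k) * t ^ k)"
proof (induction m arbitrary: k)
  case 0
  show ?case by (rule bexI[of _ 1]) (use 0 in auto)
next
  case (Suc m)
  define j where "j = min k r"
  have j: "j \<le> r" "j \<le> k" "k - j \<le> m * r" using Suc.prems by (auto simp: j_def)
  obtain e where e: "e \<in> mpols (Suc n)" "homogeneous m e"
    "\<And>s t. mpol_eval e (cone_point s t) = s ^ (m * r - (k - j)) * t ^ (k - j)"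
    using Suc.IH[OF j(3)] by blast
  have "mpol_eval (e * coord_form j) (cone_point s t) = s ^ (Suc m * r - k) * t ^ k" for s t
  proof -
    have "Suc m * r - k = (m * r - (k - j)) + (r - j)" "k = (k - j) + j" using j by auto
    then have "s ^ (Suc m * r - k) * t ^ k = (s ^ (m * r - (k - j)) * s ^ (r - j)) * (t ^ (k - j) * t ^ j)"
      by (metis power_add)
    then show ?thesis using j by (simp add: e coord_cone_point mult_ac)
  qed
  moreover have "homogeneous (Suc m) (e * coord_form j)"
    using homogeneous_mult[OF e(2) homogeneous_coord_form] by simp
  ultimately show ?case using e(1) by (blast intro: mult_in_mpols coord_form_in_mpols)
qed

text \<open>The classes of m r + 1 forms that restrict to the distinct monomials of degree m r are a
  basis of the degree m part. A combination in the ideal vanishes on the cone, hence is trivial; and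
  a form minus the combination with the same restriction vanishes on the cone, hence lies in the
  ideal.\<close>

lemma hilbert_function_curve: "hilbert_function n curve m = m * r + 1"
proof -
  define R where "R = (mpol_ring (Suc n) :: 'f mpol ring)"
  define I where "I = homogeneous_ideal n curve"
  define h where "h = coord_class n curve"
  define N where "N = Suc (m * r)"
  interpret R: cring R unfolding R_def by (rule cring_mpol_ring)
  interpret I: ideal I R unfolding R_def I_def by (rule ideal_homogeneous_ideal)
  interpret Q: ring "R Quot I" by (rule I.quotient_is_ring)
  have h: "h f = I +>\<^bsub>R\<^esub> f" for f by (simp add: h_def coord_class_def I_def R_def)
  interpret hom: ring_hom_ring R "R Quot I" h
    using I.rcos_ring_hom_ring by (simp add: h[abs_def])
  have carrier: "carrier R = mpols (Suc n)" by (simp add: R_def)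
  have R_ops: "\<And>x y. x \<otimes>\<^bsub>R\<^esub> y = x * y" "\<And>x y. x \<oplus>\<^bsub>R\<^esub> y = x + y" "\<zero>\<^bsub>R\<^esub> = 0"
    by (simp_all add: R_def)
  have zero_Q: "\<zero>\<^bsub>R Quot I\<^esub> = I" by (simp add: FactRing_def)
  have h_zero: "h f = \<zero>\<^bsub>R Quot I\<^esub> \<longleftrightarrow> f \<in> I" if "f \<in> mpols (Suc n)" for f
    using I.a_rcos_self[of f] I.a_rcos_const[of f] that unfolding h zero_Q carrier by auto
  have one: "\<one>\<^bsub>R Quot I\<^esub> \<noteq> \<zero>\<^bsub>R Quot I\<^esub>"
  proof
    assume "\<one>\<^bsub>R Quot I\<^esub> = \<zero>\<^bsub>R Quot I\<^esub>"
    then have "h 1 = \<zero>\<^bsub>R Quot I\<^esub>" using hom.hom_one by (simp add: R_def)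
    then have "1 \<in> I" using h_zero by simp
    then show False using homogeneous_ideal_cone_point[of 1 1 0] by (simp add: I_def)
  qed
  interpret F: field "ring_of_type_algebra :: 'f ring" by (rule field_from_type_algebra)
  have "mconst \<in> ring_hom (ring_of_type_algebra :: 'f ring) R"
    by (rule ring_hom_memI) (auto simp: R_def mult_single single_add)
  then interpret const: ring_hom_ring "ring_of_type_algebra :: 'f ring" R mconst
    by (intro ring_hom_ringI2 F.ring_axioms R.ring_axioms)
  \<comment> \<open>The classes of the constants are a subfield: they are the image of a field under
    a homomorphism into a nonzero ring.\<close>
  have "h \<circ> mconst \<in> ring_hom (ring_of_type_algebra :: 'f ring) (R Quot I)"
    using const.homh hom.homh by (rule ring_hom_trans)
  then interpret comp: ring_hom_ring "ring_of_type_algebra :: 'f ring" "R Quot I" "h \<circ> mconst"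
    by (intro ring_hom_ringI2 F.ring_axioms Q.ring_axioms)
  define K where "K = h ` range mconst"
  have K: "subfield K (R Quot I)"
    using comp.img_is_subfield(2)[OF F.carrier_is_subfield one] by (simp add: K_def image_comp)
  obtain e where e: "\<And>k. k < N \<Longrightarrow> e k \<in> mpols (Suc n)" "\<And>k. k < N \<Longrightarrow> homogeneous m (e k)"
    "\<And>k s t. k < N \<Longrightarrow> mpol_eval (e k) (cone_point s t) = s ^ (m * r - k) * t ^ k"
  proof -
    have "\<forall>k\<in>{..<N}. \<exists>e. e \<in> mpols (Suc n) \<and> homogeneous m e \<and>
        (\<forall>s t. mpol_eval e (cone_point s t) = s ^ (m * r - k) * t ^ k)"
      using monomial_form_exists unfolding N_def by (metis Bex_def lessThan_iff less_Suc_eq_le)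
    from bchoice[OF this] show thesis using that by auto
  qed
  define es where "es = map e [0..<N]"
  have es: "set es \<subseteq> mpols (Suc n)" using e(1) by (auto simp: es_def)
  \<comment> \<open>A coefficient list shorter than the basis is padded with zeros.\<close>
  have comb: "R.combine (map mconst cs) es = (\<Sum>k<N. mconst (if k < length cs then cs ! k else 0) * e k)"
    if "length cs \<le> N" for cs
  proof -
    have "R.combine (map mconst cs) us = (\<Sum>(c, u)\<leftarrow>zip cs us. mconst c * u)" for us
    proof (induction cs arbitrary: us)
      case (Cons c cs)
      then show ?case by (cases us) (auto simp: R_ops)
    qed (simp add: R_ops)
    also have "(\<Sum>(c, u)\<leftarrow>zip cs es. mconst c * u) = (\<Sum>k<length cs. mconst (cs ! k) * e k)"
      using that by (simp add: sum_list_sum_nth es_def atLeast0LessThan)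
    also have "\<dots> = (\<Sum>k<N. mconst (if k < length cs then cs ! k else 0) * e k)"
      using that by (intro sum.mono_neutral_cong_left) auto
    finally show ?thesis .
  qed
  have comb_in: "(\<Sum>k<N. mconst (c k) * e k) \<in> mpols (Suc n)" "homogeneous m (\<Sum>k<N. mconst (c k) * e k)"
    for c
    using e by (auto intro!: sum_in_mpols mult_in_mpols homogeneous_sum homogeneous_scale)
  have comb_eval: "mpol_eval (\<Sum>k<N. mconst (c k) * e k) (cone_point s t) =
      (\<Sum>k\<le>m * r. c k * (s ^ (m * r - k) * t ^ k))" for c s t
    using e(3) by (simp add: N_def lessThan_Suc_atMost)
  have in_I: "f \<in> I" if "f \<in> mpols (Suc n)" "homogeneous m f" "\<And>s t. mpol_eval f (cone_point s t) = 0" for f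
    unfolding I_def using that by (rule form_in_homogeneous_ideal)
  have lift: "\<exists>cs. Ks = map h (map mconst cs)" if "set Ks \<subseteq> K" for Ks
    using that
  proof (induction Ks)
    case (Cons k Ks)
    then obtain c cs where "k = h (mconst c)" "Ks = map h (map mconst cs)" by (auto simp: K_def)
    then have "k # Ks = map h (map mconst (c # cs))" by simp
    then show ?case by (rule exI[of _ "c # cs"])
  qed simp
  have Q_comb: "Q.combine (map h (map mconst cs)) (map h es) = h (R.combine (map mconst cs) es)" for cs
    by (rule hom.combine_hom) (use es in \<open>auto simp: carrier\<close>)
  have carrier_Q: "set (map h es) \<subseteq> carrier (R Quot I)"
    using es hom.hom_closed by (auto simp: carrier)
  have "Q.independent K (map h es)"
  proof (rule Q.trivial_combine_imp_independent[OF K carrier_Q])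
    fix Ks assume Ks: "set Ks \<subseteq> K" "Q.combine Ks (map h es) = \<zero>\<^bsub>R Quot I\<^esub>"
    \<comment> \<open>The criterion admits coefficient lists of any length; \<open>combine\<close>
      ignores what lies beyond the first N entries.\<close>
    have "set (take N Ks) \<subseteq> K" using Ks(1) set_take_subset by fastforce
    then obtain cs where cs: "take N Ks = map h (map mconst cs)" using lift by blast
    then have len: "length cs \<le> N" by (metis length_map length_take min.cobounded2 min.commute)
    have "Q.combine (take N Ks) (map h es) = \<zero>\<^bsub>R Quot I\<^esub>"
      using Ks(2) Q.combine_take[of "map h es" Ks] by (simp add: es_def)
    then have "h (\<Sum>k<N. mconst (if k < length cs then cs ! k else 0) * e k) = \<zero>\<^bsub>R Quot I\<^esub>"
      unfolding cs Q_comb comb[OF len] .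
    then have "(\<Sum>k<N. mconst (if k < length cs then cs ! k else 0) * e k) \<in> homogeneous_ideal n curve"
      unfolding I_def[symmetric] by (rule iffD1[OF h_zero[OF comb_in(1)]])
    from homogeneous_ideal_cone_point[OF this, of 1]
    have "(\<Sum>k\<le>m * r. (if k < length cs then cs ! k else 0) * (1 ^ (m * r - k) * t ^ k)) = 0" for t
      unfolding comb_eval .
    then have sum: "(\<Sum>k\<le>m * r. (if k < length cs then cs ! k else 0) * t ^ k) = 0" for t by simp
    have z: "(if k < length cs then cs ! k else 0) = 0" if "k \<le> m * r" for k
      by (rule power_sum_zero_imp_coeffs_zero[where c = "\<lambda>k. if k < length cs then cs ! k else 0",
            OF infinite_UNIV_char_0 sum that])
    have "c = 0" if c: "c \<in> set cs" for c
    proof -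
      obtain k where "k < length cs" "c = cs ! k" using c by (auto simp: in_set_conv_nth)
      then show ?thesis using z[of k] len by (simp add: N_def)
    qed
    then show "set (take (length (map h es)) Ks) \<subseteq> {\<zero>\<^bsub>R Quot I\<^esub>}"
    proof -
      have "h (mconst c) = \<zero>\<^bsub>R Quot I\<^esub>" if "c \<in> set cs" for c
        using \<open>\<And>c. c \<in> set cs \<Longrightarrow> c = 0\<close>[OF that] h_zero[of 0] I.zero_closed by (simp add: R_ops)
      then have "set (take N Ks) \<subseteq> {\<zero>\<^bsub>R Quot I\<^esub>}" unfolding cs by auto
      then show ?thesis by (simp add: es_def)
    qed
  qed
  moreover have "Q.Span K (map h es) = h ` {f \<in> mpols (Suc n). homogeneous m f}"
  proof (rule antisym; rule subsetI)
    fix q assume "q \<in> Q.Span K (map h es)"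
    then obtain Ks where Ks: "set Ks \<subseteq> K" "length Ks = length (map h es)" "q = Q.combine Ks (map h es)"
      using Q.Span_mem_iff_length_version[OF K carrier_Q] by blast
    obtain cs where cs: "Ks = map h (map mconst cs)" using lift[OF Ks(1)] by blast
    then have "length cs \<le> N" using Ks(2) by (simp add: es_def)
    from comb[OF this] show "q \<in> h ` {f \<in> mpols (Suc n). homogeneous m f}"
      unfolding Ks(3) cs Q_comb using comb_in by simp
  next
    fix q assume "q \<in> h ` {f \<in> mpols (Suc n). homogeneous m f}"
    then obtain f where f: "f \<in> mpols (Suc n)" "homogeneous m f" "q = h f" by blast
    have "binary_form (m * r) (\<lambda>s t. mpol_eval f (cone_point s t))"
      using binary_form_cone_point f by (intro binary_form_mpol_eval) auto
    then obtain c where c: "\<And>s t. mpol_eval f (cone_point s t) = (\<Sum>k\<le>m * r. c k * (s ^ (m * r - k) * t ^ k))"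
      unfolding binary_form_def by blast
    define g where "g = (\<Sum>k<N. mconst (c k) * e k)"
    have g: "g \<in> mpols (Suc n)" "homogeneous m g" unfolding g_def by (rule comb_in)+
    have "f - g \<in> I"
      using f g c comb_eval[of c]
      by (intro in_I diff_in_mpols homogeneous_diff) (simp_all add: g_def)
    then have "h (f - g) = \<zero>\<^bsub>R Quot I\<^esub>" using h_zero f g by (simp add: diff_in_mpols)
    then have "h ((f - g) \<oplus>\<^bsub>R\<^esub> g) = h g"
      using f g by (subst hom.hom_add) (auto simp: carrier diff_in_mpols)
    then have "q = h g" using f by (simp add: R_def)
    also have "g = R.combine (map mconst (map c [0..<N])) es"
      by (subst comb) (auto simp: g_def intro!: sum.cong)
    finally have "q = Q.combine (map h (map mconst (map c [0..<N]))) (map h es)"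
      by (simp only: Q_comb)
    moreover have "set (map h (map mconst (map c [0..<N]))) \<subseteq> K" by (auto simp: K_def)
    ultimately show "q \<in> Q.Span K (map h es)"
      using Q.Span_eq_combine_set[OF K carrier_Q] by blast
  qed
  ultimately have "Q.dimension N K (h ` {f \<in> mpols (Suc n). homogeneous m f})"
    using Q.dimension_independent[of K "map h es"] by (simp add: es_def)
  then have "Q.dim K (h ` {f \<in> mpols (Suc n). homogeneous m f}) = N"
    using Q.dimI[OF K] by (simp add: over_def)
  then show ?thesis
    unfolding hilbert_function_def coord_ring_def K_def h_def I_def R_def N_def by simp
qed

text \<open>Uniqueness in the description: two polynomials that agree at all large integers differ
  by a polynomial with infinitely many roots.\<close>

lemma hilbert_polynomial_curve: "hilbert_polynomial n curve = [:1, of_nat r:]"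
  unfolding hilbert_polynomial_def
proof (rule the_equality)
  show "\<exists>m0. \<forall>m\<ge>m0. of_nat (hilbert_function n curve m) = poly [:1, of_nat r:] (of_nat m)"
    by (simp add: hilbert_function_curve mult.commute)
next
  fix P :: "rat poly"
  assume "\<exists>m0. \<forall>m\<ge>m0. of_nat (hilbert_function n curve m) = poly P (of_nat m)"
  then obtain m0 where m0: "\<And>m. m \<ge> m0 \<Longrightarrow> of_nat (hilbert_function n curve m) = poly P (of_nat m)"
    by blast
  have "P - [:1, of_nat r:] = 0"
  proof (rule ccontr)
    assume "P - [:1, of_nat r:] \<noteq> 0"
    then have "finite {x. poly (P - [:1, of_nat r:]) x = 0}" by (rule poly_roots_finite)
    moreover have "(of_nat :: nat \<Rightarrow> rat) ` {m0..} \<subseteq> {x. poly (P - [:1, of_nat r:]) x = 0}"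
      using m0 by (auto simp: hilbert_function_curve mult.commute)
    ultimately have "finite ((of_nat :: nat \<Rightarrow> rat) ` {m0..})" using finite_subset by blast
    then show False using finite_imageD[of "of_nat :: nat \<Rightarrow> rat" "{m0..}"] infinite_Ici[of m0]
      by (simp add: inj_on_def)
  qed
  then show "P = [:1, of_nat r:]" by simp
qed

end

section \<open>The affine curve\<close>

lemma dehomogenize:
  assumes "f \<in> mpols (Suc n)"
  shows "\<exists>g\<in>mpols n. \<forall>x. mpol_eval g x = mpol_eval f (case_nat 1 x)"
  using assms
proof (induction f rule: mpols_induct)
  case (const c)
  show ?case by (rule bexI[of _ "mconst c"]) simp_all
next
  case (var i)
  show ?case
  proof (cases i)
    case 0
    then show ?thesis by (intro bexI[of _ 1]) simp_all
  next
    case (Suc j)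
    then show ?thesis using var by (intro bexI[of _ "mvar j"] mvar_in_mpols) simp_all
  qed
next
  case (add p q)
  then obtain g h where "g \<in> mpols n" "h \<in> mpols n"
    "\<And>x. mpol_eval g x = mpol_eval p (case_nat 1 x)" "\<And>x. mpol_eval h x = mpol_eval q (case_nat 1 x)"
    by blast
  then show ?case by (intro bexI[of _ "g + h"] add_in_mpols) simp_all
next
  case (mult p q)
  then obtain g h where "g \<in> mpols n" "h \<in> mpols n"
    "\<And>x. mpol_eval g x = mpol_eval p (case_nat 1 x)" "\<And>x. mpol_eval h x = mpol_eval q (case_nat 1 x)"
    by blast
  then show ?case by (intro bexI[of _ "g * h"] mult_in_mpols) simp_all
qed

text \<open>Vanishing of a polynomial along a rational parametrization becomes the vanishing of one
  univariate polynomial wherever the denominator is nonzero.\<close>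

lemma clear_denominators:
  fixes q :: "'f::field poly"
  assumes "f \<in> mpols n" and x: "\<And>i t. i < n \<Longrightarrow> poly q t \<noteq> 0 \<Longrightarrow> x t i = poly (p i) t / poly q t"
  shows "\<exists>g k. \<forall>t. poly q t \<noteq> 0 \<longrightarrow> mpol_eval f (x t) * poly q t ^ k = poly g t"
  using assms(1)
proof (induction f rule: mpols_induct)
  case (const c)
  show ?case by (intro exI[of _ "[:c:]"] exI[of _ 0]) simp
next
  case (var i)
  then show ?case by (intro exI[of _ "p i"] exI[of _ 1]) (simp add: x)
next
  case (add f1 f2)
  then obtain g k h l where
    gh: "\<And>t. poly q t \<noteq> 0 \<Longrightarrow> mpol_eval f1 (x t) * poly q t ^ k = poly g t"
    "\<And>t. poly q t \<noteq> 0 \<Longrightarrow> mpol_eval f2 (x t) * poly q t ^ l = poly h t"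
    by blast
  have "mpol_eval (f1 + f2) (x t) * poly q t ^ (k + l) =
      (mpol_eval f1 (x t) * poly q t ^ k) * poly q t ^ l + (mpol_eval f2 (x t) * poly q t ^ l) * poly q t ^ k" for t
    by (simp add: power_add algebra_simps)
  then have "poly q t \<noteq> 0 \<longrightarrow>
      mpol_eval (f1 + f2) (x t) * poly q t ^ (k + l) = poly (g * q ^ l + h * q ^ k) t" for t
    using gh by simp
  then show ?case by blast
next
  case (mult f1 f2)
  then obtain g k h l where
    gh: "\<And>t. poly q t \<noteq> 0 \<Longrightarrow> mpol_eval f1 (x t) * poly q t ^ k = poly g t"
    "\<And>t. poly q t \<noteq> 0 \<Longrightarrow> mpol_eval f2 (x t) * poly q t ^ l = poly h t"
    by blast
  have eq: "mpol_eval (f1 * f2) (x t) * poly q t ^ (k + l) =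
      (mpol_eval f1 (x t) * poly q t ^ k) * (mpol_eval f2 (x t) * poly q t ^ l)" for t
    by (simp add: power_add mult_ac)
  have "poly q t \<noteq> 0 \<longrightarrow> mpol_eval (f1 * f2) (x t) * poly q t ^ (k + l) = poly (g * h) t" for t
    unfolding eq by (simp add: gh)
  then show ?case by blast
qed

text \<open>The rows of \<open>A\<close> hold interpolation weights that recover one coefficient of
  a polynomial from its values at m + 1 distinct parameters. Existence is again an instance of
  \<open>left_inverse_exists\<close>, now over the whole field.\<close>

lemma vandermonde_left_inverse:
  fixes \<tau> :: "nat \<Rightarrow> 'f::field"
  assumes "inj \<tau>"
  shows "\<exists>A. \<forall>j\<le>m. \<forall>l\<le>m. (\<Sum>k\<le>m. A j k * \<tau> k ^ l) = (if j = l then 1 else 0)"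
proof -
  interpret sub_field "UNIV :: 'f set" by (rule sub_field_UNIV)
  have "\<exists>A. (\<forall>j<Suc m. \<forall>i<Suc m. A j i \<in> UNIV) \<and>
    (\<forall>j<Suc m. \<forall>l<Suc m. (\<Sum>k<Suc m. A j k * \<tau> k ^ l) = (if j = l then 1 else 0))"
  proof (rule left_inverse_exists)
    fix c assume c: "\<And>k. k < Suc m \<Longrightarrow> (\<Sum>j<Suc m. \<tau> k ^ j * c j) = 0"
    let ?p = "\<Sum>j\<le>m. monom (c j) j"
    have root: "poly ?p (\<tau> k) = 0" if "k < Suc m" for k
      using c[OF that] unfolding poly_coeff_sum(1) lessThan_Suc_atMost by (simp add: mult.commute)
    have "?p = 0"
    proof (rule ccontr)
      assume nz: "?p \<noteq> 0"
      then have "card {x. poly ?p x = 0} \<le> degree ?p" by (rule card_poly_roots_bound)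
      also have "\<dots> \<le> m" by (rule degree_le) (simp add: coeff_sum)
      finally have "card {x. poly ?p x = 0} \<le> m" .
      moreover have "card (\<tau> ` {..<Suc m}) \<le> card {x. poly ?p x = 0}"
        using root nz by (intro card_mono poly_roots_finite) auto
      moreover have "card (\<tau> ` {..<Suc m}) = Suc m"
        using assms by (subst card_image) (auto intro: inj_on_subset)
      ultimately show False by simp
    qed
    then show "\<forall>j<Suc m. c j = 0" using poly_coeff_sum(2)[of _ m c] by (simp add: less_Suc_eq_le)
  qed simp
  then show ?thesis by (auto simp: less_Suc_eq_le lessThan_Suc_atMost)
qed

text \<open>By interpolation the coefficient vectors of a polynomial curve are linear combinations
  of its points, so a subspace that contains enough points contains them.\<close>

lemma subspace_poly_coeffs:
  fixes v :: "nat \<Rightarrow> nat \<Rightarrow> 'f::field"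
  assumes W: "vec.subspace W" and T: "infinite T" "\<And>t. t \<in> T \<Longrightarrow> (\<lambda>i. \<Sum>j\<le>m. t ^ j * v j i) \<in> W"
    and j: "j \<le> m"
  shows "v j \<in> W"
proof -
  obtain \<tau> :: "nat \<Rightarrow> 'f" where \<tau>: "inj \<tau>" "range \<tau> \<subseteq> T"
    using infinite_countable_subset[OF T(1)] by blast
  obtain A where A: "\<And>j l. j \<le> m \<Longrightarrow> l \<le> m \<Longrightarrow> (\<Sum>k\<le>m. A j k * \<tau> k ^ l) = (if j = l then 1 else 0)"
    using vandermonde_left_inverse[OF \<tau>(1)] by blast
  have "v j = (\<Sum>k\<le>m. vscale (A j k) (\<lambda>i. \<Sum>l\<le>m. \<tau> k ^ l * v l i))"
  proof
    fix i
    have "(\<Sum>k\<le>m. vscale (A j k) (\<lambda>i. \<Sum>l\<le>m. \<tau> k ^ l * v l i)) i =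
      (\<Sum>k\<le>m. \<Sum>l\<le>m. A j k * \<tau> k ^ l * v l i)"
      by (simp add: sum_fun_apply vscale_def sum_distrib_left mult_ac)
    also have "\<dots> = (\<Sum>l\<le>m. (\<Sum>k\<le>m. A j k * \<tau> k ^ l) * v l i)"
      by (subst sum.swap) (simp add: sum_distrib_right)
    also have "\<dots> = (\<Sum>l\<le>m. if l = j then v l i else 0)"
      using j by (intro sum.cong) (auto simp: A)
    finally show "v j i = (\<Sum>k\<le>m. vscale (A j k) (\<lambda>i. \<Sum>l\<le>m. \<tau> k ^ l * v l i)) i"
      using j by simp
  qed
  also have "\<dots> \<in> W"
    using \<tau>(2) by (intro vec.subspace_sum[OF W] vec.subspace_scale[OF W] T(2)) auto
  finally show ?thesis .
qed

lemma affine_alg_set_hull: "S \<subseteq> affine_space n \<Longrightarrow> affine_alg_set n (affine_alg_set n hull S)"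
  unfolding hull_def by (rule affine_alg_set_Inter) (use affine_alg_set_affine_space in auto)

lemma sum_atMost_last: "(\<Sum>j\<le>(r::nat). f j) = (\<Sum>j<r. f j) + (f r :: 'a::comm_monoid_add)"
  by (simp add: lessThan_Suc_atMost[symmetric])

text \<open>The normalization \<open>lead\<close> makes the common denominator monic of degree r, so
  the point with s = 0 has coordinate 0 equal to 1 and lies in the affine chart.\<close>

locale affine_chart = rational_normal_cone +
  assumes lead: "B 0 r = 1"
begin

definition denom :: "'a poly" where
  "denom = (\<Sum>j\<le>r. monom (B 0 j) j)"

definition point :: "'a \<Rightarrow> nat \<Rightarrow> 'a" where
  "point t i = (if i < n then cone_point 1 t (Suc i) / cone_point 1 t 0 else 0)"

definition param_points :: "(nat \<Rightarrow> 'a) set" where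
  "param_points = {point t | t. poly denom t \<noteq> 0}"

definition affine_curve :: "(nat \<Rightarrow> 'a) set" where
  "affine_curve = affine_alg_set n hull param_points"

text \<open>The point with parameter (0, 1), read in the affine chart.\<close>

definition point_at_infinity :: "nat \<Rightarrow> 'a" where
  "point_at_infinity i = (if i < n then B (Suc i) r else 0)"

lemma poly_denom: "poly denom t = cone_point 1 t 0"
  by (simp add: denom_def cone_point_def poly_sum poly_monom)

lemma denom_nonzero: "denom \<noteq> 0"
proof
  assume "denom = 0"
  then have "coeff denom r = 0" by simp
  then show False by (simp add: denom_def coeff_sum lead)
qed

lemma infinite_denom_nonzero: "infinite {t. poly denom t \<noteq> 0}"
proof
  assume "finite {t. poly denom t \<noteq> 0}"
  then have "finite ({t. poly denom t \<noteq> 0} \<union> {t. poly denom t = 0})"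
    using poly_roots_finite[OF denom_nonzero] by blast
  moreover have "{t. poly denom t \<noteq> 0} \<union> {t. poly denom t = 0} = UNIV" by auto
  ultimately show False using infinite_UNIV_char_0[where 'a = 'a] by simp
qed

lemma case_nat_in_affine_space: "x \<in> affine_space n \<Longrightarrow> case_nat 1 x \<in> affine_space (Suc n)"
  by (auto simp: affine_space_def split: nat.split)

lemma case_nat_nonzero: "case_nat 1 x \<noteq> (0 :: nat \<Rightarrow> 'a)"
  by (metis nat.case(1) zero_fun_apply zero_neq_one)

lemma case_nat_point:
  assumes "poly denom t \<noteq> 0"
  shows "case_nat 1 (point t) = vscale (1 / cone_point 1 t 0) (cone_point 1 t)"
  using assms
  by (auto simp: fun_eq_iff vscale_def point_def poly_denom cone_point_def split: nat.split)

lemma point_in_affine_space: "point t \<in> affine_space n"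
  by (simp add: affine_space_def point_def)

text \<open>An explicit closed upper bound for the affine curve. It exceeds the parametrized points
  by at most \<open>point_at_infinity\<close>, which is precise enough for all later claims.\<close>

definition affine_cone_points :: "(nat \<Rightarrow> 'a) set" where
  "affine_cone_points = {x \<in> affine_space n. \<exists>s t. case_nat 1 x = cone_point s t}"

text \<open>The dehomogenized equations of the projective curve are among the polynomials that
  vanish on the set, and they already cut it out.\<close>

lemma affine_alg_set_affine_cone_points: "affine_alg_set n affine_cone_points"
proof -
  define P where "P = {g \<in> mpols n. \<forall>x\<in>affine_cone_points. mpol_eval g x = 0}"
  have "x \<in> affine_cone_points" if x: "x \<in> affine_space n" "\<forall>g\<in>P. mpol_eval g x = 0" for x
  proof -
    have "mpol_eval f (case_nat 1 x) = 0" if f: "f \<in> curve_eqs" for f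
    proof -
      obtain g where g: "g \<in> mpols n" "\<And>x. mpol_eval g x = mpol_eval f (case_nat 1 x)"
        using dehomogenize curve_eqs_props(1) f by blast
      have "mpol_eval f (case_nat 1 y) = 0" if "y \<in> affine_cone_points" for y
        using that f zeros_curve_eqs[OF case_nat_in_affine_space[of y]]
        unfolding affine_cone_points_def by blast
      then have "g \<in> P" using g by (simp add: P_def)
      then have "mpol_eval g x = 0" using x(2) by blast
      then show ?thesis unfolding g(2) .
    qed
    then show ?thesis
      using x(1) zeros_curve_eqs[OF case_nat_in_affine_space[OF x(1)]]
      by (simp add: affine_cone_points_def)
  qed
  then have "affine_cone_points = {x \<in> affine_space n. \<forall>g\<in>P. mpol_eval g x = 0}"
    by (auto simp: P_def affine_cone_points_def)
  then show ?thesis unfolding affine_alg_set_def by (intro exI[of _ P]) (auto simp: P_def)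
qed

lemma param_points_subset: "param_points \<subseteq> affine_cone_points"
  using case_nat_point vscale_cone_point
  by (fastforce simp: param_points_def affine_cone_points_def point_in_affine_space)

lemma affine_curve_subset: "affine_curve \<subseteq> affine_cone_points"
  unfolding affine_curve_def
  by (rule hull_minimal[of param_points affine_cone_points "affine_alg_set n",
        OF param_points_subset affine_alg_set_affine_cone_points])

lemma param_points_subset_affine_curve: "param_points \<subseteq> affine_curve"
  unfolding affine_curve_def by (rule hull_subset)

lemma affine_alg_set_affine_curve: "affine_alg_set n affine_curve"
  unfolding affine_curve_def
  by (rule affine_alg_set_hull) (auto simp: param_points_def point_in_affine_space)

lemma affine_cone_points_cases:
  assumes "x \<in> affine_cone_points"
  shows "x = point_at_infinity \<or> (\<exists>t. poly denom t \<noteq> 0 \<and> x = point t)"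
proof -
  obtain s t where x: "x \<in> affine_space n" "case_nat 1 x = cone_point s t"
    using assms by (auto simp: affine_cone_points_def)
  have x0: "cone_point s t 0 = 1" and xS: "x i = cone_point s t (Suc i)" for i
    using fun_cong[OF x(2), of 0] fun_cong[OF x(2), of "Suc i"] by auto
  show ?thesis
  proof (cases "s = 0")
    case True
    have inf: "cone_point 0 t i = (if i \<le> n then B i r * t ^ r else 0)" for i
    proof -
      have "(\<Sum>j\<le>r. B i j * (0 ^ (r - j) * t ^ j)) = (\<Sum>j\<le>r. if j = r then B i j * t ^ j else 0)"
        by (intro sum.cong) auto
      then show ?thesis by (simp add: cone_point_def)
    qed
    \<comment> \<open>Coordinate 0 equals 1 on both sides, which fixes the scale.\<close>
    then have "t ^ r = 1" using x0 True lead by simp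
    then have "x = point_at_infinity"
      using xS inf True by (auto simp: point_at_infinity_def)
    then show ?thesis ..
  next
    case False
    then have c: "cone_point s t i = s ^ r * cone_point 1 (t / s) i" for i
      using cone_point_scale[of s 1 "t / s"] by (simp add: vscale_def)
    have c0: "cone_point 1 (t / s) 0 \<noteq> 0" using x0 c[of 0] by auto
    then have sr: "s ^ r = 1 / cone_point 1 (t / s) 0" using x0 c[of 0] by (simp add: field_simps)
    have "x = point (t / s)"
    proof
      fix i show "x i = point (t / s) i"
        using x(1) xS[of i] c[of "Suc i"] sr by (auto simp: point_def affine_space_def)
    qed
    then show ?thesis using c0 by (auto simp: poly_denom)
  qed
qed

text \<open>By minimality of the hull, \<open>T\<close> misses a parametrized point, so one of its
  equations is nonzero there. Cleared of denominators, this equation is a nonzero polynomial whose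
  roots account for all of \<open>T\<close> except possibly the point at infinity.\<close>

lemma finite_closed_subset_of_affine_curve:
  assumes "affine_alg_set n T" "T \<subset> affine_curve"
  shows "finite T"
proof -
  have "\<not> param_points \<subseteq> T"
    using assms hull_minimal[of param_points T "affine_alg_set n"] unfolding affine_curve_def by blast
  then obtain t0 where t0: "poly denom t0 \<noteq> 0" "point t0 \<notin> T" by (auto simp: param_points_def)
  obtain P where P: "P \<subseteq> mpols n" "T = {x \<in> affine_space n. \<forall>f\<in>P. mpol_eval f x = 0}"
    using assms(1) unfolding affine_alg_set_def by blast
  then obtain f where f: "f \<in> P" "mpol_eval f (point t0) \<noteq> 0"
    using t0(2) point_in_affine_space[of t0] by blast
  define p where "p i = (\<Sum>j\<le>r. monom (B (Suc i) j) j)" for i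
  have "point t i = poly (p i) t / poly denom t" if "i < n" for i t
    unfolding point_def poly_denom using that
    by (simp add: p_def cone_point_def poly_sum poly_monom)
  then obtain g k where g: "\<And>t. poly denom t \<noteq> 0 \<Longrightarrow> mpol_eval f (point t) * poly denom t ^ k = poly g t"
    using clear_denominators[of f n denom point p] f(1) P(1) by blast
  have "g \<noteq> 0" using g[OF t0(1)] f(2) t0(1) by auto
  have "T \<subseteq> insert point_at_infinity (point ` {t. poly g t = 0})"
  proof
    fix x assume x: "x \<in> T"
    then have "x \<in> affine_cone_points" using assms(2) affine_curve_subset by blast
    then consider "x = point_at_infinity" | t where "poly denom t \<noteq> 0" "x = point t"
      using affine_cone_points_cases by blast
    then show "x \<in> insert point_at_infinity (point ` {t. poly g t = 0})"
    proof cases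
      case 2
      have "mpol_eval f x = 0" using x f(1) P(2) by blast
      then have "poly g t = 0" using g[OF 2(1)] 2(2) by simp
      then show ?thesis using 2(2) by blast
    qed simp
  qed
  then show ?thesis using poly_roots_finite[OF \<open>g \<noteq> 0\<close>] finite_subset by blast
qed

lemma span_case_nat_point:
  "poly denom t \<noteq> 0 \<Longrightarrow> vec.span {case_nat 1 (point t)} = vec.span {cone_point 1 t}"
  by (simp add: case_nat_point span_vscale poly_denom)

lemma irreducible_curve_affine_curve: "irreducible_curve (affine_alg_set n) affine_curve"
proof (rule irreducible_curveI)
  have "inj_on point {t. poly denom t \<noteq> 0}"
  proof (rule inj_onI)
    fix t t' assume t: "t \<in> {t. poly denom t \<noteq> 0}" "t' \<in> {t. poly denom t \<noteq> 0}" "point t = point t'"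
    then have "vec.span {cone_point 1 t} = vec.span {cone_point 1 t'}"
      using span_case_nat_point[of t] span_case_nat_point[of t'] by simp
    then show "t = t'" by (rule injD[OF inj_curve_param])
  qed
  then have "infinite (point ` {t. poly denom t \<noteq> 0})"
    using infinite_denom_nonzero finite_imageD by blast
  moreover have "point ` {t. poly denom t \<noteq> 0} \<subseteq> affine_curve"
    using param_points_subset_affine_curve by (auto simp: param_points_def)
  ultimately show "infinite affine_curve" using finite_subset by blast
  show "affine_alg_set n {x}" if "x \<in> affine_curve" for x
    using that affine_curve_subset by (intro affine_alg_set_point) (auto simp: affine_cone_points_def)
qed (use affine_alg_set_affine_curve affine_alg_set_Un finite_closed_subset_of_affine_curve in auto)

text \<open>A form that vanishes on the affine curve vanishes at infinitely many parameters, hence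
  on the whole cone; this recovers the points at which the denominator is zero.\<close>

lemma proj_closure_affine_curve: "proj_closure n affine_curve = curve"
  unfolding proj_closure_def
proof (rule hull_unique)
  show "proj_embed ` affine_curve \<subseteq> curve"
  proof
    fix l assume "l \<in> proj_embed ` affine_curve"
    then obtain x where x: "l = vec.span {case_nat 1 x}" "x \<in> affine_cone_points"
      using affine_curve_subset by (auto simp: proj_embed_def)
    obtain s t where st: "case_nat 1 x = cone_point s t"
      using x(2) by (auto simp: affine_cone_points_def)
    then have "cone_point s t \<noteq> 0" using case_nat_nonzero[of x] by simp
    then have "s \<noteq> 0 \<or> t \<noteq> 0" using cone_point_eq_0_iff by blast
    then show "l \<in> curve" unfolding x(1) st by (rule span_cone_point_in_curve)
  qed
  show "proj_alg_set n curve" by (rule proj_alg_set_curve)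
  fix T assume T: "proj_embed ` affine_curve \<subseteq> T" "proj_alg_set n T"
  obtain P where P: "P \<subseteq> mpols (Suc n)" "\<forall>f\<in>P. \<exists>k. homogeneous k f"
    "T = {l \<in> proj_space n. \<forall>f\<in>P. \<forall>v\<in>l. mpol_eval f v = 0}"
    using T(2) unfolding proj_alg_set_def by auto
  have zero: "mpol_eval f (cone_point s t) = 0" if f: "f \<in> P" for f s t
  proof -
    obtain k where k: "homogeneous k f" using P(2) f by blast
    have "mpol_eval f (cone_point 1 t) = 0" if "t \<in> {t. poly denom t \<noteq> 0}" for t
    proof -
      have "point t \<in> affine_curve"
        using that param_points_subset_affine_curve by (auto simp: param_points_def)
      then have "vec.span {cone_point 1 t} \<in> T"
        using T(1) span_case_nat_point that by (auto simp: proj_embed_def)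
      then show ?thesis using f vec.span_base[of "cone_point 1 t"] unfolding P(3) by blast
    qed
    from form_vanishes_on_cone[OF _ k infinite_denom_nonzero this] show ?thesis using P(1) f by blast
  qed
  show "curve \<subseteq> T"
  proof
    fix l assume l: "l \<in> curve"
    have "mpol_eval f v = 0" if "f \<in> P" "v \<in> l" for f v
      using mem_curveE[OF l that(2)] zero[OF that(1)] by metis
    moreover have "l \<in> proj_space n"
      using l proj_alg_set_curve unfolding proj_alg_set_def by blast
    ultimately show "l \<in> T" unfolding P(3) by blast
  qed
qed

text \<open>Column j of \<open>B\<close> minus the multiple of column r that cancels coordinate 0.
  These vectors span the directions of the linear hull through
  \<open>point_at_infinity\<close>.\<close>

definition direction :: "nat \<Rightarrow> nat \<Rightarrow> 'a" where
  "direction j i = (if i < n then B (Suc i) j - B (Suc i) r * B 0 j else 0)"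

lemma independent_directions:
  "inj_on direction {..<r}" "vec.independent (direction ` {..<r})"
proof -
  have "\<forall>j<r. c j = 0" if c: "\<And>i. (\<Sum>j<r. c j * direction j i) = 0" for c
  proof (intro allI impI)
    fix j assume j: "j < r"
    \<comment> \<open>A relation between directions lifts to one between all columns of
      \<open>B\<close>: the coefficient of the last column is determined by row 0. The left inverse
      then makes it trivial.\<close>
    define y where "y j = (if j < r then c j else - (\<Sum>j<r. B 0 j * c j))" for j
    have "(\<Sum>k\<le>r. B i k * y k) = 0" if "i \<le> n" for i
    proof (cases i)
      case 0
      then show ?thesis by (simp add: sum_atMost_last y_def lead)
    next
      case (Suc i')
      have "(\<Sum>k\<le>r. B i k * y k) = (\<Sum>k<r. B i k * c k) - B i r * (\<Sum>k<r. B 0 k * c k)"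
        by (simp add: sum_atMost_last y_def)
      also have "\<dots> = (\<Sum>k<r. c k * direction k i')"
        using Suc that by (simp add: direction_def sum_distrib_left algebra_simps sum_subtractf)
      finally show ?thesis using c by simp
    qed
    then have "(\<Sum>i\<le>n. A j i * (\<Sum>k\<le>r. B i k * y k)) = 0" by simp
    then have "y j = 0" using coord_lincomb[of j y] j by simp
    then show "c j = 0" using j by (simp add: y_def)
  qed
  from independent_family[where w = direction, OF this]
  show "inj_on direction {..<r}" "vec.independent (direction ` {..<r})" by auto
qed

text \<open>In the chart, row 0 reads 1 = sum of B_{0j} m_j over j < r, plus m_r. Eliminating m_r
  writes each point as \<open>point_at_infinity\<close> plus a combination of directions.\<close>

lemma linear_variety_contains: "\<exists>V. linear_variety n r V \<and> affine_curve \<subseteq> V"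
proof -
  let ?W = "vec.span (direction ` {..<r})"
  have dir: "direction ` {..<r} \<subseteq> affine_space n" by (auto simp: direction_def affine_space_def)
  have "linear_variety n r ((\<lambda>w. point_at_infinity + w) ` ?W)"
    unfolding linear_variety_def
  proof (intro bexI exI conjI)
    show "?W \<subseteq> affine_space n" using dir subspace_affine_space by (rule vec.span_minimal)
    show "vec.dim ?W = r"
      using vec.dim_eq_card_independent[OF independent_directions(2)] card_image[OF independent_directions(1)]
      by (simp add: vec.dim_span)
  qed (auto simp: point_at_infinity_def affine_space_def)
  moreover have "affine_curve \<subseteq> (\<lambda>w. point_at_infinity + w) ` ?W"
  proof
    fix x assume "x \<in> affine_curve"
    then obtain s t where x: "x \<in> affine_space n" "case_nat 1 x = cone_point s t"
      using affine_curve_subset by (auto simp: affine_cone_points_def)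
    define m where "m j = s ^ (r - j) * t ^ j" for j
    have x0: "1 = (\<Sum>j<r. B 0 j * m j) + m r"
      using fun_cong[OF x(2), of 0] by (simp add: cone_point_def sum_atMost_last m_def lead)
    have xS: "x i = (\<Sum>j<r. B (Suc i) j * m j) + B (Suc i) r * m r" if "i < n" for i
      using fun_cong[OF x(2), of "Suc i"] that by (simp add: cone_point_def sum_atMost_last m_def)
    have "x = point_at_infinity + (\<Sum>j<r. vscale (m j) (direction j))"
    proof
      fix i
      show "x i = (point_at_infinity + (\<Sum>j<r. vscale (m j) (direction j))) i"
      proof (cases "i < n")
        case True
        have "(\<Sum>j<r. m j * direction j i) =
          (\<Sum>j<r. B (Suc i) j * m j) - B (Suc i) r * (\<Sum>j<r. B 0 j * m j)"
          using True by (simp add: direction_def sum_distrib_left algebra_simps sum_subtractf)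
        also have "(\<Sum>j<r. B 0 j * m j) = 1 - m r" using x0 by (simp add: algebra_simps)
        finally show ?thesis
          using True xS by (simp add: sum_fun_apply vscale_def point_at_infinity_def algebra_simps)
      next
        case False
        then show ?thesis
          using x(1) by (simp add: sum_fun_apply vscale_def point_at_infinity_def direction_def affine_space_def)
      qed
    qed
    moreover have "(\<Sum>j<r. vscale (m j) (direction j)) \<in> ?W"
      by (intro vec.span_sum vec.span_scale vec.span_base) auto
    ultimately show "x \<in> (\<lambda>w. point_at_infinity + w) ` ?W" by blast
  qed
  ultimately show ?thesis by blast
qed

text \<open>Differences of points, multiplied by the denominator, run along a polynomial curve in
  the direction space \<open>W\<close>. Its coefficient vectors therefore lie in \<open>W\<close>,
  and so do the r independent directions, which exceeds the dimension r - 1.\<close>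

lemma not_in_smaller_linear_variety: "\<not> (\<exists>V. linear_variety n (r - 1) V \<and> affine_curve \<subseteq> V)"
proof
  assume "\<exists>V. linear_variety n (r - 1) V \<and> affine_curve \<subseteq> V"
  then obtain p W where W: "W \<subseteq> affine_space n" "vec.subspace W" "vec.dim W = r - 1"
    and curve: "affine_curve \<subseteq> (\<lambda>w. p + w) ` W"
    unfolding linear_variety_def by blast
  obtain t0 where t0: "poly denom t0 \<noteq> 0"
    using infinite_denom_nonzero not_finite_existsD by blast
  have diff: "point t - point t0 \<in> W" if "poly denom t \<noteq> 0" for t
  proof -
    have "point t \<in> (\<lambda>w. p + w) ` W" "point t0 \<in> (\<lambda>w. p + w) ` W"
      using that t0 curve param_points_subset_affine_curve by (auto simp: param_points_def)
    then obtain w w0 where "point t = p + w" "w \<in> W" "point t0 = p + w0" "w0 \<in> W" by blast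
    then show ?thesis using vec.subspace_diff[OF W(2), of w w0] by simp
  qed
  define v where "v j i = (if i < n then B (Suc i) j - point t0 i * B 0 j else 0)" for j i
  have v: "v j \<in> W" if "j \<le> r" for j
  proof (rule subspace_poly_coeffs[OF W(2) infinite_denom_nonzero _ that])
    fix t assume "t \<in> {t. poly denom t \<noteq> 0}"
    then have t: "poly denom t \<noteq> 0" by simp
    have "(\<lambda>i. \<Sum>j\<le>r. t ^ j * v j i) = vscale (poly denom t) (point t - point t0)"
    proof
      fix i
      show "(\<Sum>j\<le>r. t ^ j * v j i) = vscale (poly denom t) (point t - point t0) i"
      proof (cases "i < n")
        case True
        have "(\<Sum>j\<le>r. t ^ j * v j i) =
            (\<Sum>j\<le>r. B (Suc i) j * t ^ j) - point t0 i * (\<Sum>j\<le>r. B 0 j * t ^ j)"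
          using True by (simp add: v_def sum_distrib_left algebra_simps sum_subtractf)
        also have "(\<Sum>j\<le>r. B (Suc i) j * t ^ j) = poly denom t * point t i"
          using True t by (simp add: point_def poly_denom) (simp add: cone_point_def)
        also have "(\<Sum>j\<le>r. B 0 j * t ^ j) = poly denom t"
          by (simp add: poly_denom cone_point_def)
        finally show ?thesis by (simp add: vscale_def algebra_simps)
      next
        case False
        then show ?thesis by (simp add: v_def vscale_def point_def)
      qed
    qed
    then show "(\<lambda>i. \<Sum>j\<le>r. t ^ j * v j i) \<in> W"
      using vec.subspace_scale[OF W(2) diff[OF t]] by simp
  qed
  have "direction j \<in> W" if "j < r" for j
  proof -
    \<comment> \<open>Since \<open>B 0 r = 1\<close>, this combination cancels the contribution of
      the reference point \<open>point t0\<close>.\<close>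
    have "direction j = v j - vscale (B 0 j) (v r)"
      by (auto simp: direction_def v_def vscale_def lead algebra_simps)
    then show ?thesis
      using v that by (auto intro!: vec.subspace_diff[OF W(2)] vec.subspace_scale[OF W(2)])
  qed
  then have dir: "direction ` {..<r} \<subseteq> W" by blast
  obtain E where E: "E \<subseteq> W" "vec.independent E" "W \<subseteq> vec.span E" "card E = vec.dim W"
    using vec.basis_exists[of W] by blast
  have "finite E" using E(2) W(1) E(1) by (intro independent_in_affine_space) auto
  then have "card (direction ` {..<r}) \<le> card E"
    using vec.independent_span_bound[OF _ independent_directions(2)] dir E(3) by blast
  then show False using card_image[OF independent_directions(1)] E(4) W(3) r_pos by simp
qed

end

section \<open>Simple algebraic extensions\<close>

lemma nat_pow_ring_of_type_algebra [simp]: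
  "x [^]\<^bsub>ring_of_type_algebra\<^esub> (k::nat) = (x :: 'a::comm_ring_1) ^ k"
proof -
  interpret cring "ring_of_type_algebra :: 'a ring" by (rule cring_from_type_algebra)
  show ?thesis by (induction k) (simp_all add: mult.commute)
qed

text \<open>The coefficient lists of \<open>eval\<close> start with the leading coefficient, hence
  the reversal.\<close>

lemma eval_ring_of_type_algebra:
  "ring.eval ring_of_type_algebra cs (x :: 'f::field) = (\<Sum>i<length cs. rev cs ! i * x ^ i)"
proof -
  interpret field "ring_of_type_algebra :: 'f ring" by (rule field_from_type_algebra)
  show ?thesis
    by (induction cs) (auto simp: nth_append add.commute)
qed

locale base_field =
  fixes K :: "'f::field_char_0 set"
  assumes closure: "algebraic_closure (ring_of_type_algebra :: 'f ring) K"
begin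

sublocale alg: algebraic_closure "ring_of_type_algebra :: 'f ring" K
  by (rule closure)

lemma m_inv_eq_inverse: "x \<noteq> 0 \<Longrightarrow> inv\<^bsub>ring_of_type_algebra\<^esub> x = inverse (x :: 'f)"
  using alg.comm_inv_char[of x "inverse x"] by simp

sublocale K: sub_field K
proof
  show "0 \<in> K" "1 \<in> K"
    using subringE(2,3)[OF subfieldE(1)[OF alg.subfield_axioms]] by simp_all
  show "x + y \<in> K" "x * y \<in> K" if "x \<in> K" "y \<in> K" for x y
    using subringE(6,7)[OF subfieldE(1)[OF alg.subfield_axioms]] that by simp_all
  show "- x \<in> K" if "x \<in> K" for x
    using subringE(5)[OF subfieldE(1)[OF alg.subfield_axioms]] that by simp
  show "inverse x \<in> K" if "x \<in> K" for x
  proof (cases "x = 0")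
    case False
    then have "x \<in> K - {\<zero>\<^bsub>ring_of_type_algebra\<^esub>}" using that by simp
    then show ?thesis
      using alg.subfield_m_inv(1)[OF alg.subfield_axioms] m_inv_eq_inverse[OF False] by fastforce
  qed (use that in simp)
qed

lemma polynomial_has_root:
  assumes "0 < Polynomial.degree (p :: 'f poly)"
  shows "\<exists>x. poly p x = 0"
proof -
  define P where "P = rev (coeffs p)"
  have p0: "p \<noteq> 0" using assms by auto
  have deg: "Polynomials.degree P = Polynomial.degree p"
    by (auto simp: P_def degree_eq_length_coeffs)
  have "P \<in> carrier (poly_ring (ring_of_type_algebra :: 'f ring))"
    using p0 by (auto simp: univ_poly_def polynomial_def P_def hd_rev last_coeffs_eq_coeff_degree)
  then have "alg.splitted P" "P \<in> carrier (poly_ring (ring_of_type_algebra :: 'f ring))"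
    using alg.roots_over_carrier by auto
  then have "alg.roots P \<noteq> {#}" using deg assms unfolding alg.splitted_def by auto
  then obtain x where "x \<in># alg.roots P" by blast
  then have "alg.is_root P x"
    using alg.roots_mem_iff_is_root[OF \<open>P \<in> carrier (poly_ring _)\<close>] by auto
  then have "(\<Sum>i<length P. rev P ! i * x ^ i) = 0"
    by (simp add: alg.is_root_def eval_ring_of_type_algebra)
  moreover have "(\<Sum>i<length P. rev P ! i * x ^ i) = poly p x"
    using p0 by (simp add: P_def poly_altdef length_coeffs_degree lessThan_Suc_atMost coeffs_nth)
  ultimately show ?thesis by auto
qed

lemma adjoin_eq_simple_extension: "adjoin K x = alg.simple_extension K (x :: 'f)"
proof
  have alg: "(alg.algebraic over K) x" by (rule alg.algebraic_extension) simp
  have sub: "subfield (alg.simple_extension K x) ring_of_type_algebra"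
    using alg.simple_extension_is_subfield[OF alg.subfield_axioms] alg by simp
  have K_incl: "K \<subseteq> alg.simple_extension K x" and "x \<in> alg.simple_extension K x"
    using alg.simple_extension_incl[of K x] alg.simple_extension_mem[OF subfieldE(1)[OF alg.subfield_axioms], of x]
    by simp_all
  then show "adjoin K x \<subseteq> alg.simple_extension K x"
    using sub by (intro alg.generate_field_min_subfield1) auto
  show "alg.simple_extension K x \<subseteq> adjoin K x"
    using alg.generate_field_is_subfield[of "insert x K"]
    by (intro alg.simple_extension_subring_incl subfieldE(1)) (auto intro: generate_field.incl)
qed

lemma ext_degree_eq: "ext_degree K (adjoin K x) = Polynomials.degree (alg.Irr K (x :: 'f))"
  using alg.simple_extension_dim[OF alg.subfield_axioms, of x] alg.algebraic_extension[of x]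
  by (simp add: adjoin_eq_simple_extension over_def)

lemma combine_exp_base:
  "length cs = k \<Longrightarrow> alg.combine cs (alg.exp_base x k) = (\<Sum>i<k. rev cs ! i * (x :: 'f) ^ i)"
  using alg.combine_eq_eval[of cs x] by (simp add: eval_ring_of_type_algebra)

lemma adjoin_power_basis:
  assumes "y \<in> adjoin K x"
  shows "\<exists>c. (\<forall>i. c i \<in> K) \<and> y = (\<Sum>i<ext_degree K (adjoin K x). c i * x ^ i)"
proof -
  let ?k = "ext_degree K (adjoin K x)"
  have "alg.Span K (alg.exp_base x ?k) = adjoin K x"
    unfolding ext_degree_eq unfolding adjoin_eq_simple_extension
    by (rule alg.Span_exp_base[OF alg.subfield_axioms]) (simp_all add: alg.algebraic_extension)
  then have "y \<in> alg.Span K (alg.exp_base x ?k)" using assms by blast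
  then obtain cs where cs: "set cs \<subseteq> K" "length cs = length (alg.exp_base x ?k)" "y = alg.combine cs (alg.exp_base x ?k)"
    using alg.Span_mem_iff_length_version[OF alg.subfield_axioms alg.exp_base_closed[of x]] by auto
  then have len: "length cs = ?k" by (simp add: alg.exp_base_def)
  define c where "c i = (if i < ?k then rev cs ! i else 0)" for i
  have "c i \<in> K" for i
  proof (cases "i < ?k")
    case True
    then have "rev cs ! i \<in> set (rev cs)" using len by (intro nth_mem) simp
    then show ?thesis using True cs(1) by (auto simp: c_def)
  qed (simp add: c_def K.zero_mem)
  moreover have "y = (\<Sum>i<?k. c i * x ^ i)"
    using cs(3) combine_exp_base[OF len, of x] by (simp add: c_def)
  ultimately show ?thesis by blast
qed

lemma powers_independent:
  assumes "\<And>i. i < ext_degree K (adjoin K x) \<Longrightarrow> c i \<in> K"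
    and "(\<Sum>i<ext_degree K (adjoin K x). c i * x ^ i) = 0"
    and i: "i < ext_degree K (adjoin K x)"
  shows "c i = 0"
proof -
  let ?k = "ext_degree K (adjoin K x)"
  let ?cs = "rev (map c [0..<?k])"
  have ind: "alg.independent K (alg.exp_base x ?k)"
    using alg.exp_base_independent[OF alg.subfield_axioms, of x] alg.algebraic_extension[of x]
    by (simp add: ext_degree_eq)
  have "alg.combine ?cs (alg.exp_base x ?k) = (\<Sum>i<?k. c i * x ^ i)"
    by (subst combine_exp_base) simp_all
  then have "alg.combine ?cs (alg.exp_base x ?k) = \<zero>\<^bsub>ring_of_type_algebra\<^esub>" using assms(2) by simp
  moreover have "set ?cs \<subseteq> K" using assms(1) by auto
  ultimately have "set (take (length (alg.exp_base x ?k)) ?cs) \<subseteq> {\<zero>\<^bsub>ring_of_type_algebra\<^esub>}"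
    using alg.independent_imp_trivial_combine[OF alg.subfield_axioms ind] by blast
  then have "set ?cs \<subseteq> {0}" by (simp add: alg.exp_base_def)
  then show ?thesis using i by (auto simp: image_subset_iff)
qed

lemma adjoin_closed:
  "K \<subseteq> adjoin K x" "x \<in> adjoin K x"
  "y \<in> adjoin K x \<Longrightarrow> z \<in> adjoin K x \<Longrightarrow> y + z \<in> adjoin K x"
  "y \<in> adjoin K x \<Longrightarrow> z \<in> adjoin K x \<Longrightarrow> y * z \<in> adjoin K x"
  "y \<in> adjoin K x \<Longrightarrow> - y \<in> adjoin K x"
  using generate_field.eng_add[of y ring_of_type_algebra "insert x K" z]
    generate_field.eng_mult[of y ring_of_type_algebra "insert x K" z]
    generate_field.a_inv[of y ring_of_type_algebra "insert x K"]
  by (auto intro: generate_field.incl)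

lemma adjoin_power: "y \<in> adjoin K x \<Longrightarrow> y ^ k \<in> adjoin K (x :: 'f)"
  by (induction k) (use adjoin_closed(1)[of x] K.one_mem adjoin_closed(4) in auto)

lemma adjoin_sum: "(\<And>i. i \<in> S \<Longrightarrow> f i \<in> adjoin K x) \<Longrightarrow> sum f S \<in> adjoin K (x :: 'f)"
  by (induction S rule: infinite_finite_induct)
     (use adjoin_closed(1)[of x] K.zero_mem adjoin_closed(3) in auto)

lemma ext_degree_pos: "0 < ext_degree K (adjoin K x)"
proof (rule ccontr)
  assume "\<not> 0 < ext_degree K (adjoin K x)"
  then have "(1 :: 'f) = 0"
    using adjoin_power_basis[of 1 x] adjoin_closed(1)[of x] K.one_mem by auto
  then show False by simp
qed

section \<open>Coordinates over the base field\<close>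

definition poly_over :: "'f poly \<Rightarrow> bool" where
  "poly_over p \<longleftrightarrow> (\<forall>k. coeff p k \<in> K)"

lemma ratfuns_over_iff: "\<phi> \<in> ratfuns_over K \<longleftrightarrow> (\<exists>p q. \<phi> = Fract p q \<and> poly_over p \<and> poly_over q \<and> q \<noteq> 0)"
  unfolding ratfuns_over_def poly_over_def by blast

lemma poly_over_mult: "poly_over p \<Longrightarrow> poly_over q \<Longrightarrow> poly_over (p * q)"
  by (auto simp: poly_over_def coeff_mult intro!: K.sum_mem K.mult_mem)

lemma poly_over_diff: "poly_over p \<Longrightarrow> poly_over q \<Longrightarrow> poly_over (p - q)"
  by (auto simp: poly_over_def intro!: K.diff_mem)

lemma poly_over_one: "poly_over 1"
  by (auto simp: poly_over_def coeff_1 K.zero_mem K.one_mem)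

lemma poly_over_prod: "(\<And>i. i \<in> S \<Longrightarrow> poly_over (f i)) \<Longrightarrow> poly_over (prod f S)"
  by (induction S rule: infinite_finite_induct) (auto intro: poly_over_mult poly_over_one)

lemma ratfuns_over_diff:
  assumes "\<phi> \<in> ratfuns_over K" "\<psi> \<in> ratfuns_over K"
  shows "\<phi> - \<psi> \<in> ratfuns_over K"
proof -
  obtain p q p' q' where "\<phi> = Fract p q" "poly_over p" "poly_over q" "q \<noteq> 0"
    "\<psi> = Fract p' q'" "poly_over p'" "poly_over q'" "q' \<noteq> 0"
    using assms unfolding ratfuns_over_iff by blast
  then have "\<phi> - \<psi> = Fract (p * q' - p' * q) (q * q')" "poly_over (p * q' - p' * q)"
    "poly_over (q * q')" "q * q' \<noteq> 0"
    by (auto intro!: poly_over_mult poly_over_diff)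
  then show ?thesis unfolding ratfuns_over_iff by blast
qed

lemma sum_Fract:
  assumes "q \<noteq> 0"
  shows "(\<Sum>i\<in>S. Fract (f i) q) = Fract (sum f S) (q :: 'f poly)"
proof (induction S rule: infinite_finite_induct)
  case (insert x S)
  then show ?case using assms by (simp add: eq_fract distrib_right)
qed (simp_all add: Zero_fract_def eq_fract assms)

text \<open>Over a common denominator with coefficients in \<open>K\<close>, the relation holds for
  each power of t separately, where it is a relation between powers of \<alpha> over
  \<open>K\<close>.\<close>

lemma ratfuns_independent:
  assumes "\<And>i. i < ext_degree K (adjoin K \<alpha>) \<Longrightarrow> \<chi> i \<in> ratfuns_over K"
    and "(\<Sum>i<ext_degree K (adjoin K \<alpha>). \<chi> i * Fract [:\<alpha> ^ i:] 1) = 0"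
    and i: "i < ext_degree K (adjoin K \<alpha>)"
  shows "\<chi> i = 0"
proof -
  let ?n = "ext_degree K (adjoin K \<alpha>)"
  have "\<forall>i\<in>{..<?n}. \<exists>pq. \<chi> i = Fract (fst pq) (snd pq) \<and> poly_over (fst pq) \<and> poly_over (snd pq) \<and> snd pq \<noteq> 0"
    using assms(1) unfolding ratfuns_over_iff by fastforce
  from bchoice[OF this] obtain pq where
    pq: "\<And>i. i < ?n \<Longrightarrow> \<chi> i = Fract (fst (pq i)) (snd (pq i))"
    "\<And>i. i < ?n \<Longrightarrow> poly_over (fst (pq i))" "\<And>i. i < ?n \<Longrightarrow> poly_over (snd (pq i))"
    "\<And>i. i < ?n \<Longrightarrow> snd (pq i) \<noteq> 0"
    by auto
  define D where "D = (\<Prod>i<?n. snd (pq i))"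
  define E where "E i = fst (pq i) * (\<Prod>k\<in>{..<?n} - {i}. snd (pq k))" for i
  have D0: "D \<noteq> 0" using pq(4) by (simp add: D_def)
  have \<chi>: "\<chi> i = Fract (E i) D" if "i < ?n" for i
  proof -
    have "D = snd (pq i) * (\<Prod>k\<in>{..<?n} - {i}. snd (pq k))"
      unfolding D_def using that by (intro prod.remove) auto
    then show ?thesis using pq(1,4) that D0 by (simp add: eq_fract E_def mult_ac)
  qed
  have "(\<Sum>i<?n. \<chi> i * Fract [:\<alpha> ^ i:] 1) = (\<Sum>i<?n. Fract (E i * [:\<alpha> ^ i:]) D)"
    by (intro sum.cong) (auto simp: \<chi>)
  then have "Fract (\<Sum>i<?n. E i * [:\<alpha> ^ i:]) D = 0" using assms(2) sum_Fract[OF D0] by metis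
  then have zero: "(\<Sum>i<?n. E i * [:\<alpha> ^ i:]) = 0" using D0 by (simp add: Zero_fract_def eq_fract)
  have "coeff (E i) k = 0" for k
  proof (rule powers_independent[of \<alpha> "\<lambda>i. coeff (E i) k", OF _ _ i])
    have "coeff (\<Sum>i<?n. E i * [:\<alpha> ^ i:]) k = (\<Sum>i<?n. coeff (E i) k * \<alpha> ^ i)"
      by (simp add: coeff_sum mult.commute)
    then show "(\<Sum>i<?n. coeff (E i) k * \<alpha> ^ i) = 0" using zero by simp
    show "coeff (E j) k \<in> K" if "j < ?n" for j
    proof -
      have "poly_over (E j)"
        unfolding E_def using that by (intro poly_over_mult poly_over_prod pq) auto
      then show ?thesis by (simp add: poly_over_def)
    qed
  qed
  then have "E i = 0" by (simp add: poly_eq_iff)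
  then show ?thesis using \<chi>[OF i] D0 by (simp add: Zero_fract_def eq_fract)
qed

lemma hyper_coords_eq:
  fixes \<alpha> :: 'f
  defines "n \<equiv> ext_degree K (adjoin K \<alpha>)"
  assumes \<phi>: "\<And>i. i < n \<Longrightarrow> \<phi> i \<in> ratfuns_over K" "\<And>i. n \<le> i \<Longrightarrow> \<phi> i = 0"
    and u: "u = (\<Sum>i<n. \<phi> i * Fract [:\<alpha> ^ i:] 1)"
  shows "hyper_coords K \<alpha> u = \<phi>"
  unfolding hyper_coords_def Let_def n_def[symmetric]
proof (rule the_equality)
  show "(\<forall>i<n. \<phi> i \<in> ratfuns_over K) \<and> (\<forall>i\<ge>n. \<phi> i = 0) \<and> u = (\<Sum>i<n. \<phi> i * Fract [:\<alpha> ^ i:] 1)"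
    using \<phi> u by blast
  fix \<psi>
  assume \<psi>: "(\<forall>i<n. \<psi> i \<in> ratfuns_over K) \<and> (\<forall>i\<ge>n. \<psi> i = 0) \<and> u = (\<Sum>i<n. \<psi> i * Fract [:\<alpha> ^ i:] 1)"
  show "\<psi> = \<phi>"
  proof
    fix i
    show "\<psi> i = \<phi> i"
    proof (cases "i < n")
      case True
      have "(\<Sum>i<n. (\<psi> i - \<phi> i) * Fract [:\<alpha> ^ i:] 1) = 0"
        using \<psi> u by (simp add: left_diff_distrib sum_subtractf)
      then have "\<psi> i - \<phi> i = 0"
        using True \<phi> \<psi> unfolding n_def
        by (intro ratfuns_independent[where \<chi> = "\<lambda>i. \<psi> i - \<phi> i"] ratfuns_over_diff) auto
      then show ?thesis by simp
    next
      case False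
      then show ?thesis using \<phi> \<psi> by simp
    qed
  qed
qed

end

section \<open>The hypercircle of a unit\<close>

locale hypercircle_unit = base_field K for K :: "'f::field_char_0 set" +
  fixes \<alpha> a b d :: 'f
  assumes a: "a \<in> adjoin K \<alpha>" and b: "b \<in> adjoin K \<alpha>" and d: "d \<in> adjoin K \<alpha>"
    and unit: "a * d - b \<noteq> 0"
begin

definition n :: nat where "n = ext_degree K (adjoin K \<alpha>)"
definition r :: nat where "r = ext_degree K (adjoin K (- d))"

text \<open>A monic relation of degree [K(- d) : K] over \<open>K\<close> satisfied by - d gives the
  minimal polynomial. The value 0 beyond \<open>r\<close> lets sums with shifted indices run over a
  fixed range.\<close>

definition min_coeff :: "nat \<Rightarrow> 'f" where
  "min_coeff = (SOME m. (\<forall>k. m k \<in> K) \<and> m r = 1 \<and> (\<forall>k>r. m k = 0) \<and> (\<Sum>k\<le>r. m k * (- d) ^ k) = 0)"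

definition coords :: "'f \<Rightarrow> nat \<Rightarrow> 'f" where
  "coords y = (SOME c. (\<forall>i. c i \<in> K) \<and> y = (\<Sum>i<n. c i * \<alpha> ^ i))"

text \<open>
  The coefficient of \<open>t\<^sup>j\<close> in \<open>M(t) / (t + d)\<close>, where \<open>M\<close> is the minimal polynomial of \<open>- d\<close>.
\<close>

definition quot_coeff :: "nat \<Rightarrow> 'f" where
  "quot_coeff j = (\<Sum>l<r. min_coeff (j + l + 1) * (- d) ^ l)"

section \<open>The minimal polynomial of \<open>- d\<close> and its quotient by
  \<open>t + d\<close>\<close>

lemma min_coeff:
  "min_coeff k \<in> K" "min_coeff r = 1" "k > r \<Longrightarrow> min_coeff k = 0" "(\<Sum>k\<le>r. min_coeff k * (- d) ^ k) = 0"
proof -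
  obtain c where c: "\<And>i. c i \<in> K" "(- d) ^ r = (\<Sum>i<r. c i * (- d) ^ i)"
    using adjoin_power_basis[OF adjoin_power[OF adjoin_closed(2)], of "- d" r] unfolding r_def by blast
  let ?m = "\<lambda>k. if k < r then - c k else if k = r then 1 else 0"
  have "(\<Sum>k\<le>r. ?m k * (- d) ^ k) = (\<Sum>k<r. - c k * (- d) ^ k) + (- d) ^ r"
    by (simp add: lessThan_Suc_atMost[symmetric])
  also have "\<dots> = 0" using c(2) by (simp add: sum_negf)
  finally have "\<exists>m. (\<forall>k. m k \<in> K) \<and> m r = 1 \<and> (\<forall>k>r. m k = 0) \<and> (\<Sum>k\<le>r. m k * (- d) ^ k) = 0"
    using c(1) by (intro exI[of _ ?m]) (auto intro: K.uminus_mem K.zero_mem K.one_mem)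
  from someI_ex[OF this]
  show "min_coeff k \<in> K" "min_coeff r = 1" "k > r \<Longrightarrow> min_coeff k = 0"
    "(\<Sum>k\<le>r. min_coeff k * (- d) ^ k) = 0"
    unfolding min_coeff_def by blast+
qed

lemma coords:
  assumes "y \<in> adjoin K \<alpha>"
  shows "coords y i \<in> K" "y = (\<Sum>i<n. coords y i * \<alpha> ^ i)"
  using someI_ex[OF adjoin_power_basis[OF assms]] unfolding coords_def n_def by blast+

lemma r_pos: "0 < r"
  unfolding r_def by (rule ext_degree_pos)

lemma quot_coeff_in_adjoin: "quot_coeff j \<in> adjoin K \<alpha>"
  unfolding quot_coeff_def
  by (intro adjoin_sum adjoin_closed(4) adjoin_power adjoin_closed(5) d)
     (use min_coeff(1) adjoin_closed(1)[of \<alpha>] in blast)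

text \<open>One step of synthetic division by t + d.\<close>

lemma quot_coeff_rec: "quot_coeff j = min_coeff (Suc j) - d * quot_coeff (Suc j)"
proof -
  have "min_coeff (Suc j) - d * quot_coeff (Suc j) =
      min_coeff (Suc j) + (\<Sum>l<r. min_coeff (j + Suc l + 1) * (- d) ^ Suc l)"
    by (simp add: quot_coeff_def sum_distrib_left sum_negf mult_ac)
  \<comment> \<open>The shift produces an additional summand l = r, which is zero because its index
    exceeds r.\<close>
  also have "\<dots> = (\<Sum>l<Suc r. min_coeff (j + l + 1) * (- d) ^ l)"
    by (subst sum.lessThan_Suc_shift) simp
  also have "\<dots> = quot_coeff j"
    using min_coeff(3)[of "j + r + 1"] by (simp add: quot_coeff_def)
  finally show ?thesis ..
qed

text \<open>The last step of the division: the remainder is the value of the minimal polynomial at -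
  d, which is zero.\<close>

lemma quot_coeff_0: "d * quot_coeff 0 = min_coeff 0"
proof -
  have "(\<Sum>k\<le>r. min_coeff k * (- d) ^ k) = min_coeff 0 + (\<Sum>l<r. min_coeff (Suc l) * (- d) ^ Suc l)"
    unfolding lessThan_Suc_atMost[symmetric] by (subst sum.lessThan_Suc_shift) simp
  also have "(\<Sum>l<r. min_coeff (Suc l) * (- d) ^ Suc l) = - d * quot_coeff 0"
    by (simp add: quot_coeff_def sum_distrib_left mult_ac)
  finally show ?thesis using min_coeff(4) by (simp add: eq_neg_iff_add_eq_0)
qed

lemma quot_coeff_eq_0: "r \<le> j \<Longrightarrow> quot_coeff j = 0"
  by (simp add: quot_coeff_def min_coeff(3))

definition min_poly :: "'f poly" where
  "min_poly = (\<Sum>j\<le>r. monom (min_coeff j) j)"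

lemma coeff_min_poly: "coeff min_poly j = min_coeff j"
  using min_coeff(3) by (auto simp: min_poly_def coeff_sum)

lemma min_poly_factor: "[:d, 1:] * (\<Sum>j\<le>r. monom (quot_coeff j) j) = min_poly"
proof (rule poly_eqI)
  fix k
  let ?N = "\<Sum>j\<le>r. monom (quot_coeff j) j"
  have N: "coeff ?N j = quot_coeff j" for j
    using quot_coeff_eq_0 by (auto simp: coeff_sum)
  show "coeff ([:d, 1:] * ?N) k = coeff min_poly k"
  proof (cases k)
    case 0
    then show ?thesis using quot_coeff_0 by (simp add: N coeff_min_poly)
  next
    case (Suc j)
    then show ?thesis using quot_coeff_rec[of j] by (simp add: N coeff_min_poly)
  qed
qed

text \<open>The powers of - d are independent over \<open>K\<close>, and \<open>quot_coeff\<close>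
  arises from them by the Hankel matrix \<open>min_coeff (j + l + 1)\<close>, which has ones on the
  antidiagonal j + l + 1 = r and zeros beyond it.\<close>

lemma quot_coeff_independent:
  assumes c: "\<And>j. j < r \<Longrightarrow> c j \<in> K" and zero: "(\<Sum>j<r. c j * quot_coeff j) = 0"
  shows "\<forall>j<r. c j = 0"
proof (intro allI impI)
  have "(\<Sum>l<r. (\<Sum>j<r. c j * min_coeff (j + l + 1)) * (- d) ^ l) = 0"
  proof -
    have "(\<Sum>j<r. c j * quot_coeff j) = (\<Sum>j<r. \<Sum>l<r. c j * min_coeff (j + l + 1) * (- d) ^ l)"
      by (simp add: quot_coeff_def sum_distrib_left mult.assoc)
    also have "\<dots> = (\<Sum>l<r. (\<Sum>j<r. c j * min_coeff (j + l + 1)) * (- d) ^ l)"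
      by (subst sum.swap) (simp add: sum_distrib_right)
    finally show ?thesis using zero by simp
  qed
  then have rel: "(\<Sum>j<r. c j * min_coeff (j + l + 1)) = 0" if "l < r" for l
    using powers_independent[of "- d" "\<lambda>l. \<Sum>j<r. c j * min_coeff (j + l + 1)" l] that c min_coeff(1)
    unfolding r_def[symmetric] by (auto intro!: K.sum_mem K.mult_mem)
  fix j assume "j < r"
  then show "c j = 0"
  proof (induction j rule: less_induct)
    case (less j)
    \<comment> \<open>In this equation the terms with larger index than j have coefficient 0, those
      with smaller index vanish by induction, and \<open>c j\<close> has coefficient 1.\<close>
    define l where "l = r - 1 - j"
    have l: "l < r" "j + l + 1 = r" using less.prems by (auto simp: l_def)
    have "(\<Sum>i<r. c i * min_coeff (i + l + 1)) = (\<Sum>i<r. if i = j then c j else 0)"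
    proof (intro sum.cong refl)
      fix i assume "i \<in> {..<r}"
      consider "i < j" | "i = j" | "j < i" by linarith
      then show "c i * min_coeff (i + l + 1) = (if i = j then c j else 0)"
      proof cases
        case 1
        then show ?thesis using less by simp
      next
        case 2
        then show ?thesis using l(2) min_coeff(2) by simp
      next
        case 3
        then show ?thesis using min_coeff(3)[of "i + l + 1"] l(2) by simp
      qed
    qed
    then show ?case using rel[OF l(1)] less.prems by simp
  qed
qed

section \<open>The matrix of the parametrization and its left inverse\<close>

definition residue :: 'f where "residue = b - a * d"

text \<open>
  Row 0 consists of the coefficients of \<open>M\<close>, row \<open>i + 1\<close> of those of the numerator of \<open>\<phi>\<^sub>i\<close>, which
  is coordinate \<open>i\<close> of \<open>u = a + residue / (t + d)\<close> multiplied by \<open>M\<close>.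
\<close>

definition coeff_matrix :: "nat \<Rightarrow> nat \<Rightarrow> 'f" where
  "coeff_matrix i j = (case i of 0 \<Rightarrow> min_coeff j
     | Suc i \<Rightarrow> coords a i * min_coeff j + (if j < r then coords (residue * quot_coeff j) i else 0))"

lemma residue_in_adjoin: "residue \<in> adjoin K \<alpha>"
  unfolding residue_def
  using adjoin_closed(3)[OF b adjoin_closed(5)[OF adjoin_closed(4)[OF a d]]] by simp

lemma coeff_matrix_in_K: "i < n \<Longrightarrow> coeff_matrix (Suc i) j \<in> K"
  by (auto simp: coeff_matrix_def
      intro!: K.add_mem K.mult_mem coords a min_coeff adjoin_closed(4) residue_in_adjoin quot_coeff_in_adjoin
        K.zero_mem)

text \<open>The coordinate columns of \<open>residue * quot_coeff j\<close> have a left inverse over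
  \<open>K\<close>. It is then adapted to the multiples of row 0 in the other rows, and completed by
  a row for the column of leading coefficients.\<close>

lemma left_inverse_exists:
  "\<exists>A. \<forall>j\<le>r. \<forall>k\<le>r. (\<Sum>i\<le>n. A j i * coeff_matrix i k) = (if j = k then 1 else 0)"
proof -
  let ?B = "\<lambda>i j. coords (residue * quot_coeff j) i"
  have mem: "residue * quot_coeff j \<in> adjoin K \<alpha>" for j
    by (intro adjoin_closed(4) residue_in_adjoin quot_coeff_in_adjoin)
  have "\<exists>A. (\<forall>j<r. \<forall>i<n. A j i \<in> K) \<and>
    (\<forall>j<r. \<forall>k<r. (\<Sum>i<n. A j i * ?B i k) = (if j = k then 1 else 0))"
  proof (rule K.left_inverse_exists)
    show "?B i j \<in> K" for i j using coords(1)[OF mem] .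
    fix c assume c: "\<And>j. j < r \<Longrightarrow> c j \<in> K" "\<And>i. i < n \<Longrightarrow> (\<Sum>j<r. ?B i j * c j) = 0"
    \<comment> \<open>A relation between the columns, recombined with the powers of \<alpha>, is a
      relation between the products \<open>residue * quot_coeff j\<close>; the nonzero residue
      cancels.\<close>
    have "residue * (\<Sum>j<r. c j * quot_coeff j) = (\<Sum>j<r. c j * (residue * quot_coeff j))"
      by (simp add: sum_distrib_left mult_ac)
    also have "\<dots> = (\<Sum>j<r. c j * (\<Sum>i<n. ?B i j * \<alpha> ^ i))"
      using coords(2)[OF mem] by simp
    also have "\<dots> = (\<Sum>i<n. (\<Sum>j<r. ?B i j * c j) * \<alpha> ^ i)"
      unfolding sum_distrib_left sum_distrib_right by (subst sum.swap) (simp add: mult_ac)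
    also have "\<dots> = 0" using c(2) by simp
    finally have "(\<Sum>j<r. c j * quot_coeff j) = 0" using unit by (simp add: residue_def)
    then show "\<forall>j<r. c j = 0" using quot_coeff_independent c(1) by blast
  qed
  then obtain A where A: "\<And>j k. j < r \<Longrightarrow> k < r \<Longrightarrow> (\<Sum>i<n. A j i * ?B i k) = (if j = k then 1 else 0)"
    by blast
  \<comment> \<open>The entry at 0 cancels the summands \<open>coords a i * min_coeff k\<close> of
    the other rows.\<close>
  define A1 where "A1 j i = (case i of 0 \<Rightarrow> - (\<Sum>i<n. A j i * coords a i) | Suc i \<Rightarrow> A j i)" for j i
  have split: "(\<Sum>i\<le>n. f i) = f 0 + (\<Sum>i<n. f (Suc i))" for f :: "nat \<Rightarrow> 'f"
    unfolding lessThan_Suc_atMost[symmetric] by (rule sum.lessThan_Suc_shift)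
  have A1: "(\<Sum>i\<le>n. A1 j i * coeff_matrix i k) = (if j = k then 1 else 0)" if "j < r" "k \<le> r" for j k
  proof -
    have "(\<Sum>i\<le>n. A1 j i * coeff_matrix i k) = (\<Sum>i<n. A j i * (if k < r then ?B i k else 0))"
      unfolding split A1_def coeff_matrix_def
      by (simp add: distrib_left sum.distrib sum_distrib_left sum_distrib_right mult_ac)
    then show ?thesis using that A by (cases "k < r") auto
  qed
  \<comment> \<open>For j = r: row 0 of the matrix is \<open>min_coeff\<close>; subtracting its
    lower entries with the rows already found leaves only \<open>min_coeff r = 1\<close>.\<close>
  define A2 where
    "A2 j i = (if j < r then A1 j i else (if i = 0 then 1 else 0) - (\<Sum>k<r. min_coeff k * A1 k i))" for j i
  have "(\<Sum>i\<le>n. A2 j i * coeff_matrix i k) = (if j = k then 1 else 0)" if "j \<le> r" "k \<le> r" for j k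
  proof (cases "j < r")
    case True
    then show ?thesis using A1 that by (simp add: A2_def)
  next
    case False
    have "(\<Sum>i\<le>n. A2 j i * coeff_matrix i k) = (\<Sum>i\<le>n. if i = 0 then coeff_matrix i k else 0) -
        (\<Sum>i\<le>n. \<Sum>l<r. min_coeff l * A1 l i * coeff_matrix i k)"
      unfolding sum_subtractf[symmetric] using False
      by (intro sum.cong) (auto simp: A2_def left_diff_distrib sum_distrib_right)
    also have "(\<Sum>i\<le>n. if i = 0 then coeff_matrix i k else 0) = min_coeff k"
      by (simp add: coeff_matrix_def)
    also have "(\<Sum>i\<le>n. \<Sum>l<r. min_coeff l * A1 l i * coeff_matrix i k) =
        (\<Sum>l<r. min_coeff l * (\<Sum>i\<le>n. A1 l i * coeff_matrix i k))"
      by (subst sum.swap) (simp add: sum_distrib_left mult_ac)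
    also have "\<dots> = (\<Sum>l<r. if l = k then min_coeff l else 0)"
      using that by (intro sum.cong) (auto simp: A1)
    finally show ?thesis using False that min_coeff(2) by auto
  qed
  then show ?thesis by blast
qed

definition inv_matrix :: "nat \<Rightarrow> nat \<Rightarrow> 'f" where
  "inv_matrix = (SOME A. \<forall>j\<le>r. \<forall>k\<le>r. (\<Sum>i\<le>n. A j i * coeff_matrix i k) = (if j = k then 1 else 0))"

sublocale chart: affine_chart n r inv_matrix coeff_matrix
proof
  show "(\<Sum>i\<le>n. inv_matrix j i * coeff_matrix i k) = (if j = k then 1 else 0)" if "j \<le> r" "k \<le> r" for j k
    using someI_ex[OF left_inverse_exists] that unfolding inv_matrix_def by blast
  show "coeff_matrix 0 r = 1" by (simp add: coeff_matrix_def min_coeff)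
qed (use r_pos polynomial_has_root in auto)

section \<open>The coordinate functions of the unit\<close>

definition numer :: "nat \<Rightarrow> 'f poly" where
  "numer i = (\<Sum>j\<le>r. monom (coeff_matrix (Suc i) j) j)"

lemma denom_eq: "chart.denom = min_poly"
  by (simp add: chart.denom_def min_poly_def coeff_matrix_def)

lemma coeff_numer: "coeff (numer i) j = (if j \<le> r then coeff_matrix (Suc i) j else 0)"
  by (simp add: numer_def coeff_sum)

lemma sum_numer:
  "(\<Sum>i<n. numer i * [:\<alpha> ^ i:]) = smult a min_poly + smult residue (\<Sum>j\<le>r. monom (quot_coeff j) j)"
proof (rule poly_eqI)
  fix k
  let ?q = "residue * quot_coeff k"
  have q: "?q \<in> adjoin K \<alpha>" by (intro adjoin_closed(4) residue_in_adjoin quot_coeff_in_adjoin)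
  have N: "coeff (\<Sum>j\<le>r. monom (quot_coeff j) j) k = quot_coeff k"
    using quot_coeff_eq_0 by (auto simp: coeff_sum)
  have "coeff (\<Sum>i<n. numer i * [:\<alpha> ^ i:]) k = (\<Sum>i<n. coeff (numer i) k * \<alpha> ^ i)"
    by (simp add: coeff_sum mult.commute)
  also have "\<dots> = a * min_coeff k + ?q"
  proof (cases "k \<le> r")
    case True
    have "(\<Sum>i<n. coeff (numer i) k * \<alpha> ^ i) =
      (\<Sum>i<n. coords a i * \<alpha> ^ i) * min_coeff k + (if k < r then \<Sum>i<n. coords ?q i * \<alpha> ^ i else 0)"
      using True
      by (simp add: coeff_numer coeff_matrix_def algebra_simps sum.distrib sum_distrib_left)
    then show ?thesis using coords(2)[OF a] coords(2)[OF q] quot_coeff_eq_0[of k] by auto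
  next
    case False
    then show ?thesis by (simp add: coeff_numer min_coeff(3) quot_coeff_eq_0)
  qed
  finally show "coeff (\<Sum>i<n. numer i * [:\<alpha> ^ i:]) k =
      coeff (smult a min_poly + smult residue (\<Sum>j\<le>r. monom (quot_coeff j) j)) k"
    by (simp add: N coeff_min_poly)
qed

lemma hyper_coords_unit:
  "hyper_coords K \<alpha> (Fract [:b, a:] [:d, 1:]) = (\<lambda>i. if i < n then Fract (numer i) min_poly else 0)"
  unfolding n_def
proof (rule hyper_coords_eq; unfold n_def[symmetric])
  have M0: "min_poly \<noteq> 0" using chart.denom_nonzero by (simp add: denom_eq)
  show "(if i < n then Fract (numer i) min_poly else 0) \<in> ratfuns_over K" if "i < n" for i
  proof -
    have "poly_over (numer i)" "poly_over min_poly"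
      using that min_coeff(1) coeff_matrix_in_K K.zero_mem
      by (auto simp: poly_over_def coeff_numer coeff_min_poly)
    then show ?thesis using that M0 unfolding ratfuns_over_iff by auto
  qed
  have "(\<Sum>i<n. (if i < n then Fract (numer i) min_poly else 0) * Fract [:\<alpha> ^ i:] 1) =
      (\<Sum>i<n. Fract (numer i * [:\<alpha> ^ i:]) min_poly)"
    by (intro sum.cong) auto
  also have "\<dots> = Fract (\<Sum>i<n. numer i * [:\<alpha> ^ i:]) min_poly" by (rule sum_Fract[OF M0])
  also have "\<dots> = Fract [:b, a:] [:d, 1:]"
  proof -
    define N where "N = (\<Sum>j\<le>r. monom (quot_coeff j) j)"
    define l where "l = [:d, 1:]"
    have M: "min_poly = l * N" using min_poly_factor by (simp add: N_def l_def)
    \<comment> \<open>The division a t + b = a (t + d) + residue; multiplied by the cofactor N it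
      compares the two fractions.\<close>
    have "[:b, a:] = smult a l + [:residue:]" by (simp add: l_def residue_def)
    then have "(smult a min_poly + smult residue N) * l = [:b, a:] * min_poly"
      unfolding M by (simp add: algebra_simps)
    then show ?thesis
      unfolding sum_numer N_def[symmetric] using M0 by (simp add: eq_fract l_def)
  qed
  finally show "Fract [:b, a:] [:d, 1:] =
      (\<Sum>i<n. (if i < n then Fract (numer i) min_poly else 0) * Fract [:\<alpha> ^ i:] 1)" ..
qed simp

lemma cone_point_numer: "i < n \<Longrightarrow> chart.cone_point 1 t (Suc i) = poly (numer i) t"
  by (simp add: chart.cone_point_def numer_def poly_sum poly_monom)

text \<open>A single coordinate may have a value at a root of \<open>min_poly\<close> after
  cancellation. All of them together cannot: then every numerator would vanish there as well, and
  \<open>cone_point 1 t\<close> would be the zero vector, which the left inverse excludes.\<close>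

lemma param_points_eq:
  "{x \<in> affine_space n. \<exists>t. \<forall>i<n. ratfun_val (hyper_coords K \<alpha> (Fract [:b, a:] [:d, 1:]) i) t (x i)}
    = chart.param_points"
proof (rule antisym; rule subsetI)
  have M0: "min_poly \<noteq> 0" using chart.denom_nonzero by (simp add: denom_eq)
  fix x
  assume "x \<in> {x \<in> affine_space n. \<exists>t. \<forall>i<n. ratfun_val (hyper_coords K \<alpha> (Fract [:b, a:] [:d, 1:]) i) t (x i)}"
  then obtain t where x: "x \<in> affine_space n"
    and t: "\<And>i. i < n \<Longrightarrow> ratfun_val (Fract (numer i) min_poly) t (x i)"
    by (auto simp: hyper_coords_unit)
  \<comment> \<open>The cross-multiplied identity holds for every admissible fraction, and also
    where \<open>min_poly\<close> vanishes.\<close>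
  have val: "poly (numer i) t = x i * poly min_poly t" if i: "i < n" for i
  proof -
    obtain p q where pq: "poly q t \<noteq> 0" "Fract (numer i) min_poly = Fract p q" "x i = poly p t / poly q t"
      using t[OF i] unfolding ratfun_val_def by blast
    then have "q \<noteq> 0" by auto
    then have "numer i * q = p * min_poly" using M0 pq(2) by (simp add: eq_fract)
    then have "poly (numer i) t * poly q t = poly p t * poly min_poly t" by (metis poly_mult)
    also have "\<dots> = x i * poly min_poly t * poly q t" using pq by simp
    finally show ?thesis using pq(1) by simp
  qed
  have nz: "poly min_poly t \<noteq> 0"
  proof
    assume z: "poly min_poly t = 0"
    have "chart.cone_point 1 t i = 0" for i
    proof (cases i)
      case 0
      then show ?thesis using z chart.poly_denom[of t] by (simp add: denom_eq)
    next
      case (Suc i')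
      then show ?thesis
        using z val cone_point_numer by (cases "i' < n") (auto simp: chart.cone_point_def)
    qed
    then have "chart.cone_point 1 t = 0" by auto
    then show False by (simp add: chart.cone_point_eq_0_iff)
  qed
  have "x = chart.point t"
  proof
    fix i
    show "x i = chart.point t i"
      using x val[of i] nz chart.poly_denom[of t]
      by (auto simp: chart.point_def cone_point_numer denom_eq affine_space_def)
  qed
  then show "x \<in> chart.param_points" using nz by (auto simp: chart.param_points_def denom_eq)
next
  fix x assume "x \<in> chart.param_points"
  then obtain t where t: "x = chart.point t" "poly min_poly t \<noteq> 0"
    by (auto simp: chart.param_points_def denom_eq)
  have "ratfun_val (Fract (numer i) min_poly) t (x i)" if "i < n" for i
    unfolding ratfun_val_def
    using that t chart.poly_denom[of t]
    by (intro exI[of _ "numer i"] exI[of _ min_poly])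
       (simp add: chart.point_def cone_point_numer denom_eq)
  then show "x \<in> {x \<in> affine_space n. \<exists>t. \<forall>i<n.
      ratfun_val (hyper_coords K \<alpha> (Fract [:b, a:] [:d, 1:]) i) t (x i)}"
    using t(1) chart.point_in_affine_space by (auto simp: hyper_coords_unit)
qed

lemma hypercircle_eq: "hypercircle K \<alpha> (Fract [:b, a:] [:d, 1:]) = chart.affine_curve"
  unfolding hypercircle_def Let_def chart.affine_curve_def n_def[symmetric] param_points_eq ..

end

theorem corollary3p2:
  fixes K L :: "'f::field_char_0 set" and \<alpha> a b d :: 'f and n r :: nat
    and U :: "(nat \<Rightarrow> 'f) set" and Y :: "(nat \<Rightarrow> 'f) set set"
  assumes "algebraic_closure (ring_of_type_algebra :: 'f ring) K"
    and "L = adjoin K \<alpha>"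
    and "n = ext_degree K L"
    and "a \<in> L" and "b \<in> L" and "d \<in> L" and "a * d - b \<noteq> 0"
    and "r = ext_degree K (adjoin K (- d))"
    and "U = hypercircle K \<alpha> (Fract [:b, a:] [:d, 1:])"
    and "Y = proj_closure n U"
  shows "(irreducible_curve (affine_alg_set n) U \<and> has_degree n Y r)
    \<and> ((\<exists>V. linear_variety n r V \<and> U \<subseteq> V) \<and> (\<nexists>V. linear_variety n (r - 1) V \<and> U \<subseteq> V))
    \<and> regular_curve n Y
    \<and> (\<forall>m. of_nat (hilbert_function n Y m) = poly (hilbert_polynomial n Y) (of_nat m)
           \<and> hilbert_function n Y m = m * r + 1)"
proof -
  interpret H: hypercircle_unit K \<alpha> a b d
    by (intro hypercircle_unit.intro base_field.intro hypercircle_unit_axioms.intro) (use assms in auto)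
  have n: "n = H.n" and r: "r = H.r" using assms by (simp_all add: H.n_def H.r_def)
  have U: "U = H.chart.affine_curve" using assms(9) H.hypercircle_eq by simp
  then have Y: "Y = H.chart.curve" using assms(10) n H.chart.proj_closure_affine_curve by simp
  show ?thesis
    unfolding n r Y unfolding U
    using H.chart.irreducible_curve_affine_curve H.chart.has_degree_curve
      H.chart.linear_variety_contains H.chart.not_in_smaller_linear_variety
      H.chart.regular_curve_curve
    by (simp add: H.chart.hilbert_function_curve H.chart.hilbert_polynomial_curve mult.commute)
qed

end
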